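(* Let $n\ge2$ and $0<\alpha<n$. Suppose that $\Omega$ satisfies the $L^{s;\beta}$-Dini smoothness condition $\mathfrak D_{s;\beta}$ with $n/(n-\alpha)<s\le\infty$ and $0<\beta\le1$. If $0<\alpha<1+n/p$, $1\le s'\le p<n/\alpha$, $1/q=1/p-\alpha/n$, $p/q<\kappa<1$ and $\omega$ is a weight with $\omega^{s'}\in A(p/s',q/s')$, then the operator $T_{\Omega,\alpha}$ is bounded from $\mathcal M^{p,\kappa}(\omega^p,\omega^q)$ to $\mathcal C^{\gamma_*,\ell}(\omega^q)$ with $1\le\ell<n/(n-\alpha)$, $\gamma_*:=n(\kappa/p-1/q)=\alpha-(1-\kappa)n/p$ and $\tau\cdot\gamma_*<\beta$, where $$\tau=\begin{cases}1+\dfrac{q/s'}{(p/s')'},& \text{if } s'<p<n/\alpha,\\[2mm] 1,&\text{if } s'=p<n/\alpha;\end{cases}$$ that is, there is a constant $C>0$, independent of $f$, such that $$\|T_{\Omega,\alpha}f\|_{\mathcal C^{\gamma_*,\ell}(\omega^q)}\le C\,\|f\|_{\mathcal M^{p,\kappa}(\omega^p,\omega^q)}\quad\text{for every } f\in\mathcal M^{p,\kappa}(\omega^p,\omega^q).$$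
   Context: Conventions. For an exponent $r$, $r'$ is the conjugate exponent: $1/r+1/r'=1$, with $1'=\infty$ and $\infty'=1$. $m(E)$ is Lebesgue measure on $\mathbb R^n$, and $\nu(E):=\int_E\nu(x)\,dx$ for a weight $\nu$ (in particular $\omega^q(E)=\int_E\omega(x)^q\,dx$). Balls $B$ are open Euclidean balls, and $h_B:=\frac1{m(B)}\int_B h(y)\,dy$. $\mathbb S^{n-1}$ is the unit sphere of $\mathbb R^n$ with normalized Lebesgue measure $d\sigma$. A weight is a nonnegative locally integrable function on $\mathbb R^n$ that takes values in $(0,\infty)$ almost everywhere. Operator. For $\Omega$ homogeneous of degree zero on $\mathbb R^n$ and integrable on $\mathbb S^{n-1}$, $$T_{\Omega,\alpha}f(x):=\int_{\mathbb R^n}\frac{\Omega(x-y)}{|x-y|^{n-\alpha}}f(y)\,dy.$$ Dini condition. For $1\le s<\infty$ set $$\omega_s(\delta):=\sup_{|\rho|<\delta}\Big(\int_{\mathbb S^{n-1}}|\Omega(\rho x')-\Omega(x')|^s\,d\sigma(x')\Big)^{1/s},$$ and for $s=\infty$ set $\omega_\infty(\delta):=\sup_{|\rho|<\delta,\,x'\in\mathbb S^{n-1}}|\Omega(\rho x')-\Omega(x')|$, where $\rho$ ranges over rotations of $\mathbb R^n$ and $|\rho|:=\sup_{x'\in\mathbb S^{n-1}}|\rho x'-x'|$. For $1\le s\le\infty$ and $0\le\beta\le1$, $\Omega$ satisfies $\mathfrak D_{s;\beta}$ if $\Omega$ is homogeneous of degree zero on $\mathbb R^n$, $\Omega\in L^s(\mathbb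 S^{n-1})$, and $\int_0^1\frac{\omega_s(\delta)}{\delta^{1+\beta}}\,d\delta<+\infty$. Weight classes. For $1<a<b<\infty$, a weight $w$ belongs to $A(a,b)$ if there is $C>0$ such that for every ball $B$, $$\Big(\frac1{m(B)}\int_B w(x)^b\,dx\Big)^{1/b}\Big(\frac1{m(B)}\int_B w(x)^{-a'}dx\Big)^{1/a'}\le C.$$ For $1<b<\infty$, $w$ belongs to $A(1,b)$ if there is $C>0$ such that for every ball $B$, $$\Big(\frac1{m(B)}\int_B w(x)^b\,dx\Big)^{1/b}\Big[\operatorname*{ess\,sup}_{x\in B}\frac1{w(x)}\Big]\le C.$$ Spaces. For $1\le p<\infty$, $0<\kappa<1$ and weights $\mu,\nu$, the weighted Morrey space $\mathcal M^{p,\kappa}(\mu,\nu)$ is the set of locally integrable $f$ on $\mathbb R^n$ with $$\|f\|_{\mathcal M^{p,\kappa}(\mu,\nu)}:=\sup_{B}\Big(\frac1{\nu(B)^\kappa}\int_B|f(x)|^p\mu(x)\,dx\Big)^{1/p}<+\infty.$$ For $1\le\ell<\infty$, $0\le\gamma\le1$ and a weight $\nu$, the weighted Campanato space $\mathcal C^{\gamma,\ell}(\nu)$ is the set of locally integrable $h$ on $\mathbb R^n$ with $$\|h\|_{\mathcal C^{\gamma,\ell}(\nu)}:=\sup_B\frac1{\nu(B)^{\gamma/n}}\Big(\frac1{m(B)}\int_B|h(x)-h_B|^\ell dx\Big)^{1/\ell}<+\infty.$$ Both suprema are over all balls $B\subset\mathbb R^n$.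
   Formalization: For some f in the Morrey space (e.g. Ω=ω=1, f=|x|^{-(1-κ)n/p}) the integral defining T_{Ω,α}f diverges at every x; here T_{Ω,α}f(x) is taken to be 0 wherever the integral does not converge absolutely, so the claim has content only for those f whose integral converges. *)

theory Defs
  imports "HOL-Analysis.Analysis" "HOL-Probability.Essential_Supremum"
begin

(* Real powers of extended nonnegative reals; only used with exponents a > 0,
   so infinity ^ a = infinity. *)
definition epow :: "ennreal \<Rightarrow> real \<Rightarrow> ennreal" (infixr "epow" 80) where
  "x epow a = (if x = \<infinity> then \<infinity> else ennreal (enn2real x powr a))"

definition conj_exp :: "ennreal \<Rightarrow> ennreal" where
  "conj_exp r = inverse (1 - inverse r)"

lemma conj_exp_one: "conj_exp 1 = \<infinity>"
  by (simp add: conj_exp_def)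

lemma conj_exp_infinity: "conj_exp \<infinity> = 1"
  by (simp add: conj_exp_def)

lemma conj_exp_real:
  assumes "1 < r"
  shows "conj_exp (ennreal r) = ennreal (r / (r - 1))"
proof -
  have "1 - inverse (ennreal r) = ennreal (1 - inverse r)"
    using assms by (simp add: inverse_ennreal ennreal_minus flip: ennreal_1)
  moreover have "0 < 1 - inverse r"
    using assms by (simp add: field_simps)
  moreover have "inverse (1 - inverse r) = r / (r - 1)"
    using assms by (simp add: field_simps)
  ultimately show ?thesis
    by (simp add: conj_exp_def inverse_ennreal)
qed

definition locally_integrable :: "(real^'n \<Rightarrow> 'b::{banach,second_countable_topology}) \<Rightarrow> bool" where
  "locally_integrable f \<longleftrightarrow> (\<forall>K. compact K \<longrightarrow> f absolutely_integrable_on K)"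

definition weight :: "(real^'n \<Rightarrow> real) \<Rightarrow> bool" where
  "weight w \<longleftrightarrow> locally_integrable w \<and> (\<forall>x. 0 \<le> w x) \<and> (AE x in lebesgue. 0 < w x)"

definition wmeas :: "(real^'n \<Rightarrow> real) \<Rightarrow> (real^'n) set \<Rightarrow> ennreal" where
  "wmeas \<nu> E = (\<integral>\<^sup>+x\<in>E. ennreal (\<nu> x) \<partial>lebesgue)"

text \<open>Averages of nonnegative functions take values in \<^typ>\<open>ennreal\<close>, so that a divergent
  integral is infinite; \<open>ball_mean\<close> is the mean \<open>h\<^sub>B\<close> of a (locally integrable) function.\<close>

definition ball_avg :: "real^'n \<Rightarrow> real \<Rightarrow> (real^'n \<Rightarrow> real) \<Rightarrow> ennreal" where
  "ball_avg c r g = (\<integral>\<^sup>+x\<in>ball c r. ennreal (g x) \<partial>lebesgue) / emeasure lebesgue (ball c r)"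

definition ball_mean :: "real^'n \<Rightarrow> real \<Rightarrow> (real^'n \<Rightarrow> complex) \<Rightarrow> complex" where
  "ball_mean c r h = (LINT x:ball c r|lebesgue. h x) / of_real (measure lebesgue (ball c r))"

text \<open>Normalized surface measure on the unit sphere, obtained from polar coordinates: the measure
  of \<open>E\<close> is the proportion of the unit ball occupied by the cone over \<open>E\<close>. It is a completed
  measure on the whole space, carried by \<^term>\<open>sphere 0 1\<close>.\<close>

definition sphere_measure :: "(real^'n) measure" where
  "sphere_measure = completion (distr (uniform_measure lborel (ball 0 1)) borel sgn)"

definition homogeneous_zero :: "(real^'n \<Rightarrow> complex) \<Rightarrow> bool" where
  "homogeneous_zero \<Omega> \<longleftrightarrow> (\<forall>c>0. \<forall>x. \<Omega> (c *\<^sub>R x) = \<Omega> x)"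

definition sphere_L :: "ennreal \<Rightarrow> (real^'n \<Rightarrow> complex) set" where
  "sphere_L s = {\<Omega>. \<Omega> \<in> borel_measurable sphere_measure \<and>
     (if s = \<infinity> then esssup sphere_measure (\<lambda>x. ennreal (norm (\<Omega> x))) < \<infinity>
      else (\<integral>\<^sup>+x. ennreal (norm (\<Omega> x) powr enn2real s) \<partial>sphere_measure) < \<infinity>)}"

definition rotation_size :: "real^'n^'n \<Rightarrow> real" where
  "rotation_size Q = (SUP x\<in>sphere 0 1. norm (Q *v x - x))"

definition dini_modulus :: "ennreal \<Rightarrow> (real^'n \<Rightarrow> complex) \<Rightarrow> real \<Rightarrow> ennreal" where
  "dini_modulus s \<Omega> \<delta> =
     (SUP Q\<in>{Q. rotation_matrix Q \<and> rotation_size Q < \<delta>}.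
        if s = \<infinity> then (SUP x\<in>sphere 0 1. ennreal (norm (\<Omega> (Q *v x) - \<Omega> x)))
        else (\<integral>\<^sup>+x. ennreal (norm (\<Omega> (Q *v x) - \<Omega> x) powr enn2real s) \<partial>sphere_measure)
               epow (1 / enn2real s))"

definition dini :: "ennreal \<Rightarrow> real \<Rightarrow> (real^'n \<Rightarrow> complex) \<Rightarrow> bool" where
  "dini s \<beta> \<Omega> \<longleftrightarrow> homogeneous_zero \<Omega> \<and> \<Omega> \<in> sphere_L s \<and>
     (\<integral>\<^sup>+\<delta>\<in>{0<..<1}. dini_modulus s \<Omega> \<delta> / ennreal (\<delta> powr (1 + \<beta>)) \<partial>lebesgue) < \<infinity>"

text \<open>The integral is a Lebesgue integral. As always with the Bochner integral of the library, it is
  set to 0 at those \<open>x\<close> where it does not converge absolutely.\<close>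

definition T_op :: "(real^'n \<Rightarrow> complex) \<Rightarrow> real \<Rightarrow> (real^'n \<Rightarrow> complex) \<Rightarrow> real^'n \<Rightarrow> complex" where
  "T_op \<Omega> \<alpha> f x =
     (LINT y|lebesgue. \<Omega> (x - y) / of_real (norm (x - y) powr (real CARD('n) - \<alpha>)) * f y)"

definition A_class :: "real \<Rightarrow> real \<Rightarrow> (real^'n \<Rightarrow> real) set" where
  "A_class a b = {w. weight w \<and> (\<exists>C::real. C > 0 \<and> (\<forall>c r. r > 0 \<longrightarrow>
     ball_avg c r (\<lambda>x. w x powr b) epow (1 / b) *
     (if a = 1 then esssup (restrict_space lebesgue (ball c r)) (\<lambda>x. ennreal (1 / w x))
      else let a' = enn2real (conj_exp (ennreal a))
           in ball_avg c r (\<lambda>x. w x powr (- a')) epow (1 / a'))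
     \<le> ennreal C))}"

definition morrey_norm ::
  "real \<Rightarrow> real \<Rightarrow> (real^'n \<Rightarrow> real) \<Rightarrow> (real^'n \<Rightarrow> real) \<Rightarrow> (real^'n \<Rightarrow> complex) \<Rightarrow> ennreal" where
  "morrey_norm p \<kappa> \<mu> \<nu> f =
     (SUP (c, r)\<in>UNIV \<times> {0<..}.
        ((\<integral>\<^sup>+x\<in>ball c r. ennreal (norm (f x) powr p * \<mu> x) \<partial>lebesgue)
           / (wmeas \<nu> (ball c r) epow \<kappa>)) epow (1 / p))"

definition morrey ::
  "real \<Rightarrow> real \<Rightarrow> (real^'n \<Rightarrow> real) \<Rightarrow> (real^'n \<Rightarrow> real) \<Rightarrow> (real^'n \<Rightarrow> complex) set" where
  "morrey p \<kappa> \<mu> \<nu> = {f. locally_integrable f \<and> morrey_norm p \<kappa> \<mu> \<nu> f < \<infinity>}"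

definition campanato_norm ::
  "real \<Rightarrow> real \<Rightarrow> (real^'n \<Rightarrow> real) \<Rightarrow> (real^'n \<Rightarrow> complex) \<Rightarrow> ennreal" where
  "campanato_norm \<gamma> l \<nu> h =
     (SUP (c, r)\<in>UNIV \<times> {0<..}.
        ball_avg c r (\<lambda>x. norm (h x - ball_mean c r h) powr l) epow (1 / l)
          / (wmeas \<nu> (ball c r) epow (\<gamma> / real CARD('n))))"

definition campanato ::
  "real \<Rightarrow> real \<Rightarrow> (real^'n \<Rightarrow> real) \<Rightarrow> (real^'n \<Rightarrow> complex) set" where
  "campanato \<gamma> l \<nu> = {h. locally_integrable h \<and> campanato_norm \<gamma> l \<nu> h < \<infinity>}"

end

theory Submission
  imports Defs
begin

text \<open>
  Write \<open>K x = \<Omega> x / norm x powr (n - \<alpha>)\<close> for the kernel, \<open>V B\<close> for the measure of a ball \<open>B\<close> with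
  density \<open>\<omega> powr q\<close> and \<open>N\<close> for the Morrey norm of \<open>f\<close>. On a ball \<open>B\<close> with centre \<open>c\<close> and radius \<open>r\<close>
  the function \<open>T f\<close> is compared with the constant \<open>z\<close>, the integral of \<open>K (c - y) * f y\<close> over the
  \<open>y\<close> far from \<open>B\<close>. The difference is a near part, the integral of \<open>K (x - y) * f y\<close> over a fixed
  multiple of \<open>B\<close>, and a far part, the integral of \<open>(K (x - y) - K (c - y)) * f y\<close> over the rest.

  The weight enters through two consequences of its class condition. By Hoelder's inequality
  the \<open>L\<^sup>s'\<close> mean of \<open>f\<close> over any ball of radius \<open>r\<close> is at most a constant times
  \<open>N * r powr (- \<alpha>) * V B powr (\<gamma> / n)\<close> (\<open>morrey_local_power_bound\<close>), and \<open>V\<close> grows by at most a constant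
  times \<open>t powr (n * \<tau>)\<close> when the radius is multiplied by \<open>t\<close> (\<open>A_class_growth\<close>). The near part is
  controlled by Young's convolution inequality, because \<open>K\<close> is locally in \<open>L\<^sup>l\<close> (\<open>near_part\<close>,
  \<open>kernel_local_power\<close>). The far part is split into dyadic annuli, and Hoelder's inequality with
  exponents \<open>s\<close> and \<open>s'\<close> bounds the \<open>j\<close>-th piece by \<open>N * V B powr (\<gamma> / n)\<close> times
  \<open>2 powr (\<tau> * \<gamma> * j) * (2 powr (- j) + \<omega>\<^sub>s (2 powr (- j)))\<close>, up to a fixed shift of \<open>j\<close>; since
  \<open>\<tau> * \<gamma> < \<beta> \<le> 1\<close> and \<open>\<Omega>\<close> satisfies the Dini condition, these terms are summable (\<open>far_part\<close>).

  The last bound needs the \<open>L\<^sup>s\<close> size of \<open>\<Omega> (y + h) - \<Omega> y\<close>, a difference under a translation,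
  whereas the Dini modulus speaks of rotations. For finite \<open>s\<close> the value \<open>\<Omega> (y + h)\<close> is compared with
  \<open>\<Omega> y\<close> through an average of \<open>\<Omega> u\<close> over a small ball of points \<open>u\<close>, so that it suffices to average
  \<open>\<Omega> u - \<Omega> w\<close> over \<open>u\<close> near \<open>w\<close>. Up to a scalar every such \<open>u\<close> is the image of \<open>w\<close> under the product
  of the reflections along a coordinate vector \<open>e\<close> and along some \<open>b\<close> near \<open>e\<close>. If the coordinate of \<open>w\<close>
  along \<open>e\<close> is not small, then passing from \<open>u\<close> to \<open>b\<close> distorts volumes by a bounded factor only.
  After this substitution Tonelli's theorem leaves, for each fixed \<open>b\<close>, one rotation close to the
  identity (\<open>translation_le_rotations\<close>). For infinite \<open>s\<close> one such rotation suffices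
  (\<open>dini_pointwise\<close>).

  The integral defining \<open>T f\<close> need not converge for a function in the Morrey space. The estimate of
  the far part shows, however, that if it converges absolutely at one point, then it does so almost
  everywhere. In the remaining case the integral takes its default value 0 at every point and
  nothing is left to prove (\<open>singular_integral_oscillation\<close>).
\<close>

section \<open>Hoelder's inequality\<close>

text \<open>The norms are replaced by real bounds \<open>A\<close> and \<open>B\<close> for them. In this form the inequality needs no
  roots of extended reals and no convention for products of 0 and \<open>\<infinity>\<close>.\<close>

lemma nn_integral_Holder_bound:
  fixes f g :: "'a \<Rightarrow> real"
  assumes meas [measurable]: "f \<in> borel_measurable M" "g \<in> borel_measurable M"
    and nonneg: "\<And>x. 0 \<le> f x" "\<And>x. 0 \<le> g x"
    and exps: "1 < a" "1 < b" "1 / a + 1 / b = 1"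
    and "0 \<le> A" "0 \<le> B"
    and fA: "(\<integral>\<^sup>+x. ennreal (f x powr a) \<partial>M) \<le> ennreal (A powr a)"
    and gB: "(\<integral>\<^sup>+x. ennreal (g x powr b) \<partial>M) \<le> ennreal (B powr b)"
  shows "(\<integral>\<^sup>+x. ennreal (f x * g x) \<partial>M) \<le> ennreal (A * B)"
proof (cases "A = 0 \<or> B = 0")
  case True
  have "AE x in M. f x * g x = 0"
  proof -
    from True consider "A = 0" | "B = 0" by auto
    then show ?thesis
    proof cases
      case 1
      then have "(\<integral>\<^sup>+x. ennreal (f x powr a) \<partial>M) = 0" using fA by simp
      then have "AE x in M. ennreal (f x powr a) = 0" by (subst (asm) nn_integral_0_iff_AE) auto
      then show ?thesis by (rule AE_mp) (auto simp: ennreal_eq_0_iff)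
    next
      case 2
      then have "(\<integral>\<^sup>+x. ennreal (g x powr b) \<partial>M) = 0" using gB by simp
      then have "AE x in M. ennreal (g x powr b) = 0" by (subst (asm) nn_integral_0_iff_AE) auto
      then show ?thesis by (rule AE_mp) (auto simp: ennreal_eq_0_iff)
    qed
  qed
  then have "(\<integral>\<^sup>+x. ennreal (f x * g x) \<partial>M) = (\<integral>\<^sup>+x. 0 \<partial>M)"
    by (intro nn_integral_cong_AE) auto
  then show ?thesis by simp
next
  case False
  with \<open>0 \<le> A\<close> \<open>0 \<le> B\<close> have AB: "0 < A" "0 < B" by auto
  have Young: "f x * g x \<le> A * B * (f x powr a / (A powr a * a) + g x powr b / (B powr b * b))" for x
  proof -
    have "(f x / A) * (g x / B) \<le> (f x / A) powr a / a + (g x / B) powr b / b"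
      using Youngs_inequality[of a b "f x / A" "g x / B"] exps AB nonneg by auto
    then have "A * B * ((f x / A) * (g x / B)) \<le> A * B * ((f x / A) powr a / a + (g x / B) powr b / b)"
      using AB by (intro mult_left_mono) auto
    then show ?thesis using AB nonneg[of x] by (simp add: powr_divide)
  qed
  have "(\<integral>\<^sup>+x. ennreal (f x * g x) \<partial>M)
      \<le> (\<integral>\<^sup>+x. ennreal (A * B / (A powr a * a)) * ennreal (f x powr a)
              + ennreal (A * B / (B powr b * b)) * ennreal (g x powr b) \<partial>M)"
  proof (rule nn_integral_mono)
    fix x
    have "ennreal (f x * g x) \<le> ennreal (A * B / (A powr a * a) * (f x powr a) + A * B / (B powr b * b) * (g x powr b))"
      using Young[of x] by (intro ennreal_leI) (simp add: algebra_simps)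
    also have "\<dots> = ennreal (A * B / (A powr a * a)) * ennreal (f x powr a)
              + ennreal (A * B / (B powr b * b)) * ennreal (g x powr b)"
      using AB exps by (subst ennreal_plus) (auto simp: ennreal_mult[symmetric])
    finally show "ennreal (f x * g x) \<le> \<dots>" .
  qed
  also have "\<dots> = ennreal (A * B / (A powr a * a)) * (\<integral>\<^sup>+x. ennreal (f x powr a) \<partial>M)
              + ennreal (A * B / (B powr b * b)) * (\<integral>\<^sup>+x. ennreal (g x powr b) \<partial>M)"
    by (simp add: nn_integral_add nn_integral_cmult)
  also have "\<dots> \<le> ennreal (A * B / (A powr a * a)) * ennreal (A powr a)
              + ennreal (A * B / (B powr b * b)) * ennreal (B powr b)"
    by (intro add_mono mult_left_mono fA gB) auto
  also have "\<dots> = ennreal (A * B / a + A * B / b)"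
    using AB exps by (simp flip: ennreal_mult ennreal_plus)
  also have "A * B / a + A * B / b = A * B * (1 / a + 1 / b)"
    by (simp add: algebra_simps)
  finally show ?thesis using exps by simp
qed

section \<open>Maps that do not contract distances\<close>

lemma emeasure_UN_countable_subadditive:
  assumes "countable I" and X: "\<And>i. i \<in> I \<Longrightarrow> X i \<in> sets M"
  shows "emeasure M (\<Union>i\<in>I. X i) \<le> (\<integral>\<^sup>+i. emeasure M (X i) \<partial>count_space I)"
proof -
  define J where "J = to_nat_on I ` I"
  define f where "f n = (if n \<in> J then X (from_nat_into I n) else {})" for n
  have inj: "inj_on (to_nat_on I) I" using \<open>countable I\<close> by (rule inj_on_to_nat_on)
  have f_eq: "f (to_nat_on I i) = X i" if "i \<in> I" for i
    using that \<open>countable I\<close> by (auto simp: f_def J_def)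
  have "(\<Union>i\<in>I. X i) \<subseteq> (\<Union>n. f n)" using f_eq by blast
  moreover have f_sets: "range f \<subseteq> sets M"
    using f_eq X by (auto simp: f_def J_def \<open>countable I\<close>)
  ultimately have "emeasure M (\<Union>i\<in>I. X i) \<le> emeasure M (\<Union>n. f n)"
    by (intro emeasure_mono) auto
  also have "\<dots> \<le> (\<Sum>n. emeasure M (f n))"
    using f_sets by (rule emeasure_subadditive_countably)
  also have "\<dots> = (\<integral>\<^sup>+n. emeasure M (f n) * indicator J n \<partial>count_space UNIV)"
    by (auto simp: nn_integral_count_space_nat f_def intro!: suminf_cong)
  also have "\<dots> = (\<integral>\<^sup>+n. emeasure M (f n) \<partial>count_space J)"
    by (simp add: nn_integral_count_space_indicator)
  also have "\<dots> = (\<integral>\<^sup>+i. emeasure M (f (to_nat_on I i)) \<partial>count_space I)"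
    using inj by (intro nn_integral_bij_count_space[symmetric]) (auto simp: bij_betw_def J_def)
  also have "\<dots> = (\<integral>\<^sup>+i. emeasure M (X i) \<partial>count_space I)"
    by (intro nn_integral_cong) (auto simp: f_eq)
  finally show ?thesis .
qed

lemma emeasure_cbox_equal_sides:
  fixes c d :: "'a::euclidean_space"
  assumes "\<And>i. i \<in> Basis \<Longrightarrow> d \<bullet> i - c \<bullet> i = \<sigma>" "0 < \<sigma>"
  shows "emeasure lborel (cbox c d) = ennreal (\<sigma> ^ DIM('a))"
  using assms by (subst emeasure_lborel_cbox) (auto simp: inner_diff_left algebra_simps)

text \<open>The preimage of a cube of side \<open>t\<close> has diameter at most \<open>L\<close> times that of the cube, so it fits into
  a ball of volume comparable to \<open>t ^ DIM('a)\<close>; outer regularity and a covering of an open set by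
  dyadic cubes extend this from cubes to Borel sets. The lemma serves as a change of variables
  without derivatives or determinants.\<close>

lemma emeasure_vimage_expanding:
  fixes \<psi> :: "'a::euclidean_space \<Rightarrow> 'a"
  assumes [measurable]: "\<psi> \<in> borel_measurable borel" "B \<in> sets borel" "E \<in> sets borel"
    and L: "0 < L" and exp: "\<And>u v. u \<in> B \<Longrightarrow> v \<in> B \<Longrightarrow> dist u v \<le> L * dist (\<psi> u) (\<psi> v)"
  shows "emeasure lborel (B \<inter> \<psi> -` E)
    \<le> ennreal (unit_ball_vol DIM('a) * (L * DIM('a)) ^ DIM('a)) * emeasure lborel E"
    (is "_ \<le> ennreal ?C * _")
proof -
  have C: "0 \<le> ?C" using L by (intro mult_nonneg_nonneg unit_ball_vol_nonneg) auto
  have bounded_case: "emeasure lborel (B \<inter> \<psi> -` E') \<le> ennreal ?C * emeasure lborel E'"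
    if [measurable]: "E' \<in> sets borel" and E'sub: "E' \<subseteq> cbox (- (k *\<^sub>R One)) (k *\<^sub>R One)" "0 < k" for E' and k :: real
  proof (rule ennreal_le_epsilon)
    fix e :: real assume "0 < e"
    define e' where "e' = e / (?C + 1)"
    have e': "0 < e'" "?C * e' \<le> e" using \<open>0 < e\<close> C by (auto simp: e'_def field_simps)
    obtain U where U: "open U" "E' \<subseteq> U" "emeasure lborel (U - E') < ennreal e'"
      using outer_regular_lborel[of E' e'] e' by auto
    obtain g where g: "gauge g" "\<And>x. x \<in> U \<Longrightarrow> g x \<subseteq> U"
    proof
      show "gauge (\<lambda>x. if x \<in> U then U else UNIV)" using U by (auto simp: gauge_def)
    qed auto
    have ne: "box (- (k *\<^sub>R One)) (k *\<^sub>R One :: 'a) \<noteq> {}"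
      using \<open>0 < k\<close> by (auto simp: box_ne_empty)
    obtain \<D> where D: "countable \<D>"
      "\<And>K. K \<in> \<D> \<Longrightarrow> interior K \<noteq> {} \<and> (\<exists>c d. K = cbox c d)"
      "pairwise (\<lambda>A B. interior A \<inter> interior B = {}) \<D>"
      "\<And>K. K \<in> \<D> \<Longrightarrow> \<exists>x \<in> E' \<inter> K. K \<subseteq> g x"
      "\<And>u v. cbox u v \<in> \<D> \<Longrightarrow> \<exists>n. \<forall>i \<in> Basis. v \<bullet> i - u \<bullet> i = ((k *\<^sub>R One) \<bullet> i - (-(k *\<^sub>R One)) \<bullet> i) / 2^n"
      "E' \<subseteq> \<Union>\<D>"
      using covering_lemma[OF E'sub(1) ne g(1)] by metis
    have KU: "K \<subseteq> U" if "K \<in> \<D>" for K using D(4)[OF that] U(2) g(2) by blast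
    have Kbound: "emeasure lborel (B \<inter> \<psi> -` K) \<le> ennreal ?C * emeasure lborel (interior K)"
      and Kmeas: "B \<inter> \<psi> -` K \<in> sets lborel" if KD: "K \<in> \<D>" for K
    proof -
      obtain c d where K: "K = cbox c d" using D(2)[OF KD] by auto
      show Km: "B \<inter> \<psi> -` K \<in> sets lborel"
        using measurable_sets[OF assms(1), of K] K by auto
      obtain m where m: "\<And>i. i \<in> Basis \<Longrightarrow> d \<bullet> i - c \<bullet> i = (2 * k) / 2 ^ m"
        using D(5)[of c d] KD K by (auto simp: inner_simps)
      define \<sigma> where "\<sigma> = (2 * k) / 2 ^ m"
      have \<sigma>: "0 < \<sigma>" using \<open>0 < k\<close> by (simp add: \<sigma>_def)
      have "emeasure lborel (interior K) = emeasure lborel K"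
        using K by (simp add: interior_cbox emeasure_lborel_box_eq emeasure_lborel_cbox_eq)
      then have mK: "emeasure lborel (interior K) = ennreal (\<sigma> ^ DIM('a))"
        using emeasure_cbox_equal_sides[of d c \<sigma>] m \<sigma> K by (simp add: \<sigma>_def)
      show "emeasure lborel (B \<inter> \<psi> -` K) \<le> ennreal ?C * emeasure lborel (interior K)"
      proof (cases "B \<inter> \<psi> -` K = {}")
        case False
        then obtain u0 where u0: "u0 \<in> B" "\<psi> u0 \<in> K" by auto
        have "B \<inter> \<psi> -` K \<subseteq> cball u0 (L * (DIM('a) * \<sigma>))"
        proof
          fix u assume u: "u \<in> B \<inter> \<psi> -` K"
          have "dist (\<psi> u0) (\<psi> u) \<le> (\<Sum>i\<in>Basis. \<bar>(\<psi> u0 - \<psi> u) \<bullet> i\<bar>)"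
            unfolding dist_norm by (rule norm_le_l1)
          also have "\<dots> \<le> (\<Sum>i\<in>(Basis::'a set). \<sigma>)"
          proof (rule sum_mono)
            fix i :: 'a assume i: "i \<in> Basis"
            have "c \<bullet> i \<le> \<psi> u0 \<bullet> i" "\<psi> u0 \<bullet> i \<le> d \<bullet> i" "c \<bullet> i \<le> \<psi> u \<bullet> i" "\<psi> u \<bullet> i \<le> d \<bullet> i"
              using u u0 i K by (auto simp: mem_box)
            then show "\<bar>(\<psi> u0 - \<psi> u) \<bullet> i\<bar> \<le> \<sigma>" using m[OF i] by (simp add: inner_diff_left \<sigma>_def)
          qed
          finally have "dist (\<psi> u0) (\<psi> u) \<le> DIM('a) * \<sigma>" by simp
          then have "L * dist (\<psi> u0) (\<psi> u) \<le> L * (DIM('a) * \<sigma>)" using L by (intro mult_left_mono) auto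
          then show "u \<in> cball u0 (L * (DIM('a) * \<sigma>))" using exp[of u0 u] u u0 by auto
        qed
        then have "emeasure lborel (B \<inter> \<psi> -` K) \<le> emeasure lborel (cball u0 (L * (DIM('a) * \<sigma>)))"
          by (intro emeasure_mono) auto
        also have "\<dots> = ennreal (unit_ball_vol DIM('a) * (L * (DIM('a) * \<sigma>)) ^ DIM('a))"
          using L \<sigma> by (intro emeasure_cball) auto
        also have "\<dots> = ennreal (?C * \<sigma> ^ DIM('a))" by (simp add: power_mult_distrib mult_ac)
        also have "\<dots> = ennreal ?C * ennreal (\<sigma> ^ DIM('a))" using C \<sigma> by (intro ennreal_mult) auto
        finally show ?thesis using mK by simp
      qed auto
    qed
    have "emeasure lborel (B \<inter> \<psi> -` E') \<le> emeasure lborel (\<Union>K\<in>\<D>. B \<inter> \<psi> -` K)"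
      using D(1,6) Kmeas by (intro emeasure_mono sets.countable_UN') (blast, auto)
    also have "\<dots> \<le> (\<integral>\<^sup>+K. emeasure lborel (B \<inter> \<psi> -` K) \<partial>count_space \<D>)"
      using D(1) Kmeas by (intro emeasure_UN_countable_subadditive) auto
    also have "\<dots> \<le> (\<integral>\<^sup>+K. ennreal ?C * emeasure lborel (interior K) \<partial>count_space \<D>)"
      by (intro nn_integral_mono) (auto simp: Kbound)
    also have "\<dots> = ennreal ?C * (\<integral>\<^sup>+K. emeasure lborel (interior K) \<partial>count_space \<D>)"
      by (intro nn_integral_cmult) auto
    also have "(\<integral>\<^sup>+K. emeasure lborel (interior K) \<partial>count_space \<D>) = emeasure lborel (\<Union>K\<in>\<D>. interior K)"
      using D(1,3) by (intro emeasure_UN_countable[symmetric])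
        (auto simp: disjoint_family_on_def pairwise_def)
    also have "\<dots> \<le> emeasure lborel U"
      using KU interior_subset U(1) by (intro emeasure_mono) (blast, auto)
    also have "\<dots> = emeasure lborel (E' \<union> (U - E'))" using U by (intro arg_cong[where f="emeasure lborel"]) auto
    also have "\<dots> \<le> emeasure lborel E' + emeasure lborel (U - E')"
      using U by (intro emeasure_subadditive) auto
    also have "\<dots> \<le> emeasure lborel E' + ennreal e'" using U(3) by (intro add_left_mono) auto
    finally have "emeasure lborel (B \<inter> \<psi> -` E') \<le> ennreal ?C * (emeasure lborel E' + ennreal e')"
      by (simp add: mult_left_mono)
    also have "\<dots> = ennreal ?C * emeasure lborel E' + ennreal (?C * e')"
      using C e' by (simp add: distrib_left ennreal_mult)
    also have "\<dots> \<le> ennreal ?C * emeasure lborel E' + ennreal e"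
      using e' by (intro add_left_mono ennreal_leI) auto
    finally show "emeasure lborel (B \<inter> \<psi> -` E') \<le> ennreal ?C * emeasure lborel E' + ennreal e" .
  qed
  \<comment> \<open>Exhaustion by cubes removes the boundedness of \<open>E\<close>.\<close>
  define Q where "Q k = E \<inter> cbox (- (real (Suc k) *\<^sub>R One)) (real (Suc k) *\<^sub>R One)" for k
  have Q [measurable]: "Q k \<in> sets borel" for k by (auto simp: Q_def)
  have Qm: "B \<inter> \<psi> -` Q k \<in> sets lborel" for k
    using measurable_sets[OF assms(1), of "Q k"] by auto
  have UQ: "(\<Union>k. Q k) = E"
  proof -
    have "x \<in> (\<Union>k. Q k)" if "x \<in> E" for x
    proof -
      obtain k where k: "norm x \<le> real k" using real_arch_simple by blast
      have "- real (Suc k) \<le> x \<bullet> i \<and> x \<bullet> i \<le> real (Suc k)" if "i \<in> Basis" for i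
        using Basis_le_norm[OF that, of x] k by auto
      then have "x \<in> Q k" using that by (auto simp: Q_def mem_box)
      then show ?thesis by auto
    qed
    then show ?thesis by (auto simp: Q_def)
  qed
  have inc: "incseq (\<lambda>k. B \<inter> \<psi> -` Q k)"
    by (rule incseq_SucI) (auto simp: Q_def mem_box, (smt (verit, ccfv_SIG))+)
  have "emeasure lborel (B \<inter> \<psi> -` E) = emeasure lborel (\<Union>k. B \<inter> \<psi> -` Q k)"
    using UQ by (intro arg_cong[where f="emeasure lborel"]) auto
  also have "\<dots> = (SUP k. emeasure lborel (B \<inter> \<psi> -` Q k))"
    using Qm inc by (intro SUP_emeasure_incseq[symmetric]) auto
  also have "\<dots> \<le> ennreal ?C * emeasure lborel E"
  proof (rule SUP_least)
    fix k
    have "emeasure lborel (B \<inter> \<psi> -` Q k) \<le> ennreal ?C * emeasure lborel (Q k)"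
      by (rule bounded_case[of _ "real (Suc k)"]) (auto simp: Q_def)
    also have "\<dots> \<le> ennreal ?C * emeasure lborel E"
      by (intro mult_left_mono emeasure_mono) (auto simp: Q_def)
    finally show "emeasure lborel (B \<inter> \<psi> -` Q k) \<le> ennreal ?C * emeasure lborel E" .
  qed
  finally show ?thesis .
qed

text \<open>By the previous lemma the image under \<open>\<psi>\<close> of Lebesgue measure on \<open>B\<close> has a bounded density.\<close>

lemma nn_integral_expanding:
  fixes \<psi> :: "'a::euclidean_space \<Rightarrow> 'a"
  assumes [measurable]: "\<psi> \<in> borel_measurable borel" "B \<in> sets borel" "T \<in> sets borel" "F \<in> borel_measurable borel"
    and L: "0 < L" and exp: "\<And>u v. u \<in> B \<Longrightarrow> v \<in> B \<Longrightarrow> dist u v \<le> L * dist (\<psi> u) (\<psi> v)"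
    and T: "\<And>u. u \<in> B \<Longrightarrow> \<psi> u \<in> T"
  shows "(\<integral>\<^sup>+u\<in>B. F (\<psi> u) \<partial>lborel)
    \<le> ennreal (unit_ball_vol DIM('a) * (L * DIM('a)) ^ DIM('a)) * (\<integral>\<^sup>+b\<in>T. F b \<partial>lborel)"
    (is "_ \<le> ennreal ?C * _")
proof -
  define M where "M = distr (density lborel (indicator B)) borel \<psi>"
  define N where "N = density lborel (\<lambda>b. ennreal ?C * indicator T b)"
  have [measurable_cong]: "sets (density lborel (indicator B)) = sets borel" by simp
  have "M \<le> N"
  proof (subst le_measure)
    show "sets M = sets N" by (simp add: M_def N_def)
    show "\<forall>X\<in>sets M. emeasure M X \<le> emeasure N X"
    proof
      fix X assume "X \<in> sets M"
      then have [measurable]: "X \<in> sets borel" by (simp add: M_def)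
      have pm: "\<psi> -` X \<in> sets borel" using measurable_sets[OF assms(1), of X] by simp
      have "emeasure M X = emeasure (density lborel (indicator B)) (\<psi> -` X)"
        by (simp add: M_def emeasure_distr)
      also have "\<dots> = emeasure lborel (B \<inter> \<psi> -` X)"
        using pm by (subst emeasure_density) (auto simp: nn_integral_indicator[symmetric] indicator_inter_arith[symmetric] simp del: nn_integral_indicator)
      also have "\<dots> \<le> emeasure lborel (B \<inter> \<psi> -` (X \<inter> T))"
        using T by (intro eq_refl arg_cong[where f="emeasure lborel"]) auto
      also have "\<dots> \<le> ennreal ?C * emeasure lborel (X \<inter> T)"
        by (rule emeasure_vimage_expanding[OF _ _ _ L exp]) auto
      also have "\<dots> = emeasure N X"
        unfolding N_def by (subst emeasure_density)
          (auto simp: mult.assoc indicator_inter_arith[symmetric] nn_integral_cmult Int_commute)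
      finally show "emeasure M X \<le> emeasure N X" .
    qed
  qed
  then have "nn_integral M F \<le> nn_integral N F"
    by (intro nn_integral_mono_measure) (simp_all add: M_def N_def)
  moreover have "nn_integral M F = (\<integral>\<^sup>+u\<in>B. F (\<psi> u) \<partial>lborel)"
    by (simp add: M_def nn_integral_distr nn_integral_density mult.commute)
  moreover have "nn_integral N F = ennreal ?C * (\<integral>\<^sup>+b\<in>T. F b \<partial>lborel)"
    by (simp add: N_def nn_integral_density nn_integral_cmult mult.assoc mult.commute[of "indicator _ _"])
  ultimately show ?thesis by simp
qed

section \<open>Reflections and rotations\<close>

text \<open>The Householder reflection in the hyperplane orthogonal to \<open>a\<close>. For \<open>a = 0\<close> the quotient is 0 and
  the map is the identity, so it is an orthogonal transformation for every \<open>a\<close>.\<close>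

definition reflect_along :: "'a::real_inner \<Rightarrow> 'a \<Rightarrow> 'a" where
  "reflect_along a x = x - (2 * (a \<bullet> x) / (a \<bullet> a)) *\<^sub>R a"

lemma linear_reflect_along: "linear (reflect_along a)"
  by (rule linearI) (auto simp: reflect_along_def inner_add_right algebra_simps add_divide_distrib)

lemma inner_reflect_along: "reflect_along a x \<bullet> reflect_along a y = x \<bullet> y"
proof (cases "a = 0")
  case False
  define s where "s = a \<bullet> a"
  have "s \<noteq> 0" using False by (simp add: s_def)
  have "reflect_along a x \<bullet> reflect_along a y
      = x \<bullet> y - (2 * (a \<bullet> y) / s) * (x \<bullet> a) - (2 * (a \<bullet> x) / s) * (a \<bullet> y)
        + (2 * (a \<bullet> x) / s) * ((2 * (a \<bullet> y) / s) * s)"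
    by (simp add: reflect_along_def inner_diff_left inner_diff_right s_def right_diff_distrib diff_divide_distrib
        inner_commute[of x a])
  then show ?thesis using \<open>s \<noteq> 0\<close> inner_commute[of x a] by simp
qed (simp add: reflect_along_def)

lemma orthogonal_reflect_along: "orthogonal_transformation (reflect_along a)"
  by (simp add: orthogonal_transformation_def linear_reflect_along inner_reflect_along)

lemma norm_reflect_along [simp]: "norm (reflect_along a x) = norm x"
  by (simp add: norm_eq_sqrt_inner inner_reflect_along)

lemma reflect_along_involutive: "reflect_along a (reflect_along a x) = x"
proof (cases "a = 0")
  case False
  then have "a \<bullet> a \<noteq> 0" by simp
  then have "a \<bullet> reflect_along a x = - (a \<bullet> x)"
    by (simp add: reflect_along_def inner_diff_right)
  then show ?thesis by (simp add: reflect_along_def[of a "reflect_along a x"], simp add: reflect_along_def)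
qed (simp add: reflect_along_def)

lemma reflect_along_scaleR_left: "c \<noteq> 0 \<Longrightarrow> reflect_along (c *\<^sub>R a) x = reflect_along a x"
  by (simp add: reflect_along_def field_simps)

lemma reflect_along_conjugate:
  assumes "orthogonal_transformation f"
  shows "reflect_along (f a) (f x) = f (reflect_along a x)"
  using assms orthogonal_transformation_linear[OF assms]
  by (simp add: reflect_along_def orthogonal_transformation_def linear_diff linear_scale)

definition reflect2 :: "real^'n \<Rightarrow> real^'n \<Rightarrow> real^'n^'n" where
  "reflect2 a e = matrix (reflect_along a) ** matrix (reflect_along e)"

lemma reflect2_apply: "reflect2 a e *v x = reflect_along a (reflect_along e x)"
  by (simp add: reflect2_def matrix_vector_mul_assoc[symmetric] matrix_works linear_reflect_along)

text \<open>Reflections along different vectors are conjugate under an orthogonal transformation that takes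
  one unit normal to the other. Hence a product of two reflections has determinant 1, without the
  determinant of a reflection being computed.\<close>

lemma det_reflect_along:
  fixes a e :: "real^'n"
  assumes "a \<noteq> 0" "e \<noteq> 0"
  shows "det (matrix (reflect_along a)) = det (matrix (reflect_along e))"
proof -
  obtain f where f: "orthogonal_transformation f" "f (a /\<^sub>R norm a) = e /\<^sub>R norm e"
    using orthogonal_transformation_exists[of "a /\<^sub>R norm a" "e /\<^sub>R norm e"] assms by auto
  have lf: "linear f" using f(1) orthogonal_transformation_linear by blast
  have "reflect_along e (f x) = f (reflect_along a x)" for x
    using reflect_along_conjugate[OF f(1), of "a /\<^sub>R norm a" x] f(2) assms
      reflect_along_scaleR_left[of "inverse (norm e)" e] reflect_along_scaleR_left[of "inverse (norm a)" a]
    by simp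
  then have eq: "reflect_along e \<circ> f = f \<circ> reflect_along a" by auto
  have "matrix (reflect_along e) ** matrix f = matrix f ** matrix (reflect_along a)"
    using matrix_compose[OF lf linear_reflect_along[of e]] matrix_compose[OF linear_reflect_along[of a] lf] eq
    by simp
  then have "det (matrix (reflect_along e)) * det (matrix f) = det (matrix f) * det (matrix (reflect_along a))"
    by (metis det_mul)
  moreover have "det (matrix f) \<noteq> 0"
    using det_orthogonal_matrix[of "matrix f"] f(1) orthogonal_transformation_matrix by fastforce
  ultimately show ?thesis by simp
qed

lemma rotation_reflect2:
  assumes "a \<noteq> 0" "e \<noteq> 0"
  shows "rotation_matrix (reflect2 a e)"
proof -
  have om: "orthogonal_matrix (matrix (reflect_along b))" for b :: "real^'n"
    using orthogonal_reflect_along orthogonal_transformation_matrix by blast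
  have "det (reflect2 a e) = (det (matrix (reflect_along e)))\<^sup>2"
    unfolding reflect2_def det_mul det_reflect_along[OF assms] by (simp add: power2_eq_square)
  also have "\<dots> = 1"
    using det_orthogonal_matrix[OF om[of e]] by auto
  finally show ?thesis
    unfolding rotation_matrix_def using orthogonal_matrix_mul[OF om om] by (simp add: reflect2_def)
qed

text \<open>With \<open>y = reflect_along e x\<close> the difference is \<open>reflect_along a y - reflect_along e y\<close>, which is Lipschitz in
  the unit normal.\<close>

lemma norm_reflect2_diff:
  assumes e: "norm e = 1" and a: "a \<noteq> 0"
  shows "norm (reflect2 a e *v x - x) \<le> 8 * norm (a - e) * norm x"
proof -
  define y where "y = reflect_along e x"
  define u where "u = a /\<^sub>R norm a"
  have u: "norm u = 1" using a by (simp add: u_def)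
  have ue: "norm (u - e) \<le> 2 * norm (a - e)"
  proof -
    have "norm (u - a) = \<bar>1 - norm a\<bar>"
    proof -
      have "u - a = (1 - norm a) *\<^sub>R u" using a by (simp add: u_def algebra_simps)
      then show ?thesis using u by simp
    qed
    also have "\<dots> \<le> norm (a - e)" using norm_triangle_ineq3[of a e] e by simp
    finally show ?thesis using norm_triangle_ineq[of "u - a" "a - e"] by simp
  qed
  have aa: "a \<bullet> a = (norm a)\<^sup>2" by (simp add: power2_norm_eq_inner)
  have "reflect_along a y = y - (2 * (u \<bullet> y)) *\<^sub>R u"
    using a unfolding reflect_along_def aa by (simp add: u_def power2_eq_square field_simps)
  moreover have "x = y - (2 * (e \<bullet> y)) *\<^sub>R e"
  proof -
    have "x = reflect_along e y" by (simp add: y_def reflect_along_involutive)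
    also have "\<dots> = y - (2 * (e \<bullet> y)) *\<^sub>R e" using e by (simp add: reflect_along_def norm_eq_1)
    finally show ?thesis .
  qed
  ultimately have "reflect2 a e *v x - x = - (2 *\<^sub>R ((u \<bullet> y) *\<^sub>R (u - e) + ((u - e) \<bullet> y) *\<^sub>R e))"
    by (simp add: reflect2_apply y_def[symmetric] inner_diff_left algebra_simps)
  then have "norm (reflect2 a e *v x - x) = 2 * norm ((u \<bullet> y) *\<^sub>R (u - e) + ((u - e) \<bullet> y) *\<^sub>R e)"
    by simp
  also have "\<dots> \<le> 2 * (\<bar>u \<bullet> y\<bar> * norm (u - e) + \<bar>(u - e) \<bullet> y\<bar>)"
    using norm_triangle_ineq[of "(u \<bullet> y) *\<^sub>R (u - e)" "((u - e) \<bullet> y) *\<^sub>R e"] e by simp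
  also have "\<dots> \<le> 2 * (norm y * norm (u - e) + norm (u - e) * norm y)"
    using Cauchy_Schwarz_ineq2[of u y] Cauchy_Schwarz_ineq2[of "u - e" y] u
    by (intro mult_left_mono add_mono mult_right_mono) auto
  also have "\<dots> = 4 * (norm (u - e) * norm y)" by simp
  also have "\<dots> \<le> 4 * ((2 * norm (a - e)) * norm y)"
    using ue by (intro mult_left_mono mult_right_mono) auto
  finally show ?thesis by (simp add: y_def)
qed

lemma rotation_size_reflect2:
  fixes a e :: "real^'n"
  assumes "norm e = 1" "a \<noteq> 0"
  shows "rotation_size (reflect2 a e) \<le> 8 * norm (a - e)"
  unfolding rotation_size_def
proof (rule cSUP_least)
  show "sphere 0 1 \<noteq> ({} :: (real^'n) set)" using assms(1) mem_sphere_0[of e 1] by auto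
  fix x :: "real^'n" assume "x \<in> sphere 0 1"
  then show "norm (reflect2 a e *v x - x) \<le> 8 * norm (a - e)"
    using norm_reflect2_diff[OF assms, of x] by simp
qed

text \<open>A normal vector of the hyperplane that reflects the direction of \<open>z\<close> to that of \<open>u\<close>. Among its
  multiples this one is chosen because it is affine in \<open>u\<close> up to the norm of \<open>u\<close>, which makes the
  dependence on \<open>u\<close> easy to invert.\<close>

definition bisector_normal :: "real^'n \<Rightarrow> real^'n \<Rightarrow> real^'n" where
  "bisector_normal z u = (norm u / norm z) *\<^sub>R z - u"

lemma reflect_along_bisector_normal:
  assumes "z \<noteq> 0" "u \<noteq> 0"
  shows "reflect_along (bisector_normal z u) z = (norm z / norm u) *\<^sub>R u"
proof -
  define a where "a = bisector_normal z u"
  have nz: "norm z > 0" "norm u > 0" using assms by auto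
  have zz: "z \<bullet> z = (norm z)\<^sup>2" "u \<bullet> u = (norm u)\<^sup>2" by (simp_all add: power2_norm_eq_inner)
  have az: "a \<bullet> z = norm u * norm z - u \<bullet> z"
    using nz by (simp add: a_def bisector_normal_def inner_diff_left zz power2_eq_square)
  have aa: "a \<bullet> a = 2 * (norm u / norm z) * (norm u * norm z - u \<bullet> z)"
    using nz by (simp add: a_def bisector_normal_def inner_diff_left inner_diff_right zz inner_commute[of z u]
        power2_eq_square field_simps)
  show ?thesis
  proof (cases "norm u * norm z = u \<bullet> z")
    case True
    then have "a = 0" using aa by simp
    then have "(norm u / norm z) *\<^sub>R z = u" by (simp add: a_def bisector_normal_def)
    then have "(norm z / norm u) *\<^sub>R u = (norm z / norm u) *\<^sub>R ((norm u / norm z) *\<^sub>R z)" by simp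
    also have "\<dots> = z" using nz by simp
    finally show ?thesis using \<open>a = 0\<close> by (simp add: a_def[symmetric] reflect_along_def)
  next
    case False
    then have "2 * (a \<bullet> z) / (a \<bullet> a) = norm z / norm u"
      unfolding az aa using nz by (simp add: field_simps)
    then have "reflect_along a z = z - (norm z / norm u) *\<^sub>R a" by (simp add: reflect_along_def)
    also have "\<dots> = (norm z / norm u) *\<^sub>R u"
      using nz by (simp add: a_def bisector_normal_def algebra_simps)
    finally show ?thesis by (simp add: a_def)
  qed
qed

lemma bisector_normal_Lipschitz:
  "norm (bisector_normal z u - bisector_normal z v) \<le> 2 * norm (u - v)"
proof -
  have "bisector_normal z u - bisector_normal z v = ((norm u - norm v) / norm z) *\<^sub>R z - (u - v)"
    by (simp add: bisector_normal_def algebra_simps diff_divide_distrib)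
  then have "norm (bisector_normal z u - bisector_normal z v)
      \<le> norm (((norm u - norm v) / norm z) *\<^sub>R z) + norm (u - v)"
    by (metis norm_triangle_ineq4)
  also have "norm (((norm u - norm v) / norm z) *\<^sub>R z) \<le> \<bar>norm u - norm v\<bar>" by simp
  also have "\<bar>norm u - norm v\<bar> \<le> norm (u - v)" by (rule norm_triangle_ineq3)
  finally show ?thesis by simp
qed

text \<open>The derivative of \<open>bisector_normal z\<close> at \<open>u\<close> maps \<open>d\<close> to a multiple of \<open>z\<close> minus \<open>d\<close> and degenerates only when \<open>u\<close> is
  a positive multiple of \<open>z\<close>. The hypotheses on \<open>u\<close> and \<open>v\<close> keep both away from that ray; the proof
  replaces the derivative by the exact identity for \<open>(norm u)\<^sup>2 - (norm v)\<^sup>2\<close>.\<close>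

lemma bisector_normal_expanding:
  assumes z: "z \<noteq> 0" and k: "0 < k"
    and u: "norm z / k \<le> norm u - (u \<bullet> z) / norm z" "norm u \<le> 2 * norm z"
    and v: "norm z / k \<le> norm v - (v \<bullet> z) / norm z" "norm v \<le> 2 * norm z"
  shows "norm (u - v) \<le> (1 + 2 * k) * norm (bisector_normal z u - bisector_normal z v)"
proof -
  define t where "t = norm u - norm v"
  define d where "d = u - v"
  define y where "y = z /\<^sub>R norm z"
  define e where "e = d - t *\<^sub>R y"
  have nz: "norm z > 0" using z by simp
  have be: "bisector_normal z u - bisector_normal z v = - e"
    by (simp add: bisector_normal_def e_def d_def t_def y_def algebra_simps divide_inverse)
  have y: "norm y = 1" using z by (simp add: y_def)
  have uy: "x \<bullet> y = (x \<bullet> z) / norm z" for x by (simp add: y_def divide_inverse)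
  have "t * (norm u + norm v) = (u + v) \<bullet> d"
    by (simp add: t_def d_def inner_add_left inner_diff_right inner_commute[of v u] algebra_simps
        power2_norm_eq_inner[symmetric] power2_eq_square)
  also have "d = t *\<^sub>R y + e" by (simp add: e_def)
  finally have eq: "t * ((norm u - u \<bullet> y) + (norm v - v \<bullet> y)) = (u + v) \<bullet> e"
    by (simp add: inner_add_left inner_add_right algebra_simps)
  have low: "2 * norm z / k \<le> (norm u - u \<bullet> y) + (norm v - v \<bullet> y)"
    using u(1) v(1) unfolding uy by linarith
  have "\<bar>t\<bar> * (2 * norm z / k) \<le> \<bar>t\<bar> * ((norm u - u \<bullet> y) + (norm v - v \<bullet> y))"
    using low by (intro mult_left_mono) auto
  also have "\<dots> = \<bar>(u + v) \<bullet> e\<bar>"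
  proof -
    have "0 \<le> 2 * norm z / k" using nz k by simp
    then have "\<bar>(norm u - u \<bullet> y) + (norm v - v \<bullet> y)\<bar> = (norm u - u \<bullet> y) + (norm v - v \<bullet> y)"
      using low by (intro abs_of_nonneg) linarith
    then show ?thesis unfolding eq[symmetric] abs_mult by simp
  qed
  also have "\<dots> \<le> norm (u + v) * norm e" by (rule Cauchy_Schwarz_ineq2)
  also have "\<dots> \<le> (4 * norm z) * norm e"
    using u(2) v(2) norm_triangle_ineq[of u v] by (intro mult_right_mono) auto
  finally have "\<bar>t\<bar> \<le> 2 * k * norm e" using nz k by (simp add: field_simps)
  moreover have "norm d \<le> \<bar>t\<bar> + norm e"
    using norm_triangle_ineq[of "t *\<^sub>R y" e] y by (simp add: e_def)
  ultimately have "norm d \<le> (1 + 2 * k) * norm e" by (simp add: algebra_simps)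
  then show ?thesis by (simp add: be d_def)
qed

section \<open>Translations controlled by rotations\<close>

lemma powr_add_le_two_powr:
  fixes x y a :: real
  assumes "0 \<le> x" "0 \<le> y" "0 \<le> a"
  shows "(x + y) powr a \<le> 2 powr a * (x powr a + y powr a)"
proof -
  have "(x + y) powr a \<le> (2 * max x y) powr a"
    using assms by (intro powr_mono2) auto
  also have "\<dots> = 2 powr a * max x y powr a" using assms by (simp add: powr_mult)
  also have "max x y powr a \<le> x powr a + y powr a" by (auto simp: max_def)
  finally show ?thesis by simp
qed

lemma norm_diff_powr_le:
  fixes x y z :: "'b::real_normed_vector"
  assumes "0 \<le> a"
  shows "norm (x - z) powr a \<le> 2 powr a * (norm (y - z) powr a + norm (y - x) powr a)"
proof -
  have "norm (x - z) powr a \<le> (norm (y - z) + norm (y - x)) powr a"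
    using norm_triangle_ineq[of "y - z" "x - y"] assms by (intro powr_mono2) (auto simp: norm_minus_commute)
  also have "\<dots> \<le> 2 powr a * (norm (y - z) powr a + norm (y - x) powr a)"
    using assms by (intro powr_add_le_two_powr) auto
  finally show ?thesis .
qed

lemma borel_measurable_reflect_along [measurable]:
  fixes f g :: "'b \<Rightarrow> 'a::euclidean_space"
  assumes [measurable]: "f \<in> borel_measurable M" "g \<in> borel_measurable M"
  shows "(\<lambda>x. reflect_along (f x) (g x)) \<in> borel_measurable M"
  unfolding reflect_along_def by measurable

lemma borel_measurable_bisector_normal [measurable]:
  "bisector_normal z \<in> borel_measurable borel"
  unfolding bisector_normal_def by measurable

lemma nn_integral_lborel_shift:
  fixes h :: "'a::euclidean_space"
  assumes [measurable]: "f \<in> borel_measurable borel"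
  shows "(\<integral>\<^sup>+x. f (x + h) \<partial>lborel) = (\<integral>\<^sup>+x. f x \<partial>lborel)"
proof -
  have "(\<integral>\<^sup>+x. f x \<partial>lborel) = (\<integral>\<^sup>+x. f x \<partial>distr lborel borel ((+) h))"
    by (simp add: lborel_distr_plus)
  also have "\<dots> = (\<integral>\<^sup>+x. f (x + h) \<partial>lborel)"
    by (subst nn_integral_distr) (auto simp: add.commute)
  finally show ?thesis by simp
qed

lemma nn_integral_lborel_scale:
  fixes f :: "'a::euclidean_space \<Rightarrow> ennreal"
  assumes [measurable]: "f \<in> borel_measurable borel" and c: "c \<noteq> 0"
  shows "(\<integral>\<^sup>+x. f x \<partial>lborel) = ennreal (\<bar>c\<bar> ^ DIM('a)) * (\<integral>\<^sup>+x. f (t + c *\<^sub>R x) \<partial>lborel)"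
  by (subst lborel_affine[OF c, of t])
     (simp add: nn_integral_density nn_integral_distr nn_integral_cmult)

lemma indicator_ball:
  "indicator (ball w r) u = (if dist w u < r then 1 else 0 :: ennreal)"
  by (auto split: split_indicator)

text \<open>The constant of \<open>nn_integral_expanding\<close> for the map that is used in the next lemma.\<close>

definition reflection_density :: "'n::finite itself \<Rightarrow> real" where
  "reflection_density _ = unit_ball_vol (real CARD('n)) *
     (6 * (1 + 2 * real CARD('n) ^ 2) * real CARD('n)) ^ CARD('n)"

lemma reflection_density_nonneg: "0 \<le> reflection_density TYPE('n::finite)"
  unfolding reflection_density_def by (intro mult_nonneg_nonneg unit_ball_vol_nonneg) auto

text \<open>Let \<open>z\<close> be the reflection of \<open>w\<close> along the coordinate vector \<open>e\<close>. A second reflection, along a multiple \<open>b\<close> of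
  \<open>bisector_normal z u\<close>, takes \<open>z\<close> to a positive multiple of \<open>u\<close>, where \<open>F\<close> has the value \<open>F u\<close>. Since \<open>w\<close> has a large
  coordinate along \<open>e\<close>, it is far from the ray through \<open>z\<close>, and so \<open>u\<close> depends on \<open>b\<close> in a Lipschitz way.
  The multiple is normalized so that \<open>u = w\<close> gives \<open>b = e\<close>; the domain of \<open>b\<close> is then independent of \<open>w\<close>,
  which makes a later exchange of the integrations over \<open>b\<close> and \<open>w\<close> possible.\<close>

lemma nn_integral_ball_le_reflections:
  fixes w :: "real^'n" and F :: "real^'n \<Rightarrow> ennreal"
  defines "N \<equiv> real CARD('n)"
  assumes [measurable]: "F \<in> borel_measurable borel"
    and hom: "\<And>c x. 0 < c \<Longrightarrow> F (c *\<^sub>R x) = F x"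
    and w: "1 / 2 \<le> norm w" "norm w \<le> 3"
    and i: "norm w \<le> N * \<bar>w $ i\<bar>"
    and \<epsilon>: "0 < \<epsilon>" "\<epsilon> \<le> norm w / (2 * N\<^sup>2)"
  shows "(\<integral>\<^sup>+u\<in>ball w \<epsilon>. F u \<partial>lborel) \<le> ennreal (reflection_density TYPE('n)) *
     (\<integral>\<^sup>+b\<in>ball (axis i 1) (2 * N * \<epsilon>). F (reflect_along b (reflect_along (axis i 1) w)) \<partial>lborel)"
proof -
  define e :: "real^'n" where "e = axis i 1"
  define z where "z = reflect_along e w"
  define \<theta> where "\<theta> = - 2 * w $ i"
  define \<psi> where "\<psi> u = (1 / \<theta>) *\<^sub>R bisector_normal z u" for u
  have N: "1 \<le> N" unfolding N_def using zero_less_card_finite[where 'a='n] by linarith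
  have N2: "1 \<le> N\<^sup>2" using N by (simp add: one_le_power)
  have wi: "w $ i \<noteq> 0" using i w by auto
  then have \<theta>: "\<theta> \<noteq> 0" "\<bar>\<theta>\<bar> = 2 * \<bar>w $ i\<bar>" by (auto simp: \<theta>_def abs_mult)
  have z: "z = w - (2 * w $ i) *\<^sub>R e"
    by (simp add: z_def reflect_along_def e_def inner_axis inner_commute[of "axis i 1"] norm_eq_1[symmetric])
  have nz: "norm z = norm w" by (simp add: z_def)
  have z0: "z \<noteq> 0" using nz w by auto
  have nw: "norm w > 0" using w by linarith
  have bw: "bisector_normal z w = \<theta> *\<^sub>R e"
    using nz nw by (simp add: bisector_normal_def z \<theta>_def)
  have small: "norm u \<le> 2 * norm z" "norm z / N\<^sup>2 \<le> norm u - (u \<bullet> z) / norm z" "u \<noteq> 0" if "u \<in> ball w \<epsilon>" for u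
  proof -
    have d: "norm (u - w) < norm w / (2 * N\<^sup>2)" using that \<epsilon> by (simp add: dist_norm norm_minus_commute)
    also have "\<dots> \<le> norm w / 2" using N2 nw by (intro divide_left_mono) auto
    finally have d2: "norm (u - w) < norm w / 2" .
    have "norm u \<le> norm w + norm (u - w)" using norm_triangle_ineq[of w "u - w"] by simp
    then show "norm u \<le> 2 * norm z" using d2 nz nw by linarith
    show "u \<noteq> 0" using d2 nw by auto
    have wz: "w \<bullet> z = (norm w)\<^sup>2 - 2 * (w $ i)\<^sup>2"
      by (simp add: z inner_diff_right e_def inner_axis dot_square_norm power2_eq_square[of "w $ i"])
    have "2 * norm w / N\<^sup>2 \<le> norm w - (w \<bullet> z) / norm z"
    proof -
      have "(norm w)\<^sup>2 \<le> (N * \<bar>w $ i\<bar>)\<^sup>2" using i by (intro power_mono) auto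
      then have "(norm w)\<^sup>2 \<le> N\<^sup>2 * (w $ i)\<^sup>2" by (simp add: power_mult_distrib)
      moreover have "norm w - (w \<bullet> z) / norm z = 2 * (w $ i)\<^sup>2 / norm w"
        using nw by (simp add: wz nz field_simps power2_eq_square)
      moreover have "2 * norm w / N\<^sup>2 \<le> 2 * (w $ i)\<^sup>2 / norm w" if "(norm w)\<^sup>2 \<le> N\<^sup>2 * (w $ i)\<^sup>2"
      proof -
        have "(norm w)\<^sup>2 / N\<^sup>2 \<le> (w $ i)\<^sup>2" using that N2 by (simp add: divide_le_eq mult.commute)
        then have "2 * ((norm w)\<^sup>2 / N\<^sup>2) / norm w \<le> 2 * (w $ i)\<^sup>2 / norm w"
          using nw by (intro divide_right_mono) auto
        moreover have "2 * ((norm w)\<^sup>2 / N\<^sup>2) / norm w = 2 * norm w / N\<^sup>2"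
          using nw by (simp add: power2_eq_square)
        ultimately show ?thesis by simp
      qed
      ultimately show ?thesis by simp
    qed
    moreover have "(norm w - (w \<bullet> z) / norm z) - (norm u - (u \<bullet> z) / norm z) \<le> 2 * norm (u - w)"
    proof -
      have "(u \<bullet> z) / norm z - (w \<bullet> z) / norm z = ((u - w) \<bullet> z) / norm z"
        by (simp add: inner_diff_left diff_divide_distrib)
      also have "\<dots> \<le> norm (u - w)"
        using norm_cauchy_schwarz[of "u - w" z] nz nw by (simp add: field_simps)
      finally show ?thesis using norm_triangle_ineq3[of u w] by linarith
    qed
    moreover have "2 * norm (u - w) \<le> norm w / N\<^sup>2" using d by simp
    ultimately show "norm z / N\<^sup>2 \<le> norm u - (u \<bullet> z) / norm z" unfolding nz by simp
  qed
  have F\<psi>: "F u = F (reflect_along (\<psi> u) z)" if "u \<in> ball w \<epsilon>" for u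
  proof -
    have "reflect_along (\<psi> u) z = (norm z / norm u) *\<^sub>R u"
      using reflect_along_scaleR_left[of "1 / \<theta>" "bisector_normal z u" z] \<theta>
        reflect_along_bisector_normal[OF z0 small(3)[OF that]] by (simp add: \<psi>_def)
    then show ?thesis using hom[of "norm z / norm u" u] small(3)[OF that] z0 by simp
  qed
  have \<psi>T: "\<psi> u \<in> ball e (2 * N * \<epsilon>)" if "u \<in> ball w \<epsilon>" for u
  proof -
    have "\<psi> u - e = (1 / \<theta>) *\<^sub>R (bisector_normal z u - bisector_normal z w)"
      using \<theta>(1) by (simp add: \<psi>_def bw scaleR_diff_right)
    then have "norm (\<psi> u - e) = norm (bisector_normal z u - bisector_normal z w) / \<bar>\<theta>\<bar>"
      by (simp add: divide_inverse)
    also have "\<dots> \<le> 2 * norm (u - w) / \<bar>\<theta>\<bar>"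
      by (intro divide_right_mono bisector_normal_Lipschitz) auto
    also have "\<dots> = norm (u - w) / \<bar>w $ i\<bar>" by (simp add: \<theta>)
    also have "\<dots> < \<epsilon> / \<bar>w $ i\<bar>"
      using that wi by (intro divide_strict_right_mono) (auto simp: dist_norm norm_minus_commute)
    also have "\<dots> \<le> 2 * N * \<epsilon>"
    proof -
      have "1 \<le> 2 * N * \<bar>w $ i\<bar>" using i w by linarith
      then have "\<epsilon> * 1 \<le> \<epsilon> * (2 * N * \<bar>w $ i\<bar>)" using \<epsilon> by (intro mult_left_mono) auto
      then show ?thesis using wi by (simp add: field_simps)
    qed
    finally show ?thesis by (simp add: dist_norm norm_minus_commute)
  qed
  have exp: "dist u v \<le> (6 * (1 + 2 * N\<^sup>2)) * dist (\<psi> u) (\<psi> v)" if "u \<in> ball w \<epsilon>" "v \<in> ball w \<epsilon>" for u v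
  proof -
    have "norm (u - v) \<le> (1 + 2 * N\<^sup>2) * norm (bisector_normal z u - bisector_normal z v)"
      using small[OF that(1)] small[OF that(2)] N2 z0 by (intro bisector_normal_expanding) auto
    also have "bisector_normal z u - bisector_normal z v = \<theta> *\<^sub>R (\<psi> u - \<psi> v)"
      using \<theta>(1) by (simp add: \<psi>_def scaleR_diff_right)
    also have "(1 + 2 * N\<^sup>2) * norm (\<theta> *\<^sub>R (\<psi> u - \<psi> v)) \<le> (1 + 2 * N\<^sup>2) * (6 * norm (\<psi> u - \<psi> v))"
    proof (rule mult_left_mono)
      have "\<bar>\<theta>\<bar> \<le> 6" using \<theta>(2) component_le_norm_cart[of w i] w by linarith
      then show "norm (\<theta> *\<^sub>R (\<psi> u - \<psi> v)) \<le> 6 * norm (\<psi> u - \<psi> v)" by (simp add: mult_right_mono)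
    qed (use N2 in auto)
    finally show ?thesis by (simp add: dist_norm algebra_simps)
  qed
  have "(\<integral>\<^sup>+u\<in>ball w \<epsilon>. F u \<partial>lborel) = (\<integral>\<^sup>+u\<in>ball w \<epsilon>. F (reflect_along (\<psi> u) z) \<partial>lborel)"
    by (intro nn_integral_cong) (auto simp: F\<psi> split: split_indicator)
  also have "\<dots> \<le> ennreal (unit_ball_vol DIM(real^'n) * (6 * (1 + 2 * N\<^sup>2) * DIM(real^'n)) ^ DIM(real^'n)) *
     (\<integral>\<^sup>+b\<in>ball e (2 * N * \<epsilon>). F (reflect_along b z) \<partial>lborel)"
  proof (rule nn_integral_expanding[OF _ _ _ _ _ exp \<psi>T])
    show "\<psi> \<in> borel_measurable borel" unfolding \<psi>_def by measurable
    show "0 < 6 * (1 + 2 * N\<^sup>2)" by (simp add: add_pos_nonneg)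
  qed auto
  also have "unit_ball_vol DIM(real^'n) * (6 * (1 + 2 * N\<^sup>2) * DIM(real^'n)) ^ DIM(real^'n) = reflection_density TYPE('n)"
    by (simp add: reflection_density_def N_def)
  finally show ?thesis by (simp add: z_def e_def)
qed

definition translation_const :: "'n::finite itself \<Rightarrow> real \<Rightarrow> real" where
  "translation_const _ \<sigma> = 2 powr \<sigma> * 2 * real CARD('n) * reflection_density TYPE('n) * (4 * real CARD('n)) ^ CARD('n)"

lemma translation_const_nonneg: "0 \<le> translation_const TYPE('n::finite) \<sigma>"
  unfolding translation_const_def by (intro mult_nonneg_nonneg reflection_density_nonneg) auto

text \<open>For \<open>w = y + h\<close> both \<open>\<Omega> (y + h)\<close> and \<open>\<Omega> y\<close> are compared with \<open>\<Omega> u\<close> and the comparison is averaged over \<open>u\<close>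
  in the ball of radius \<open>\<delta>\<close> around \<open>y\<close>. The function \<open>J\<close> of the proof is the resulting local
  oscillation. The annulus is split according to a large coordinate of \<open>w\<close>; on each piece \<open>J\<close> is an
  integral over products of two reflections, and these are rotations of size less than
  \<open>8 * (4 * N * \<delta>)\<close>.\<close>

lemma translation_le_rotations:
  fixes \<Omega> :: "real^'n \<Rightarrow> complex"
  defines "N \<equiv> real CARD('n)"
  assumes meas [measurable]: "\<Omega> \<in> borel_measurable borel" and hom: "homogeneous_zero \<Omega>"
    and \<sigma>: "0 < \<sigma>" and \<delta>: "0 < \<delta>" "\<delta> \<le> 1 / (8 * N\<^sup>2)" and h: "norm h < \<delta>"
    and rot: "\<And>Q. rotation_matrix Q \<Longrightarrow> rotation_size Q < 32 * N * \<delta> \<Longrightarrow>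
        (\<integral>\<^sup>+w\<in>ball 0 3. ennreal (norm (\<Omega> (Q *v w) - \<Omega> w) powr \<sigma>) \<partial>lborel) \<le> X"
  shows "(\<integral>\<^sup>+y\<in>{y. 1 \<le> norm y \<and> norm y < 2}. ennreal (norm (\<Omega> (y + h) - \<Omega> y) powr \<sigma>) \<partial>lborel)
     \<le> ennreal (translation_const TYPE('n) \<sigma>) * X"
proof -
  define g where "g u w = ennreal (norm (\<Omega> u - \<Omega> w) powr \<sigma>)" for u w
  define J where "J w = (\<integral>\<^sup>+u\<in>ball w (2 * \<delta>). g u w \<partial>lborel)" for w
  define A where "A = {y::real^'n. 1 \<le> norm y \<and> norm y < 2}"
  define A' where "A' = {y::real^'n. 1 / 2 \<le> norm y \<and> norm y < 3}"
  \<comment> \<open>The averages are written without denominators: both sides are multiplied by \<open>V\<close>.\<close>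
  define V where "V = emeasure lborel (ball (0::real^'n) \<delta>)"
  define D where "D = ennreal (reflection_density TYPE('n))"
  have N: "1 \<le> N" unfolding N_def using zero_less_card_finite[where 'a='n] by linarith
  have N2: "1 \<le> N\<^sup>2" using N by (simp add: one_le_power)
  have "1 / (8 * N\<^sup>2) \<le> 1 / 8" using N2 by (intro divide_left_mono) auto
  then have "\<delta> \<le> 1 / 8" using \<delta>(2) by linarith
  have V: "V = ennreal (unit_ball_vol N * \<delta> ^ CARD('n))"
    using \<delta> by (simp add: V_def emeasure_ball N_def)
  have Vpos: "0 < unit_ball_vol N * \<delta> ^ CARD('n)"
    using \<delta> N by (intro mult_pos_pos unit_ball_vol_pos zero_less_power) auto
  have [measurable]: "A \<in> sets borel" "A' \<in> sets borel" unfolding A_def A'_def by measurable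
  have gm [measurable]: "(\<lambda>x. g (k x) (k' x)) \<in> borel_measurable M"
    if [measurable]: "k \<in> borel_measurable M" "k' \<in> borel_measurable M"
    for k k' :: "'z \<Rightarrow> real^'n" and M
    unfolding g_def by measurable
  have Jm [measurable]: "J \<in> borel_measurable borel"
    unfolding J_def indicator_ball g_def by measurable
  have step1: "V * g (y + h) y \<le> ennreal (2 powr \<sigma>) * (J y + J (y + h))" for y
  proof -
    have "V * g (y + h) y = (\<integral>\<^sup>+u\<in>ball y \<delta>. g (y + h) y \<partial>lborel)"
      using \<delta> by (subst nn_integral_cmult_indicator) (auto simp: V_def emeasure_ball mult.commute)
    also have "\<dots> \<le> (\<integral>\<^sup>+u. ennreal (2 powr \<sigma>) * (g u y * indicator (ball y (2 * \<delta>)) u + g u (y + h) * indicator (ball (y + h) (2 * \<delta>)) u) \<partial>lborel)"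
    proof (rule nn_integral_mono)
      fix u
      show "g (y + h) y * indicator (ball y \<delta>) u \<le> ennreal (2 powr \<sigma>) * (g u y * indicator (ball y (2 * \<delta>)) u + g u (y + h) * indicator (ball (y + h) (2 * \<delta>)) u)"
      proof (cases "u \<in> ball y \<delta>")
        case True
        then have u: "u \<in> ball y (2 * \<delta>)" "u \<in> ball (y + h) (2 * \<delta>)"
          using \<delta> h norm_triangle_ineq[of "y - u" h] by (auto simp: dist_norm algebra_simps)
        have "g (y + h) y \<le> ennreal (2 powr \<sigma> * (norm (\<Omega> u - \<Omega> y) powr \<sigma> + norm (\<Omega> u - \<Omega> (y + h)) powr \<sigma>))"
          unfolding g_def using \<sigma> by (intro ennreal_leI norm_diff_powr_le) auto
        then show ?thesis using True u by (simp add: g_def ennreal_mult)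
      qed simp
    qed
    also have "\<dots> = ennreal (2 powr \<sigma>) * (J y + J (y + h))"
      unfolding J_def indicator_ball by (simp add: nn_integral_cmult nn_integral_add)
    finally show ?thesis .
  qed
  have "(\<integral>\<^sup>+w\<in>A'. J w \<partial>lborel) \<le> D * (\<Sum>i\<in>(UNIV::'n set). X * emeasure lborel (ball (axis i 1 :: real^'n) (4 * N * \<delta>)))"
  proof -
    define H where "H i b w = g (reflect_along b (reflect_along (axis i 1) w)) w" for i :: 'n and b w :: "real^'n"
    have Hm [measurable]: "(\<lambda>x. H i (k x) (k' x)) \<in> borel_measurable M"
      if [measurable]: "k \<in> borel_measurable M" "k' \<in> borel_measurable M"
      for i and k k' :: "'z \<Rightarrow> real^'n" and M
      unfolding H_def by measurable
    have [measurable]: "(\<lambda>w. \<integral>\<^sup>+b. H i b w * indicator (ball (axis i 1) (4 * N * \<delta>)) b * indicator (ball 0 3) w \<partial>lborel) \<in> borel_measurable borel" for i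
      unfolding indicator_ball by measurable
    have Jle: "J w * indicator A' w \<le> (\<Sum>i\<in>UNIV. D * (\<integral>\<^sup>+b. H i b w * indicator (ball (axis i 1) (4 * N * \<delta>)) b * indicator (ball 0 3) w \<partial>lborel))" for w
    proof (cases "w \<in> A'")
      case True
      have "\<exists>i. norm w \<le> N * \<bar>w $ i\<bar>"
      proof (rule ccontr)
        assume "\<not> ?thesis"
        then have less: "\<bar>w $ i\<bar> < norm w / N" for i using N by (simp add: field_simps not_le)
        have "norm w \<le> (\<Sum>i\<in>UNIV. \<bar>w $ i\<bar>)" by (rule norm_le_l1_cart)
        also have "\<dots> < (\<Sum>i\<in>(UNIV::'n set). norm w / N)" using less by (intro sum_strict_mono) auto
        also have "\<dots> = norm w" using N by (simp add: N_def)
        finally show False by simp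
      qed
      then obtain i where i: "norm w \<le> N * \<bar>w $ i\<bar>" by blast
      have "2 * \<delta> \<le> (1 / 2) / (2 * N\<^sup>2)" using \<delta>(2) by simp
      also have "\<dots> \<le> norm w / (2 * N\<^sup>2)" using True N2 by (intro divide_right_mono) (auto simp: A'_def)
      finally have "2 * \<delta> \<le> norm w / (2 * N\<^sup>2)" .
      then have "J w \<le> D * (\<integral>\<^sup>+b\<in>ball (axis i 1) (2 * N * (2 * \<delta>)). H i b w \<partial>lborel)"
        unfolding J_def D_def H_def N_def using True \<delta>(1) i[unfolded N_def] hom
        by (intro nn_integral_ball_le_reflections[of "\<lambda>u. g u w"])
           (auto simp: A'_def g_def homogeneous_zero_def)
      also have "\<dots> = D * (\<integral>\<^sup>+b. H i b w * indicator (ball (axis i 1) (4 * N * \<delta>)) b * indicator (ball 0 3) w \<partial>lborel)"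
        using True by (simp add: A'_def mult_ac)
      also have "\<dots> \<le> (\<Sum>i\<in>UNIV. D * (\<integral>\<^sup>+b. H i b w * indicator (ball (axis i 1) (4 * N * \<delta>)) b * indicator (ball 0 3) w \<partial>lborel))"
        by (intro member_le_sum) auto
      finally show ?thesis using True by simp
    qed simp
    have "(\<integral>\<^sup>+w\<in>A'. J w \<partial>lborel) \<le> (\<integral>\<^sup>+w. (\<Sum>i\<in>UNIV. D * (\<integral>\<^sup>+b. H i b w * indicator (ball (axis i 1) (4 * N * \<delta>)) b * indicator (ball 0 3) w \<partial>lborel)) \<partial>lborel)"
      by (intro nn_integral_mono Jle)
    also have "\<dots> = (\<Sum>i\<in>UNIV. D * (\<integral>\<^sup>+w. \<integral>\<^sup>+b. H i b w * indicator (ball (axis i 1) (4 * N * \<delta>)) b * indicator (ball 0 3) w \<partial>lborel \<partial>lborel))"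
      by (simp add: nn_integral_sum nn_integral_cmult)
    also have "\<dots> \<le> (\<Sum>i\<in>(UNIV::'n set). D * (X * emeasure lborel (ball (axis i 1 :: real^'n) (4 * N * \<delta>))))"
    proof (intro sum_mono mult_left_mono)
      fix i :: 'n
      have "(\<integral>\<^sup>+w. \<integral>\<^sup>+b. H i b w * indicator (ball (axis i 1) (4 * N * \<delta>)) b * indicator (ball 0 3) w \<partial>lborel \<partial>lborel)
          = (\<integral>\<^sup>+b. \<integral>\<^sup>+w. H i b w * indicator (ball (axis i 1) (4 * N * \<delta>)) b * indicator (ball 0 3) w \<partial>lborel \<partial>lborel)"
        unfolding indicator_ball by (rule lborel_pair.Fubini') measurable
      also have "\<dots> \<le> (\<integral>\<^sup>+b. X * indicator (ball (axis i 1 :: real^'n) (4 * N * \<delta>)) b \<partial>lborel)"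
      proof (rule nn_integral_mono)
        fix b :: "real^'n"
        show "(\<integral>\<^sup>+w. H i b w * indicator (ball (axis i 1) (4 * N * \<delta>)) b * indicator (ball 0 3) w \<partial>lborel)
           \<le> X * indicator (ball (axis i 1) (4 * N * \<delta>)) b"
        proof (cases "b \<in> ball (axis i 1) (4 * N * \<delta>)")
          case True
          have "4 * N * \<delta> \<le> 4 * N * (1 / (8 * N\<^sup>2))" using \<delta> N by (intro mult_left_mono) auto
          also have "\<dots> \<le> 1" using N by (simp add: field_simps power2_eq_square)
          finally have "4 * N * \<delta> \<le> 1" .
          then have b0: "b \<noteq> 0" using True by auto
          have e: "norm (axis i 1 :: real^'n) = 1" "axis i 1 \<noteq> (0 :: real^'n)" by (simp_all add: axis_eq_0_iff)
          have "rotation_size (reflect2 b (axis i 1)) \<le> 8 * norm (b - axis i 1)"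
            by (rule rotation_size_reflect2[OF e(1) b0])
          also have "\<dots> < 8 * (4 * N * \<delta>)" using True by (simp add: dist_norm norm_minus_commute)
          finally have "rotation_size (reflect2 b (axis i 1)) < 32 * N * \<delta>" by simp
          from rot[OF rotation_reflect2[OF b0 e(2)] this]
          show ?thesis using True by (simp add: H_def g_def reflect2_apply)
        qed simp
      qed
      also have "\<dots> = X * emeasure lborel (ball (axis i 1 :: real^'n) (4 * N * \<delta>))"
        by (rule nn_integral_cmult_indicator) simp
      finally show "(\<integral>\<^sup>+w. \<integral>\<^sup>+b. H i b w * indicator (ball (axis i 1) (4 * N * \<delta>)) b * indicator (ball 0 3) w \<partial>lborel \<partial>lborel)
         \<le> X * emeasure lborel (ball (axis i 1 :: real^'n) (4 * N * \<delta>))" .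
    qed auto
    finally show ?thesis by (simp add: sum_distrib_left)
  qed
  also have "(\<Sum>i\<in>(UNIV::'n set). X * emeasure lborel (ball (axis i 1 :: real^'n) (4 * N * \<delta>)))
      = ennreal (N * (4 * N) ^ CARD('n)) * (X * V)"
  proof -
    have "emeasure lborel (ball (axis i 1 :: real^'n) (4 * N * \<delta>)) = ennreal ((4 * N) ^ CARD('n)) * V" for i
    proof -
      have "emeasure lborel (ball (axis i 1 :: real^'n) (4 * N * \<delta>)) = ennreal (unit_ball_vol N * (4 * N * \<delta>) ^ CARD('n))"
        using \<delta> N by (subst emeasure_ball) (auto simp: N_def)
      also have "\<dots> = ennreal ((4 * N) ^ CARD('n) * (unit_ball_vol N * \<delta> ^ CARD('n)))"
        by (simp add: power_mult_distrib mult_ac)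
      also have "\<dots> = ennreal ((4 * N) ^ CARD('n)) * V"
        unfolding V using N Vpos by (intro ennreal_mult) auto
      finally show ?thesis .
    qed
    then show ?thesis using N by (simp add: ennreal_mult mult_ac ennreal_of_nat_eq_real_of_nat N_def)
  qed
  finally have stepJ: "(\<integral>\<^sup>+w\<in>A'. J w \<partial>lborel) \<le> D * (ennreal (N * (4 * N) ^ CARD('n)) * (X * V))" .
  have "V * (\<integral>\<^sup>+y\<in>A. g (y + h) y \<partial>lborel) = (\<integral>\<^sup>+y\<in>A. V * g (y + h) y \<partial>lborel)"
    by (simp add: nn_integral_cmult[symmetric] mult.assoc)
  also have "\<dots> \<le> (\<integral>\<^sup>+y\<in>A. ennreal (2 powr \<sigma>) * (J y + J (y + h)) \<partial>lborel)"
    by (intro nn_integral_mono mult_right_mono step1) auto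
  also have "\<dots> = ennreal (2 powr \<sigma>) * ((\<integral>\<^sup>+y\<in>A. J y \<partial>lborel) + (\<integral>\<^sup>+y\<in>A. J (y + h) \<partial>lborel))"
    by (simp add: nn_integral_cmult nn_integral_add mult.assoc distrib_right)
  also have "\<dots> \<le> ennreal (2 powr \<sigma>) * ((\<integral>\<^sup>+w\<in>A'. J w \<partial>lborel) + (\<integral>\<^sup>+w\<in>A'. J w \<partial>lborel))"
  proof (intro mult_left_mono add_mono)
    show "(\<integral>\<^sup>+y\<in>A. J y \<partial>lborel) \<le> (\<integral>\<^sup>+w\<in>A'. J w \<partial>lborel)"
      by (intro nn_integral_mono) (auto simp: A_def A'_def split: split_indicator)
    have "(\<integral>\<^sup>+y\<in>A. J (y + h) \<partial>lborel) \<le> (\<integral>\<^sup>+y. J (y + h) * indicator A' (y + h) \<partial>lborel)"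
    proof (intro nn_integral_mono mult_left_mono)
      fix y
      have "y + h \<in> A'" if "y \<in> A"
        using that norm_triangle_ineq[of y h] norm_triangle_ineq2[of y "-h"] h \<open>\<delta> \<le> 1 / 8\<close>
        by (simp add: A_def A'_def)
      then show "indicator A y \<le> (indicator A' (y + h) :: ennreal)" by (auto split: split_indicator)
    qed auto
    also have "\<dots> = (\<integral>\<^sup>+w\<in>A'. J w \<partial>lborel)"
      by (rule nn_integral_lborel_shift[of "\<lambda>w. J w * indicator A' w"]) measurable
    finally show "(\<integral>\<^sup>+y\<in>A. J (y + h) \<partial>lborel) \<le> (\<integral>\<^sup>+w\<in>A'. J w \<partial>lborel)" .
  qed auto
  also have "\<dots> = ennreal (2 powr \<sigma> * 2) * (\<integral>\<^sup>+w\<in>A'. J w \<partial>lborel)"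
    by (simp add: ennreal_mult mult.assoc mult_2[symmetric])
  also have "\<dots> \<le> ennreal (2 powr \<sigma> * 2) * (D * (ennreal (N * (4 * N) ^ CARD('n)) * (X * V)))"
    by (intro mult_left_mono stepJ) auto
  finally have "V * (\<integral>\<^sup>+y\<in>A. g (y + h) y \<partial>lborel)
      \<le> V * (ennreal (2 powr \<sigma> * 2) * (D * (ennreal (N * (4 * N) ^ CARD('n)) * X)))"
    by (simp add: mult_ac)
  then have "(\<integral>\<^sup>+y\<in>A. g (y + h) y \<partial>lborel) \<le> ennreal (2 powr \<sigma> * 2) * (D * (ennreal (N * (4 * N) ^ CARD('n)) * X))"
  proof (subst (asm) ennreal_mult_le_mult_iff)
    have "0 < V" unfolding V ennreal_less_zero_iff by (rule Vpos)
    then show "V \<noteq> 0" by simp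
    show "V \<noteq> top" by (simp add: V)
  qed
  also have "\<dots> = ennreal (translation_const TYPE('n) \<sigma>) * X"
    using reflection_density_nonneg[where 'n='n] N
    by (simp add: translation_const_def D_def N_def ennreal_mult mult_ac)
  finally show ?thesis by (simp add: A_def g_def)
qed

section \<open>The surface measure of the unit sphere\<close>

lemma borel_measurable_sgn_vector [measurable]:
  "(sgn :: 'a::euclidean_space \<Rightarrow> 'a) \<in> borel_measurable borel"
  unfolding sgn_div_norm by measurable

text \<open>The measure on Borel sets whose completion is \<open>sphere_measure\<close>.\<close>

definition sphere_borel :: "(real^'n) measure" where
  "sphere_borel = distr (uniform_measure lborel (ball 0 1)) borel sgn"

lemma sphere_measure_eq: "sphere_measure = completion sphere_borel"
  by (simp add: sphere_measure_def sphere_borel_def)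

lemma sets_sphere_borel [simp, measurable_cong]: "sets sphere_borel = sets borel"
  by (simp add: sphere_borel_def)

lemma space_sphere_borel [simp]: "space sphere_borel = UNIV"
  by (simp add: sphere_borel_def)

lemma emeasure_ball_one:
  fixes x :: "real^'n"
  shows "0 < emeasure lborel (ball x 1)" "emeasure lborel (ball x 1) < top" "emeasure lborel (ball x 1) \<noteq> 0"
proof -
  show "0 < emeasure lborel (ball x 1)" by (simp add: emeasure_ball)
  then show "emeasure lborel (ball x 1) \<noteq> 0" by simp
qed (simp add: emeasure_ball)

lemma nn_integral_sphere_borel:
  fixes f :: "real^'n \<Rightarrow> ennreal"
  assumes [measurable]: "f \<in> borel_measurable borel"
  shows "(\<integral>\<^sup>+x. f x \<partial>sphere_borel)
    = (\<integral>\<^sup>+x\<in>ball 0 1. f (sgn x) \<partial>lborel) / emeasure lborel (ball (0::real^'n) 1)"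
  unfolding sphere_borel_def by (simp add: nn_integral_distr nn_integral_uniform_measure)

text \<open>The preimage under \<open>sgn\<close> is a cone, so by scaling it is null as soon as its part in the unit ball is null.\<close>

lemma null_sets_sphere_borel_iff:
  "N \<in> null_sets sphere_borel \<longleftrightarrow> N \<in> sets borel \<and> sgn -` N \<in> null_sets (lborel :: (real^'n) measure)"
proof (cases "N \<in> sets borel")
  case True
  then have [measurable]: "N \<in> sets borel" by simp
  have [measurable]: "sgn -` N \<in> sets borel" using measurable_sets[OF borel_measurable_sgn_vector, of N] by simp
  have "emeasure sphere_borel N = (\<integral>\<^sup>+x\<in>ball 0 1. indicator N (sgn x) \<partial>lborel) / emeasure lborel (ball (0::real^'n) 1)"
    using nn_integral_sphere_borel[of "indicator N"] by simp
  also have "(\<integral>\<^sup>+x\<in>ball 0 1. indicator N (sgn x) \<partial>lborel) = emeasure lborel (sgn -` N \<inter> ball 0 1)"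
  proof -
    have "(\<integral>\<^sup>+x\<in>ball 0 1. indicator N (sgn x) \<partial>lborel)
        = (\<integral>\<^sup>+x. indicator (sgn -` N \<inter> ball 0 1) x \<partial>(lborel :: (real^'n) measure))"
      by (intro nn_integral_cong) (auto split: split_indicator)
    then show ?thesis by simp
  qed
  finally have "emeasure sphere_borel N = 0 \<longleftrightarrow> emeasure lborel (sgn -` N \<inter> ball 0 1) = 0"
    using emeasure_ball_one(2)[of "0::real^'n"] by (auto simp: ennreal_divide_eq_0_iff)
  also have "\<dots> \<longleftrightarrow> emeasure lborel (sgn -` N) = 0"
  proof
    assume null: "emeasure lborel (sgn -` N \<inter> ball 0 1) = 0"
    have "emeasure lborel (sgn -` N \<inter> ball 0 (Suc k)) = 0" for k
    proof -
      have eq: "indicator (sgn -` N \<inter> ball 0 (Suc k)) (0 + real (Suc k) *\<^sub>R x) = (indicator (sgn -` N \<inter> ball 0 1) x :: ennreal)" for x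
      proof -
        have "sgn (real (Suc k) *\<^sub>R x) = sgn x" by (simp add: sgn_scaleR)
        moreover have "real (Suc k) *\<^sub>R x \<in> ball 0 (real (Suc k)) \<longleftrightarrow> x \<in> ball 0 1"
        proof -
          have "real (Suc k) * norm x < real (Suc k) * 1 \<longleftrightarrow> norm x < 1"
            by (subst mult_less_cancel_left_pos) auto
          then show ?thesis by simp
        qed
        ultimately show ?thesis by (simp add: indicator_def)
      qed
      have "emeasure lborel (sgn -` N \<inter> ball 0 (Suc k)) = (\<integral>\<^sup>+x. indicator (sgn -` N \<inter> ball 0 (Suc k)) x \<partial>lborel)"
        by simp
      also have "\<dots> = ennreal (\<bar>real (Suc k)\<bar> ^ DIM(real^'n)) * (\<integral>\<^sup>+x. indicator (sgn -` N \<inter> ball 0 1) x \<partial>lborel)"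
        unfolding eq[symmetric]
        by (intro nn_integral_lborel_scale borel_measurable_indicator sets.Int) auto
      also have "\<dots> = 0" using null by simp
      finally show ?thesis .
    qed
    then have "(\<Union>k. sgn -` N \<inter> ball 0 (real (Suc k))) \<in> null_sets lborel"
      by (intro null_sets_UN) (auto simp: null_sets_def)
    also have "(\<Union>k. sgn -` N \<inter> ball 0 (real (Suc k))) = sgn -` N"
    proof -
      have "\<exists>k. norm x < real (Suc k)" for x :: "real^'n"
        using reals_Archimedean2[of "norm x"] by (metis less_trans lessI of_nat_less_iff)
      then show ?thesis by auto
    qed
    finally show "emeasure lborel (sgn -` N) = 0" by auto
  next
    assume "emeasure lborel (sgn -` N) = 0"
    then show "emeasure lborel (sgn -` N \<inter> ball 0 1) = 0"
      using emeasure_mono[of "sgn -` N \<inter> ball 0 1" "sgn -` N" lborel] by auto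
  qed
  finally show ?thesis using True by (auto simp: null_sets_def)
qed (auto simp: null_sets_def)

lemma AE_sphere_borel_imp_AE_lborel:
  assumes "AE x in sphere_borel. P x"
  shows "AE x in lborel. P (sgn x)"
proof -
  obtain N where N: "N \<in> null_sets sphere_borel" "{x. \<not> P x} \<subseteq> N"
    using assms by (auto simp: eventually_ae_filter)
  then show ?thesis
    using N(1)[unfolded null_sets_sphere_borel_iff] by (intro AE_I'[of "sgn -` N"]) auto
qed

lemma orthogonal_matrix_sgn:
  fixes Q :: "real^'n^'n"
  assumes "orthogonal_matrix Q"
  shows "sgn (Q *v x) = Q *v sgn x"
proof -
  have "norm (Q *v x) = norm x"
    using assms orthogonal_transformation_matrix[of "(*v) Q"]
    by (metis orthogonal_transformation_norm matrix_of_matrix_vector_mul matrix_vector_mul_linear)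
  then show ?thesis by (simp add: sgn_div_norm matrix_vector_mult_scaleR)
qed

text \<open>The cone over a rotated set is the rotated cone, and orthogonal maps preserve Lebesgue null sets.\<close>

lemma AE_sphere_borel_rotate:
  fixes Q :: "real^'n^'n"
  assumes "AE x in sphere_borel. P x" and Q: "orthogonal_matrix Q"
  shows "AE x in sphere_borel. P (Q *v x)"
proof -
  obtain N where N: "N \<in> null_sets sphere_borel" "{x. \<not> P x} \<subseteq> N"
    using assms by (auto simp: eventually_ae_filter)
  have QN: "(\<lambda>x. Q *v x) \<in> borel_measurable borel"
    by (rule borel_measurable_continuous_onI) (rule linear_continuous_on, simp add: linear_linear)
  have Nb: "N \<in> sets borel" "sgn -` N \<in> null_sets lborel" using N(1) null_sets_sphere_borel_iff by auto
  have pre: "((*v) Q) -` X = (*v) (transpose Q) ` X" for X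
  proof -
    have "transpose Q *v (Q *v x) = x" "Q *v (transpose Q *v x) = x" for x
      using Q by (metis matrix_vector_mul_assoc matrix_vector_mul_lid orthogonal_matrix_def)+
    then show ?thesis by (auto simp: image_iff) metis
  qed
  have "((*v) Q) -` N \<in> sets borel" using measurable_sets[OF QN Nb(1)] by simp
  moreover have "sgn -` (((*v) Q) -` N) \<in> null_sets lborel"
  proof -
    have eq: "sgn -` (((*v) Q) -` N) = ((*v) Q) -` (sgn -` N)" using orthogonal_matrix_sgn[OF Q] by auto
    have "sgn -` N \<in> null_sets lebesgue" using Nb(2) null_sets_completion_iff2 by blast
    then have "negligible (sgn -` N)" by (simp add: negligible_iff_null_sets)
    then have "negligible ((*v) (transpose Q) ` (sgn -` N))"
      by (intro negligible_differentiable_image_negligible linear_imp_differentiable_on) (auto intro: matrix_vector_mul_linear)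
    then have "((*v) Q) -` (sgn -` N) \<in> null_sets lebesgue" by (simp add: pre negligible_iff_null_sets)
    moreover have "((*v) Q) -` (sgn -` N) \<in> sets lborel"
      using measurable_sets[OF QN, of "sgn -` N"] Nb(2) by auto
    ultimately show ?thesis unfolding eq by (simp add: null_sets_completion_iff)
  qed
  ultimately have "((*v) Q) -` N \<in> null_sets sphere_borel" by (simp add: null_sets_sphere_borel_iff)
  then show ?thesis using N(2) by (intro AE_I'[of "((*v) Q) -` N"]) auto
qed

text \<open>Functions in \<open>sphere_L\<close> are measurable for a completed measure only. A Borel version that is still
  homogeneous permits integration over products and along translates.\<close>

definition borel_version :: "(real^'n \<Rightarrow> complex) \<Rightarrow> (real^'n \<Rightarrow> complex) \<Rightarrow> bool" where
  "borel_version \<Omega> \<Omega>' \<longleftrightarrow> \<Omega>' \<in> borel_measurable borel \<and> homogeneous_zero \<Omega>' \<and>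
     (AE x in sphere_borel. \<Omega> x = \<Omega>' x)"

lemma homogeneous_zero_sgn:
  assumes "homogeneous_zero \<Omega>" shows "x \<noteq> 0 \<Longrightarrow> \<Omega> (sgn x) = \<Omega> x"
  using assms[unfolded homogeneous_zero_def, rule_format, of "inverse (norm x)" x]
  by (simp add: sgn_div_norm)

lemma completion_ex_borel_measurable_complex:
  fixes g :: "'a \<Rightarrow> complex"
  assumes "g \<in> borel_measurable (completion M)"
  shows "\<exists>g'\<in>borel_measurable M. AE x in M. g x = g' x"
proof -
  have "(\<lambda>x. Re (g x)) \<in> borel_measurable (completion M)" "(\<lambda>x. Im (g x)) \<in> borel_measurable (completion M)"
    using assms by measurable
  then obtain a b where ab: "a \<in> borel_measurable M" "b \<in> borel_measurable M"
    "AE x in M. Re (g x) = a x" "AE x in M. Im (g x) = b x"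
    using completion_ex_borel_measurable_real by metis
  show ?thesis
  proof (rule bexI[of _ "\<lambda>x. Complex (a x) (b x)"])
    show "AE x in M. g x = Complex (a x) (b x)"
      using ab(3,4) by eventually_elim (simp add: complex_eq_iff)
    have "(\<lambda>x. of_real (a x) + \<i> * of_real (b x)) \<in> borel_measurable M" using ab by measurable
    then show "(\<lambda>x. Complex (a x) (b x)) \<in> borel_measurable M" by (simp add: complex_eq_iff Complex_eq)
  qed
qed

lemma AE_neq_zero: "AE x in lborel. x \<noteq> (0::'a::euclidean_space)"
  by (rule AE_I'[of "{0}"]) auto

lemma borel_version_exists:
  assumes "\<Omega> \<in> borel_measurable sphere_measure"
  obtains \<Omega>' where "borel_version \<Omega> \<Omega>'"
proof -
  obtain \<Omega>0 where \<Omega>0: "\<Omega>0 \<in> borel_measurable borel" "AE x in sphere_borel. \<Omega> x = \<Omega>0 x"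
    using completion_ex_borel_measurable_complex[of \<Omega> sphere_borel] assms
      measurable_cong_sets[OF sets_sphere_borel refl, of borel]
    unfolding sphere_measure_eq by blast
  have sphere: "AE x in sphere_borel. sgn x = (x::real^'n)"
  proof -
    have "{x::real^'n. sgn x \<noteq> x} \<in> null_sets sphere_borel"
      unfolding null_sets_sphere_borel_iff
    proof
      show "{x::real^'n. sgn x \<noteq> x} \<in> sets borel" by measurable
      have "sgn -` {x::real^'n. sgn x \<noteq> x} = {}" by (auto simp: sgn_div_norm)
      then show "sgn -` {x::real^'n. sgn x \<noteq> x} \<in> null_sets lborel" by simp
    qed
    then show ?thesis by (intro AE_I'[of "{x. sgn x \<noteq> x}"]) auto
  qed
  have "borel_version \<Omega> (\<lambda>x. \<Omega>0 (sgn x))"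
    unfolding borel_version_def
  proof (intro conjI)
    show "(\<lambda>x. \<Omega>0 (sgn x)) \<in> borel_measurable borel" using \<Omega>0(1) by measurable
    show "homogeneous_zero (\<lambda>x. \<Omega>0 (sgn x))" by (simp add: homogeneous_zero_def sgn_scaleR)
    show "AE x in sphere_borel. \<Omega> x = \<Omega>0 (sgn x)"
      using \<Omega>0(2) sphere by eventually_elim simp
  qed
  then show ?thesis by (rule that)
qed

lemma borel_version_AE_lborel:
  assumes "borel_version \<Omega> \<Omega>'" "homogeneous_zero \<Omega>"
  shows "AE x in lborel. \<Omega> x = \<Omega>' x"
proof -
  have "AE x in lborel. \<Omega> (sgn x) = \<Omega>' (sgn x)"
    using assms by (intro AE_sphere_borel_imp_AE_lborel) (auto simp: borel_version_def)
  then show ?thesis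
    using AE_neq_zero assms homogeneous_zero_sgn[of \<Omega>] homogeneous_zero_sgn[of \<Omega>']
    by (auto simp: borel_version_def elim: eventually_elim2)
qed

text \<open>Polar coordinates for a function that is homogeneous of degree zero. On the left stands the
  Borel version \<open>g\<close>, on the right the function \<open>f\<close> that agrees with it almost everywhere on the sphere.\<close>

lemma nn_integral_ball_homogeneous:
  fixes g :: "real^'n \<Rightarrow> ennreal"
  assumes [measurable]: "g \<in> borel_measurable borel" and hom: "\<And>c x. 0 < c \<Longrightarrow> g (c *\<^sub>R x) = g x"
    and fg: "AE x in sphere_borel. f x = g x" and R: "0 < R"
  shows "(\<integral>\<^sup>+x\<in>ball 0 R. g x \<partial>lborel)
    = ennreal (unit_ball_vol CARD('n) * R ^ CARD('n)) * (\<integral>\<^sup>+x. f x \<partial>sphere_measure)"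
proof -
  let ?v = "emeasure lborel (ball (0::real^'n) 1)"
  have "(\<integral>\<^sup>+x. f x \<partial>sphere_measure) = (\<integral>\<^sup>+x. g x \<partial>sphere_borel)"
    using fg unfolding sphere_measure_eq nn_integral_completion by (intro nn_integral_cong_AE) auto
  also have "\<dots> = (\<integral>\<^sup>+x\<in>ball 0 1. g (sgn x) \<partial>lborel) / ?v"
    by (rule nn_integral_sphere_borel) simp
  also have "(\<integral>\<^sup>+x\<in>ball 0 1. g (sgn x) \<partial>lborel) = (\<integral>\<^sup>+x\<in>ball 0 1. g x \<partial>lborel)"
  proof (rule nn_integral_cong_AE)
    show "AE x in lborel. g (sgn x) * indicator (ball 0 1) x = g x * indicator (ball 0 1) x"
      using AE_neq_zero
    proof eventually_elim
      case (elim x)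
      then show ?case using hom[of "inverse (norm x)" x] by (simp add: sgn_div_norm)
    qed
  qed
  finally have "?v * (\<integral>\<^sup>+x. f x \<partial>sphere_measure) = (\<integral>\<^sup>+x\<in>ball 0 1. g x \<partial>lborel)"
    using emeasure_ball_one[of "0::real^'n"]
    by (simp add: ennreal_times_divide mult.commute[of ?v] ennreal_mult_divide_eq)
  moreover have "(\<integral>\<^sup>+x\<in>ball 0 R. g x \<partial>lborel) = ennreal (R ^ CARD('n)) * (\<integral>\<^sup>+x\<in>ball 0 1. g x \<partial>lborel)"
  proof -
    have "(\<integral>\<^sup>+x\<in>ball 0 R. g x \<partial>lborel) = ennreal (\<bar>R\<bar> ^ DIM(real^'n)) *
        (\<integral>\<^sup>+x. g (0 + R *\<^sub>R x) * indicator (ball 0 R) (0 + R *\<^sub>R x) \<partial>lborel)"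
      unfolding indicator_ball using R by (intro nn_integral_lborel_scale) auto
    also have "(\<integral>\<^sup>+x. g (0 + R *\<^sub>R x) * indicator (ball 0 R) (0 + R *\<^sub>R x) \<partial>lborel) = (\<integral>\<^sup>+x\<in>ball 0 1. g x \<partial>lborel)"
      using R hom[OF R] by (intro nn_integral_cong) (simp add: indicator_ball mult_less_cancel_left_pos[of R _ 1, simplified])
    finally show ?thesis using R by simp
  qed
  moreover have "?v = ennreal (unit_ball_vol CARD('n))" by (simp add: emeasure_ball)
  moreover have "ennreal (unit_ball_vol CARD('n) * R ^ CARD('n)) = ennreal (R ^ CARD('n)) * ennreal (unit_ball_vol CARD('n))"
    using R by (subst mult.commute) (intro ennreal_mult, auto)
  ultimately show ?thesis by (simp add: mult.assoc)
qed

section \<open>Dual bounds on annuli\<close>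

lemma AE_lborel_affine:
  fixes t :: "'a::euclidean_space"
  assumes "AE x in lborel. P x" and c: "c \<noteq> 0"
  shows "AE x in lborel. P (t + c *\<^sub>R x)"
proof -
  obtain N where N: "N \<in> null_sets lborel" "{x. \<not> P x} \<subseteq> N"
    using assms by (auto simp: eventually_ae_filter)
  have [measurable]: "N \<in> sets borel" using N by auto
  have "(\<integral>\<^sup>+x. indicator N x \<partial>lborel) = ennreal (\<bar>c\<bar> ^ DIM('a)) * (\<integral>\<^sup>+x. indicator N (t + c *\<^sub>R x) \<partial>lborel)"
    by (rule nn_integral_lborel_scale[OF _ c]) measurable
  then have "(\<integral>\<^sup>+x. indicator N (t + c *\<^sub>R x) \<partial>lborel) = 0" using N(1) c by auto
  then have "AE x in lborel. indicator N (t + c *\<^sub>R x) = (0::ennreal)"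
    by (subst (asm) nn_integral_0_iff_AE) measurable
  then show ?thesis
  proof eventually_elim
    case (elim x)
    then have "t + c *\<^sub>R x \<notin> N" by (auto split: split_indicator_asm)
    then show ?case using N(2) by auto
  qed
qed

lemma set_nn_integral_Holder_bound:
  fixes f g :: "'a \<Rightarrow> real"
  assumes meas [measurable]: "f \<in> borel_measurable M" "g \<in> borel_measurable M" and S: "S \<in> sets M"
    and "\<And>x. 0 \<le> f x" "\<And>x. 0 \<le> g x" "1 < a" "1 < b" "1 / a + 1 / b = 1" "0 \<le> A" "0 \<le> B"
    and "(\<integral>\<^sup>+x\<in>S. ennreal (f x powr a) \<partial>M) \<le> ennreal (A powr a)"
    and "(\<integral>\<^sup>+x\<in>S. ennreal (g x powr b) \<partial>M) \<le> ennreal (B powr b)"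
  shows "(\<integral>\<^sup>+x\<in>S. ennreal (f x * g x) \<partial>M) \<le> ennreal (A * B)"
proof -
  have S': "S \<inter> space M \<in> sets M" using S by auto
  show ?thesis
    using assms unfolding nn_integral_restrict_space[OF S', symmetric]
    by (intro nn_integral_Holder_bound[where a = a and b = b] measurable_restrict_space1) auto
qed

definition annulus :: "real \<Rightarrow> (real^'n) set" where
  "annulus \<rho> = {y. \<rho> \<le> norm y \<and> norm y < 2 * \<rho>}"

lemma annulus_sets [measurable]: "annulus \<rho> \<in> sets borel"
  unfolding annulus_def by measurable

text \<open>The dual form of the statement that the \<open>L\<^sup>s\<close> norm of a nonnegative \<open>g\<close> on the annulus is at most \<open>B\<close>, where
  \<open>s'\<close> is the exponent conjugate to \<open>s\<close>. Finite and infinite \<open>s\<close> can be treated together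
  in this form, the latter being the case \<open>s' = 1\<close>.\<close>

definition annular_bound :: "real \<Rightarrow> real \<Rightarrow> (real^'n \<Rightarrow> real) \<Rightarrow> real \<Rightarrow> bool" where
  "annular_bound s' \<rho> g B \<longleftrightarrow> (\<forall>F A. F \<in> borel_measurable borel \<longrightarrow> (\<forall>x. 0 \<le> F x) \<longrightarrow> 0 \<le> A \<longrightarrow>
     (\<integral>\<^sup>+y\<in>annulus \<rho>. ennreal (F y powr s') \<partial>lborel) \<le> ennreal (A powr s') \<longrightarrow>
     (\<integral>\<^sup>+y\<in>annulus \<rho>. ennreal (g y * F y) \<partial>lborel) \<le> ennreal (B * A))"

lemma annular_boundD:
  assumes "annular_bound s' \<rho> g B" "F \<in> borel_measurable borel" "\<And>x. 0 \<le> F x" "0 \<le> A"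
    "(\<integral>\<^sup>+y\<in>annulus \<rho>. ennreal (F y powr s') \<partial>lborel) \<le> ennreal (A powr s')"
  shows "(\<integral>\<^sup>+y\<in>annulus \<rho>. ennreal (g y * F y) \<partial>lborel) \<le> ennreal (B * A)"
  using assms unfolding annular_bound_def by blast

lemma annular_bound_Holder:
  fixes g :: "real^'n \<Rightarrow> real"
  assumes "g \<in> borel_measurable borel" "\<And>x. 0 \<le> g x" "1 < \<sigma>" "1 < s'" "1 / \<sigma> + 1 / s' = 1" "0 \<le> B"
    and "(\<integral>\<^sup>+y\<in>annulus \<rho>. ennreal (g y powr \<sigma>) \<partial>lborel) \<le> ennreal (B powr \<sigma>)"
  shows "annular_bound s' \<rho> g B"
  unfolding annular_bound_def
proof (intro allI impI)
  fix F :: "real^'n \<Rightarrow> real" and A :: real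
  assume F: "F \<in> borel_measurable borel" "\<forall>x. 0 \<le> F x" "0 \<le> A"
    "(\<integral>\<^sup>+y\<in>annulus \<rho>. ennreal (F y powr s') \<partial>lborel) \<le> ennreal (A powr s')"
  show "(\<integral>\<^sup>+y\<in>annulus \<rho>. ennreal (g y * F y) \<partial>lborel) \<le> ennreal (B * A)"
    by (rule set_nn_integral_Holder_bound[where a = \<sigma> and b = s']) (use assms F in auto)
qed

lemma annular_bound_AE:
  fixes g :: "real^'n \<Rightarrow> real"
  assumes "AE y in lborel. y \<in> annulus \<rho> \<longrightarrow> g y \<le> B" "0 \<le> B"
  shows "annular_bound 1 \<rho> g B"
  unfolding annular_bound_def
proof (intro allI impI)
  fix F :: "real^'n \<Rightarrow> real" and A :: real
  assume F [measurable]: "F \<in> borel_measurable borel" and F0: "\<forall>x. 0 \<le> F x" and A: "0 \<le> A"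
    and FA: "(\<integral>\<^sup>+y\<in>annulus \<rho>. ennreal (F y powr 1) \<partial>lborel) \<le> ennreal (A powr 1)"
  have "(\<integral>\<^sup>+y\<in>annulus \<rho>. ennreal (g y * F y) \<partial>lborel)
      \<le> (\<integral>\<^sup>+y. ennreal B * (ennreal (F y powr 1) * indicator (annulus \<rho>) y) \<partial>lborel)"
  proof (rule nn_integral_mono_AE)
    show "AE y in lborel. ennreal (g y * F y) * indicator (annulus \<rho>) y
        \<le> ennreal B * (ennreal (F y powr 1) * indicator (annulus \<rho>) y)"
      using assms(1)
    proof eventually_elim
      case (elim y)
      have "ennreal (g y * F y) \<le> ennreal (B * F y)" if "y \<in> annulus \<rho>"
        using elim that F0 by (intro ennreal_leI mult_right_mono) auto
      then show ?case using F0 assms(2) by (auto simp: ennreal_mult split: split_indicator)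
    qed
  qed
  also have "\<dots> = ennreal B * (\<integral>\<^sup>+y\<in>annulus \<rho>. ennreal (F y powr 1) \<partial>lborel)"
    by (intro nn_integral_cmult) simp
  also have "\<dots> \<le> ennreal B * ennreal (A powr 1)" by (intro mult_left_mono FA) auto
  also have "\<dots> = ennreal (B * A)" using A assms(2) by (simp add: ennreal_mult)
  finally show "(\<integral>\<^sup>+y\<in>annulus \<rho>. ennreal (g y * F y) \<partial>lborel) \<le> ennreal (B * A)" .
qed

lemma annular_bound_combine:
  fixes g g1 g2 :: "real^'n \<Rightarrow> real"
  assumes [measurable]: "g1 \<in> borel_measurable borel" "g2 \<in> borel_measurable borel"
    and nonneg: "\<And>y. 0 \<le> g1 y" "\<And>y. 0 \<le> g2 y" "0 \<le> a" "0 \<le> b" "0 \<le> B1" "0 \<le> B2"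
    and le: "\<And>y. y \<in> annulus \<rho> \<Longrightarrow> g y \<le> a * g1 y + b * g2 y"
    and bounds: "annular_bound s' \<rho> g1 B1" "annular_bound s' \<rho> g2 B2"
  shows "annular_bound s' \<rho> g (a * B1 + b * B2)"
  unfolding annular_bound_def
proof (intro allI impI)
  fix F :: "real^'n \<Rightarrow> real" and A :: real
  assume Fm [measurable]: "F \<in> borel_measurable borel" and F0: "\<forall>x. 0 \<le> F x" and A: "0 \<le> A"
    and FA: "(\<integral>\<^sup>+y\<in>annulus \<rho>. ennreal (F y powr s') \<partial>lborel) \<le> ennreal (A powr s')"
  have "(\<integral>\<^sup>+y\<in>annulus \<rho>. ennreal (g y * F y) \<partial>lborel)
     \<le> (\<integral>\<^sup>+y. ennreal a * (ennreal (g1 y * F y) * indicator (annulus \<rho>) y)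
           + ennreal b * (ennreal (g2 y * F y) * indicator (annulus \<rho>) y) \<partial>lborel)"
  proof (rule nn_integral_mono)
    fix y
    show "ennreal (g y * F y) * indicator (annulus \<rho>) y
      \<le> ennreal a * (ennreal (g1 y * F y) * indicator (annulus \<rho>) y)
           + ennreal b * (ennreal (g2 y * F y) * indicator (annulus \<rho>) y)"
    proof (cases "y \<in> annulus \<rho>")
      case True
      have "g y * F y \<le> (a * g1 y + b * g2 y) * F y" using le[OF True] F0 by (intro mult_right_mono) auto
      then have "ennreal (g y * F y) \<le> ennreal (a * (g1 y * F y) + b * (g2 y * F y))"
        by (intro ennreal_leI) (simp add: algebra_simps)
      also have "\<dots> = ennreal a * ennreal (g1 y * F y) + ennreal b * ennreal (g2 y * F y)"
        using nonneg F0 by (simp add: ennreal_plus ennreal_mult)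
      finally show ?thesis using True by simp
    qed simp
  qed
  also have "\<dots> = ennreal a * (\<integral>\<^sup>+y\<in>annulus \<rho>. ennreal (g1 y * F y) \<partial>lborel)
      + ennreal b * (\<integral>\<^sup>+y\<in>annulus \<rho>. ennreal (g2 y * F y) \<partial>lborel)"
    by (simp add: nn_integral_add nn_integral_cmult)
  also have "\<dots> \<le> ennreal a * ennreal (B1 * A) + ennreal b * ennreal (B2 * A)"
    using F0 by (intro add_mono mult_left_mono annular_boundD[OF bounds(1)] annular_boundD[OF bounds(2)] Fm A FA) auto
  also have "\<dots> = ennreal ((a * B1 + b * B2) * A)"
    using nonneg A by (simp add: ennreal_mult[symmetric] distrib_right mult.assoc flip: ennreal_plus)
  finally show "(\<integral>\<^sup>+y\<in>annulus \<rho>. ennreal (g y * F y) \<partial>lborel) \<le> ennreal ((a * B1 + b * B2) * A)" .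
qed

section \<open>The Dini condition on dyadic scales\<close>

lemma dini_modulus_mono: "\<delta> \<le> \<delta>' \<Longrightarrow> dini_modulus s \<Omega> \<delta> \<le> dini_modulus s \<Omega> \<delta>'"
  unfolding dini_modulus_def by (intro SUP_subset_mono) auto

text \<open>On the interval from \<open>2 powr - (j + 1)\<close> to \<open>2 powr - j\<close> the integrand of the Dini condition is at least the
  modulus at the left end point times \<open>2 powr ((1 + \<beta>) * j)\<close>, because the modulus is monotone.\<close>

lemma dini_modulus_dyadic:
  fixes \<Omega> :: "real^'n \<Rightarrow> complex"
  assumes "dini s \<beta> \<Omega>" "0 < \<beta>"
  obtains D :: "nat \<Rightarrow> real" where "\<And>j. 0 \<le> D j"
    "\<And>j. dini_modulus s \<Omega> (2 powr - (real j + 1)) = ennreal (D j)"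
    "summable (\<lambda>j. D j * 2 powr (\<beta> * real j))"
proof -
  define E where "E j = dini_modulus s \<Omega> (2 powr - (real j + 1))" for j :: nat
  define I where "I j = {2 powr - (real j + 1) <..< 2 powr - real j}" for j :: nat
  define c where "c j = ennreal (2 powr ((1 + \<beta>) * real j))" for j :: nat
  let ?f = "\<lambda>\<delta>. dini_modulus s \<Omega> \<delta> / ennreal (\<delta> powr (1 + \<beta>)) * indicator {0<..<1} \<delta>"
  have pos: "c j * E j \<le> ?f \<delta>" if "\<delta> \<in> I j" for j \<delta>
  proof -
    have d: "2 powr - (real j + 1) < \<delta>" "\<delta> < 2 powr - real j" using that by (auto simp: I_def)
    have d0: "0 < \<delta>" using d(1) powr_gt_zero[of 2 "- (real j + 1)"] by linarith
    have d1: "\<delta> < 1" using d(2) powr_mono[of "- real j" 0 2] by simp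
    have pw: "\<delta> powr (1 + \<beta>) \<le> (2 powr - real j) powr (1 + \<beta>)"
      using d0 d(2) assms(2) by (intro powr_mono2) auto
    have "inverse ((2 powr - real j) powr (1 + \<beta>)) \<le> inverse (\<delta> powr (1 + \<beta>))"
      using pw d0 by (intro le_imp_inverse_le) auto
    moreover have "inverse ((2 powr - real j) powr (1 + \<beta>)) = 2 powr ((1 + \<beta>) * real j)"
      unfolding powr_powr powr_minus[symmetric] by (simp add: algebra_simps)
    ultimately have "2 powr ((1 + \<beta>) * real j) \<le> inverse (\<delta> powr (1 + \<beta>))" by simp
    then have "c j \<le> inverse (ennreal (\<delta> powr (1 + \<beta>)))"
      using d0 unfolding c_def by (subst inverse_ennreal) (auto intro: ennreal_leI)
    moreover have "E j \<le> dini_modulus s \<Omega> \<delta>" unfolding E_def using d by (intro dini_modulus_mono) auto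
    ultimately have "c j * E j \<le> dini_modulus s \<Omega> \<delta> / ennreal (\<delta> powr (1 + \<beta>))"
      unfolding divide_ennreal_def by (subst mult.commute) (intro mult_mono, auto)
    then show ?thesis using d0 d1 by simp
  qed
  show ?thesis
  proof -
    \<comment> \<open>At most one term of the sum below is nonzero at each point.\<close>
    have disj: "I j \<inter> I k = {}" if "j < k" for j k
    proof -
      have "2 powr - real k \<le> 2 powr - (real j + 1)" using that by (intro powr_mono) auto
      then show ?thesis by (auto simp: I_def)
    qed
    have "(\<Sum>j. c j * E j * indicator (I j) \<delta>) \<le> ?f \<delta>" for \<delta>
    proof (cases "\<exists>k. \<delta> \<in> I k")
      case True
      then obtain k where k: "\<delta> \<in> I k" by blast
      then have "\<delta> \<notin> I j" if "j \<noteq> k" for j using disj[of j k] disj[of k j] that by (cases "j < k") auto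
      then have "(\<Sum>j. c j * E j * indicator (I j) \<delta>) = (\<Sum>j\<in>{k}. c j * E j * indicator (I j) \<delta>)"
        by (intro suminf_finite) auto
      then show ?thesis using pos[OF k] k by simp
    qed auto
    then have "(\<integral>\<^sup>+\<delta>. (\<Sum>j. c j * E j * indicator (I j) \<delta>) \<partial>lebesgue) \<le> (\<integral>\<^sup>+\<delta>. ?f \<delta> \<partial>lebesgue)"
      by (intro nn_integral_mono)
    also have "\<dots> < \<infinity>" using assms by (simp add: dini_def)
    also have "(\<integral>\<^sup>+\<delta>. (\<Sum>j. c j * E j * indicator (I j) \<delta>) \<partial>lebesgue) = (\<Sum>j. c j * E j * emeasure lborel (I j))"
      unfolding nn_integral_completion
      by (subst nn_integral_suminf) (auto simp: I_def nn_integral_cmult_indicator)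
    also have "(\<lambda>j. c j * E j * emeasure lborel (I j)) = (\<lambda>j. E j * ennreal (2 powr (\<beta> * real j) / 2))"
    proof
      fix j
      have "- (real j + 1) = - real j - 1" by simp
      then have eq: "(2::real) powr - (real j + 1) = 2 powr - real j / 2"
        by (simp only: powr_diff powr_one zero_le_numeral)
      have "2 powr - (real j + 1) \<le> (2::real) powr - real j" by (intro powr_mono) auto
      then have "emeasure lborel (I j) = ennreal (2 powr - real j - 2 powr - (real j + 1))"
        unfolding I_def by (intro emeasure_lborel_Ioo)
      then have "emeasure lborel (I j) = ennreal (2 powr - real j / 2)" unfolding eq by simp
      moreover have "c j * ennreal (2 powr - real j / 2) = ennreal (2 powr (\<beta> * real j) / 2)"
      proof -
        have "2 powr ((1 + \<beta>) * real j) * 2 powr - real j = (2::real) powr (\<beta> * real j)"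
          unfolding powr_add[symmetric] by (rule arg_cong[where f="(powr) 2"]) (simp add: algebra_simps)
        then have "2 powr ((1 + \<beta>) * real j) * (2 powr - real j / 2) = (2::real) powr (\<beta> * real j) / 2"
          by simp
        then show ?thesis unfolding c_def by (subst ennreal_mult[symmetric]) auto
      qed
      ultimately show "c j * E j * emeasure lborel (I j) = E j * ennreal (2 powr (\<beta> * real j) / 2)"
        by (metis mult.assoc mult.commute)
    qed
    finally have fin: "(\<Sum>j. E j * ennreal (2 powr (\<beta> * real j) / 2)) < \<infinity>" .
    have Efin: "E j \<noteq> \<infinity>" for j
    proof
      assume "E j = \<infinity>"
      then have "\<infinity> = E j * ennreal (2 powr (\<beta> * real j) / 2)"
        by (simp add: ennreal_top_mult ennreal_eq_0_iff not_le)
      also have "\<dots> \<le> (\<Sum>j. E j * ennreal (2 powr (\<beta> * real j) / 2))"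
        using sum_le_suminf[of "\<lambda>j. E j * ennreal (2 powr (\<beta> * real j) / 2)" "{j}"] by simp
      finally show False using fin by (simp add: top_unique)
    qed
    define D where "D j = enn2real (E j)" for j
    have DE: "E j = ennreal (D j)" for j using Efin[of j] by (simp add: D_def top.not_eq_extremum)
    have "summable (\<lambda>j. D j * (2 powr (\<beta> * real j) / 2))"
    proof (rule summable_suminf_not_top)
      show "0 \<le> D j * (2 powr (\<beta> * real j) / 2)" for j by (simp add: D_def)
      show "(\<Sum>j. ennreal (D j * (2 powr (\<beta> * real j) / 2))) \<noteq> top"
      proof -
        have "ennreal (D j * (2 powr (\<beta> * real j) / 2)) = E j * ennreal (2 powr (\<beta> * real j) / 2)" for j
          unfolding DE by (rule ennreal_mult) (auto simp: D_def)
        then show ?thesis using fin[unfolded infinity_ennreal_def, THEN less_imp_neq] by (simp only: simp_thms)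
      qed
    qed
    from summable_mult[OF this, of 2] have sum: "summable (\<lambda>j. D j * 2 powr (\<beta> * real j))" by simp
    show ?thesis
      by (rule that[of D]) (use sum DE in \<open>auto simp: D_def E_def\<close>)
  qed
qed

lemma emeasure_sphere_measure: "emeasure sphere_measure (UNIV :: (real^'n) set) < \<infinity>"
proof -
  have "emeasure sphere_measure (UNIV :: (real^'n) set) = emeasure sphere_borel (UNIV :: (real^'n) set)"
    unfolding sphere_measure_eq by simp
  also have "\<dots> = (\<integral>\<^sup>+x. 1 \<partial>(sphere_borel :: (real^'n) measure))" by simp
  also have "\<dots> = (\<integral>\<^sup>+x\<in>ball (0::real^'n) 1. 1 \<partial>lborel) / emeasure lborel (ball (0::real^'n) 1)"
    by (rule nn_integral_sphere_borel) simp
  also have "\<dots> = 1" using emeasure_ball_one[of "0::real^'n"] by (simp add: ennreal_divide_self)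
  finally show ?thesis by simp
qed

text \<open>The sphere has finite measure, so integrability of a power passes to smaller exponents.\<close>

lemma sphere_L_power_integrable:
  fixes \<Omega> :: "real^'n \<Rightarrow> complex"
  assumes "\<Omega> \<in> sphere_L s" "0 < a" "ennreal a \<le> s"
  shows "(\<integral>\<^sup>+x. ennreal (norm (\<Omega> x) powr a) \<partial>sphere_measure) < \<infinity>"
proof -
  have [measurable]: "\<Omega> \<in> borel_measurable sphere_measure" using assms by (simp add: sphere_L_def)
  have sp: "space sphere_measure = (UNIV :: (real^'n) set)" by (simp add: sphere_measure_eq)
  show ?thesis
  proof (cases "s = \<infinity>")
    case True
    define E where "E = esssup sphere_measure (\<lambda>x. ennreal (norm (\<Omega> x)))"
    have "E < \<infinity>" using assms True by (simp add: sphere_L_def E_def)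
    then obtain M where M: "0 \<le> M" "E = ennreal M" by (cases E) auto
    have "AE x in sphere_measure. ennreal (norm (\<Omega> x)) \<le> ennreal M"
      using esssup_AE[of "\<lambda>x. ennreal (norm (\<Omega> x))" sphere_measure] by (simp add: M(2)[symmetric] E_def)
    then have "(\<integral>\<^sup>+x. ennreal (norm (\<Omega> x) powr a) \<partial>sphere_measure) \<le> (\<integral>\<^sup>+x. ennreal (M powr a) \<partial>(sphere_measure :: (real^'n) measure))"
      using M assms(2) by (intro nn_integral_mono_AE) (auto elim!: eventually_mono intro!: ennreal_leI powr_mono2)
    also have "\<dots> < \<infinity>" using emeasure_sphere_measure[where 'n='n] by (simp add: sp ennreal_mult_less_top)
    finally show ?thesis .
  next
    case False
    then have fin: "(\<integral>\<^sup>+x. ennreal (norm (\<Omega> x) powr enn2real s) \<partial>sphere_measure) < \<infinity>"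
      using assms by (simp add: sphere_L_def)
    have "a \<le> enn2real s" using assms False by (cases s) auto
    have "(\<integral>\<^sup>+x. ennreal (norm (\<Omega> x) powr a) \<partial>sphere_measure)
       \<le> (\<integral>\<^sup>+x. 1 + ennreal (norm (\<Omega> x) powr enn2real s) \<partial>sphere_measure)"
    proof (rule nn_integral_mono)
      fix x
      have "norm (\<Omega> x) powr a \<le> 1 + norm (\<Omega> x) powr enn2real s"
      proof (cases "norm (\<Omega> x) \<le> 1")
        case True
        then have "norm (\<Omega> x) powr a \<le> 1" using assms(2) by (simp add: powr_le1)
        then show ?thesis by (simp add: add_increasing2)
      next
        case False
        then have "norm (\<Omega> x) powr a \<le> norm (\<Omega> x) powr enn2real s"
          using \<open>a \<le> enn2real s\<close> by (intro powr_mono) auto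
        then show ?thesis by simp
      qed
      then show "ennreal (norm (\<Omega> x) powr a) \<le> 1 + ennreal (norm (\<Omega> x) powr enn2real s)"
        by (metis ennreal_1 ennreal_leI ennreal_plus powr_ge_zero zero_le_one)
    qed
    also have "\<dots> = emeasure sphere_measure (UNIV :: (real^'n) set) + (\<integral>\<^sup>+x. ennreal (norm (\<Omega> x) powr enn2real s) \<partial>sphere_measure)"
      by (simp add: nn_integral_add sp)
    also have "\<dots> < \<infinity>" using fin emeasure_sphere_measure[where 'n='n] by simp
    finally show ?thesis .
  qed
qed

lemma borel_version_power_ball:
  fixes \<Omega> :: "real^'n \<Rightarrow> complex"
  assumes "\<Omega> \<in> sphere_L s" "borel_version \<Omega> \<Omega>'" "0 < a" "ennreal a \<le> s"
  obtains M where "0 \<le> M" "\<And>R. 0 < R \<Longrightarrow>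
    (\<integral>\<^sup>+x\<in>ball 0 R. ennreal (norm (\<Omega>' x) powr a) \<partial>lborel) \<le> ennreal (M * R ^ CARD('n))"
proof -
  have [measurable]: "\<Omega>' \<in> borel_measurable borel" using assms by (simp add: borel_version_def)
  obtain I where I: "0 \<le> I" "(\<integral>\<^sup>+x. ennreal (norm (\<Omega> x) powr a) \<partial>sphere_measure) = ennreal I"
    using sphere_L_power_integrable[OF assms(1,3,4)]
    by (cases "\<integral>\<^sup>+x. ennreal (norm (\<Omega> x) powr a) \<partial>sphere_measure") auto
  show ?thesis
  proof (rule that[of "unit_ball_vol CARD('n) * I"])
    show "0 \<le> unit_ball_vol CARD('n) * I" using I by simp
    fix R :: real assume R: "0 < R"
    have "(\<integral>\<^sup>+x\<in>ball 0 R. ennreal (norm (\<Omega>' x) powr a) \<partial>lborel)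
       = ennreal (unit_ball_vol CARD('n) * R ^ CARD('n)) * ennreal I"
      unfolding I(2)[symmetric] using R assms(2)
      by (intro nn_integral_ball_homogeneous) (auto simp: borel_version_def homogeneous_zero_def elim: eventually_mono)
    also have "\<dots> = ennreal (unit_ball_vol CARD('n) * I * R ^ CARD('n))"
      using I R by (simp add: ennreal_mult[symmetric] mult_ac)
    finally show "(\<integral>\<^sup>+x\<in>ball 0 R. ennreal (norm (\<Omega>' x) powr a) \<partial>lborel) \<le> ennreal (unit_ball_vol CARD('n) * I * R ^ CARD('n))"
      by simp
  qed
qed

lemma ball_sets_borel [measurable]: "ball (c::'a::euclidean_space) r \<in> sets borel"
  by simp

text \<open>This takes the root out of the definition of the modulus for finite exponents.\<close>

lemma dini_modulus_rotation:
  fixes \<Omega> :: "real^'n \<Rightarrow> complex"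
  assumes \<sigma>: "0 < \<sigma>" and D: "dini_modulus (ennreal \<sigma>) \<Omega> \<delta> \<le> ennreal D" "0 \<le> D"
    and Q: "rotation_matrix Q" "rotation_size Q < \<delta>"
  shows "(\<integral>\<^sup>+x. ennreal (norm (\<Omega> (Q *v x) - \<Omega> x) powr \<sigma>) \<partial>sphere_measure) \<le> ennreal (D powr \<sigma>)"
proof -
  define X where "X = (\<integral>\<^sup>+x. ennreal (norm (\<Omega> (Q *v x) - \<Omega> x) powr \<sigma>) \<partial>sphere_measure)"
  have "X epow (1 / \<sigma>) \<le> dini_modulus (ennreal \<sigma>) \<Omega> \<delta>"
    unfolding dini_modulus_def X_def using \<sigma> Q by (intro SUP_upper2[of Q]) auto
  then have le: "X epow (1 / \<sigma>) \<le> ennreal D" using D(1) by (rule order_trans)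
  then obtain t where t: "0 \<le> t" "X = ennreal t" by (cases X) (auto simp: epow_def top_unique)
  then have "t powr (1 / \<sigma>) \<le> D" using le D(2) by (simp add: epow_def)
  then have "(t powr (1 / \<sigma>)) powr \<sigma> \<le> D powr \<sigma>" using \<sigma> by (intro powr_mono2) auto
  then have "t \<le> D powr \<sigma>" using \<sigma> t by (simp add: powr_powr)
  then show ?thesis using t by (simp add: X_def ennreal_leI)
qed

text \<open>The case of an annulus of radius \<open>\<rho>\<close> follows from that of radius 1 by homogeneity. Each rotation
  contributes the integral over the ball of radius 3, which polar coordinates turn into the integral over the sphere
  that occurs in the Dini modulus.\<close>

lemma dini_translation_power:
  fixes \<Omega> \<Omega>' :: "real^'n \<Rightarrow> complex"
  defines "N \<equiv> real CARD('n)"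
  assumes bv: "borel_version \<Omega> \<Omega>'"
    and \<sigma>: "0 < \<sigma>" and D: "dini_modulus (ennreal \<sigma>) \<Omega> \<epsilon> \<le> ennreal D" "0 \<le> D"
    and \<delta>: "0 < \<delta>" "\<delta> \<le> 1 / (8 * N\<^sup>2)" "32 * N * \<delta> \<le> \<epsilon>"
    and \<rho>: "0 < \<rho>" and h: "norm h < \<delta> * \<rho>"
  shows "(\<integral>\<^sup>+y\<in>annulus \<rho>. ennreal (norm (\<Omega>' (y + h) - \<Omega>' y) powr \<sigma>) \<partial>lborel)
    \<le> ennreal (translation_const TYPE('n) \<sigma> * (unit_ball_vol N * 3 ^ CARD('n)) * D powr \<sigma> * \<rho> ^ CARD('n))"
proof -
  have [measurable]: "\<Omega>' \<in> borel_measurable borel" and hom: "homogeneous_zero \<Omega>'"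
    and ae: "AE x in sphere_borel. \<Omega> x = \<Omega>' x"
    using bv by (auto simp: borel_version_def)
  have hs: "\<Omega>' (c *\<^sub>R x) = \<Omega>' x" if "0 < c" for c x using hom that by (simp add: homogeneous_zero_def)
  define Xr where "Xr = unit_ball_vol N * 3 ^ CARD('n) * D powr \<sigma>"
  have N: "0 < N" by (simp add: N_def)
  have Xr: "0 \<le> Xr" unfolding Xr_def using N by (intro mult_nonneg_nonneg) auto
  have rot: "(\<integral>\<^sup>+w\<in>ball 0 3. ennreal (norm (\<Omega>' (Q *v w) - \<Omega>' w) powr \<sigma>) \<partial>lborel) \<le> ennreal Xr"
    if Q: "rotation_matrix Q" "rotation_size Q < 32 * N * \<delta>" for Q :: "real^'n^'n"
  proof -
    have oQ: "orthogonal_matrix Q" using Q by (simp add: rotation_matrix_def)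
    have QN [measurable]: "(\<lambda>x. Q *v x) \<in> borel_measurable borel"
      by (rule borel_measurable_continuous_onI) (rule linear_continuous_on, simp add: linear_linear)
    have "(\<integral>\<^sup>+w\<in>ball 0 3. ennreal (norm (\<Omega>' (Q *v w) - \<Omega>' w) powr \<sigma>) \<partial>lborel)
       = ennreal (unit_ball_vol CARD('n) * 3 ^ CARD('n)) * (\<integral>\<^sup>+x. ennreal (norm (\<Omega> (Q *v x) - \<Omega> x) powr \<sigma>) \<partial>sphere_measure)"
    proof (rule nn_integral_ball_homogeneous)
      show "AE x in sphere_borel. ennreal (norm (\<Omega> (Q *v x) - \<Omega> x) powr \<sigma>) = ennreal (norm (\<Omega>' (Q *v x) - \<Omega>' x) powr \<sigma>)"
        using ae AE_sphere_borel_rotate[OF ae oQ] by eventually_elim simp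
    qed (auto simp: hs matrix_vector_mult_scaleR)
    also have "\<dots> \<le> ennreal (unit_ball_vol CARD('n) * 3 ^ CARD('n)) * ennreal (D powr \<sigma>)"
      using Q \<delta>(3) by (intro mult_left_mono dini_modulus_rotation[OF \<sigma> D]) auto
    also have "\<dots> = ennreal Xr"
      by (simp add: Xr_def N_def ennreal_mult[symmetric])
    finally show ?thesis .
  qed
  have h': "norm (h /\<^sub>R \<rho>) < \<delta>" using h \<rho> by (simp add: field_simps)
  have ann: "(\<rho> *\<^sub>R x \<in> annulus \<rho>) = (1 \<le> norm x \<and> norm x < 2)" for x :: "real^'n"
    using \<rho> by (simp add: annulus_def mult.commute[of _ \<rho>] pos_divide_le_eq mult_le_cancel_left_pos[of \<rho> 1, simplified] mult_less_cancel_left_pos[of \<rho> _ 2])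
  have "(\<integral>\<^sup>+y\<in>annulus \<rho>. ennreal (norm (\<Omega>' (y + h) - \<Omega>' y) powr \<sigma>) \<partial>lborel)
    = ennreal (\<bar>\<rho>\<bar> ^ DIM(real^'n)) * (\<integral>\<^sup>+x. ennreal (norm (\<Omega>' ((0 + \<rho> *\<^sub>R x) + h) - \<Omega>' (0 + \<rho> *\<^sub>R x)) powr \<sigma>) * indicator (annulus \<rho>) (0 + \<rho> *\<^sub>R x) \<partial>lborel)"
    using \<rho> by (intro nn_integral_lborel_scale) auto
  also have "(\<integral>\<^sup>+x. ennreal (norm (\<Omega>' ((0 + \<rho> *\<^sub>R x) + h) - \<Omega>' (0 + \<rho> *\<^sub>R x)) powr \<sigma>) * indicator (annulus \<rho>) (0 + \<rho> *\<^sub>R x) \<partial>lborel)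
     = (\<integral>\<^sup>+y\<in>{y. 1 \<le> norm y \<and> norm y < 2}. ennreal (norm (\<Omega>' (y + h /\<^sub>R \<rho>) - \<Omega>' y) powr \<sigma>) \<partial>lborel)"
  proof (rule nn_integral_cong)
    fix x
    have "\<rho> *\<^sub>R x + h = \<rho> *\<^sub>R (x + h /\<^sub>R \<rho>)" using \<rho> by (simp add: algebra_simps)
    then show "ennreal (norm (\<Omega>' ((0 + \<rho> *\<^sub>R x) + h) - \<Omega>' (0 + \<rho> *\<^sub>R x)) powr \<sigma>) * indicator (annulus \<rho>) (0 + \<rho> *\<^sub>R x)
      = ennreal (norm (\<Omega>' (x + h /\<^sub>R \<rho>) - \<Omega>' x) powr \<sigma>) * indicator {y. 1 \<le> norm y \<and> norm y < 2} x"
      using hs[OF \<rho>] ann[of x] by (simp add: indicator_def)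
  qed
  also have "ennreal (\<bar>\<rho>\<bar> ^ DIM(real^'n)) * (\<integral>\<^sup>+y\<in>{y. 1 \<le> norm y \<and> norm y < 2}. ennreal (norm (\<Omega>' (y + h /\<^sub>R \<rho>) - \<Omega>' y) powr \<sigma>) \<partial>lborel)
     \<le> ennreal (\<bar>\<rho>\<bar> ^ DIM(real^'n)) * (ennreal (translation_const TYPE('n) \<sigma>) * ennreal Xr)"
    using \<delta> h' hom \<sigma> rot unfolding N_def
    by (intro mult_left_mono translation_le_rotations[where \<delta> = \<delta>]) auto
  also have "\<dots> = ennreal (\<rho> ^ CARD('n) * (translation_const TYPE('n) \<sigma> * Xr))"
    using \<rho> Xr translation_const_nonneg[where 'n='n, of \<sigma>] by (simp add: ennreal_mult)
  also have "\<rho> ^ CARD('n) * (translation_const TYPE('n) \<sigma> * Xr)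
      = translation_const TYPE('n) \<sigma> * (unit_ball_vol N * 3 ^ CARD('n)) * D powr \<sigma> * \<rho> ^ CARD('n)"
    by (simp add: Xr_def mult_ac)
  finally show ?thesis .
qed

text \<open>With \<open>e = sgn w\<close> and \<open>a\<close> the midpoint of \<open>sgn u\<close> and \<open>e\<close>, the rotation \<open>reflect2 a e\<close> takes \<open>sgn w\<close> to \<open>sgn u\<close>, and
  \<open>norm (a - e)\<close> is half the distance of these two unit vectors. For the exponent \<open>\<infinity>\<close> the modulus is
  a supremum over all points of the sphere, so this single rotation gives the bound.\<close>

lemma dini_pointwise:
  fixes \<Omega> :: "real^'n \<Rightarrow> complex"
  assumes hom: "homogeneous_zero \<Omega>" and D: "dini_modulus \<infinity> \<Omega> \<delta> \<le> ennreal D" "0 \<le> D"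
    and uw: "u \<noteq> 0" "w \<noteq> 0" and close: "4 * norm (sgn u - sgn w) < \<delta>" "norm (sgn u - sgn w) < 2"
  shows "norm (\<Omega> u - \<Omega> w) \<le> D"
proof -
  define e where "e = sgn w"
  define a where "a = (1 / 2) *\<^sub>R (sgn u + e)"
  define Q where "Q = reflect2 a e"
  have n1: "norm e = 1" "norm (sgn u) = 1" using uw by (simp_all add: e_def norm_sgn)
  have "a \<noteq> 0"
  proof
    assume "a = 0"
    then have "sgn u = - e" by (simp add: a_def eq_neg_iff_add_eq_0)
    then have "sgn u - sgn w = - (2 *\<^sub>R e)" by (simp add: scaleR_2 e_def[symmetric])
    then have "norm (sgn u - sgn w) = 2" using n1 by simp
    then show False using close by simp
  qed
  have e0: "e \<noteq> 0" using n1 by auto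
  have Qe: "Q *v e = sgn u"
  proof -
    have "reflect_along e e = - e" using n1 by (simp add: reflect_along_def norm_eq_1 scaleR_2)
    moreover have "bisector_normal (- e) (sgn u) = (-2) *\<^sub>R a"
      using n1 by (simp add: bisector_normal_def a_def algebra_simps)
    moreover have "reflect_along (bisector_normal (- e) (sgn u)) (- e) = sgn u"
      using reflect_along_bisector_normal[of "- e" "sgn u"] n1 e0 uw by (simp add: sgn_zero_iff)
    ultimately show ?thesis
      using reflect_along_scaleR_left[of "-2" a "- e"] by (simp add: Q_def reflect2_apply)
  qed
  have "rotation_size Q \<le> 8 * norm (a - e)"
    unfolding Q_def by (rule rotation_size_reflect2[OF n1(1) \<open>a \<noteq> 0\<close>])
  also have "a - e = (1 / 2) *\<^sub>R (sgn u - sgn w)" by (simp add: a_def e_def algebra_simps flip: scaleR_add_left)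
  finally have "rotation_size Q < \<delta>" using close by simp
  moreover have "rotation_matrix Q" unfolding Q_def by (rule rotation_reflect2[OF \<open>a \<noteq> 0\<close> e0])
  ultimately have "(SUP x\<in>sphere 0 1. ennreal (norm (\<Omega> (Q *v x) - \<Omega> x))) \<le> dini_modulus \<infinity> \<Omega> \<delta>"
    unfolding dini_modulus_def by (intro SUP_upper2[of Q]) auto
  moreover have "ennreal (norm (\<Omega> (Q *v e) - \<Omega> e)) \<le> (SUP x\<in>sphere 0 1. ennreal (norm (\<Omega> (Q *v x) - \<Omega> x)))"
    using n1 by (intro SUP_upper) auto
  ultimately have "ennreal (norm (\<Omega> (Q *v e) - \<Omega> e)) \<le> ennreal D" using D(1) by (meson order_trans)
  then show ?thesis
    using D(2) homogeneous_zero_sgn[OF hom uw(1)] homogeneous_zero_sgn[OF hom uw(2)]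
    by (simp add: Qe) (simp add: e_def)
qed

lemma norm_sgn_diff_le:
  fixes u w :: "'a::real_normed_vector"
  assumes "u \<noteq> 0" "w \<noteq> 0"
  shows "norm (sgn u - sgn w) \<le> 2 * norm (u - w) / norm w"
proof -
  have "sgn u - sgn w = (1 / norm w) *\<^sub>R (u - w) + ((norm w - norm u) / norm w) *\<^sub>R sgn u"
    using assms by (simp add: sgn_div_norm field_simps scaleR_diff_right flip: scaleR_diff_left)
      (simp add: field_simps flip: scaleR_add_left)
  then have "norm (sgn u - sgn w) \<le> norm (u - w) / norm w + \<bar>norm w - norm u\<bar> / norm w"
    using norm_triangle_ineq[of "(1 / norm w) *\<^sub>R (u - w)" "((norm w - norm u) / norm w) *\<^sub>R sgn u"] assms
    by (simp add: norm_sgn)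
  also have "\<dots> \<le> norm (u - w) / norm w + norm (u - w) / norm w"
    using norm_triangle_ineq3[of w u] by (intro add_mono divide_right_mono) (auto simp: norm_minus_commute)
  finally show ?thesis by simp
qed

text \<open>The shift \<open>k0\<close> absorbs the factor \<open>32 * n\<close> between the length of a translation and the size of the
  rotations that control it: for \<open>norm h < 2 powr - (j + k0) * \<rho>\<close> all these rotations have size less than
  \<open>2 powr - (j + 1)\<close>, the scale of the \<open>j\<close>-th dyadic value of the modulus. The exponent
  \<open>n * (1 - 1 / s')\<close> is \<open>n / s\<close>.\<close>

lemma dini_translation_estimates:
  fixes \<Omega> \<Omega>' :: "real^'n \<Rightarrow> complex"
  defines "n \<equiv> real CARD('n)"
  assumes dini: "dini s \<beta> \<Omega>" "0 < \<beta>" and s: "1 < s" and s': "s' = enn2real (conj_exp s)"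
    and bv: "borel_version \<Omega> \<Omega>'"
  obtains k0 :: nat and M :: real and \<eta> :: "nat \<Rightarrow> real" where
    "1 \<le> k0" "0 \<le> M" "\<And>j. 0 \<le> \<eta> j" "summable (\<lambda>j. \<eta> j * 2 powr (\<beta> * real j))"
    "\<And>\<rho> h. 0 < \<rho> \<Longrightarrow> norm h \<le> \<rho> \<Longrightarrow>
       annular_bound s' \<rho> (\<lambda>y. norm (\<Omega>' (y + h))) (M * \<rho> powr (n * (1 - 1 / s')))"
    "\<And>j \<rho> h. 0 < \<rho> \<Longrightarrow> norm h < 2 powr - (real j + real k0) * \<rho> \<Longrightarrow>
       annular_bound s' \<rho> (\<lambda>y. norm (\<Omega>' (y + h) - \<Omega>' y)) (\<eta> j * \<rho> powr (n * (1 - 1 / s')))"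
proof -
  have [measurable]: "\<Omega>' \<in> borel_measurable borel" using bv by (simp add: borel_version_def)
  have hom: "homogeneous_zero \<Omega>" and \<Omega>L: "\<Omega> \<in> sphere_L s" using dini by (auto simp: dini_def)
  obtain D where D: "\<And>j. 0 \<le> D j" "\<And>j. dini_modulus s \<Omega> (2 powr - (real j + 1)) = ennreal (D j)"
    "summable (\<lambda>j. D j * 2 powr (\<beta> * real j))" for j :: nat
    using dini_modulus_dyadic[OF dini] by metis
  have n: "1 \<le> n" unfolding n_def using zero_less_card_finite[where 'a='n] by linarith
  have n2: "n \<le> n\<^sup>2" using n by (simp add: power2_eq_square)
  \<comment> \<open>This makes both \<open>8 * n\<^sup>2 * \<delta> j \<le> 1\<close> and \<open>32 * n * \<delta> j \<le> 2 powr - (j + 1)\<close> true.\<close>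
  obtain k0 :: nat where k0: "64 * n\<^sup>2 < 2 ^ k0"
    using real_arch_pow[of 2 "64 * n\<^sup>2"] by auto
  have "1 \<le> k0"
  proof (rule ccontr)
    assume "\<not> 1 \<le> k0"
    then have "k0 = 0" by simp
    then have "64 * n\<^sup>2 < 1" using k0 by simp
    then show False using n n2 by linarith
  qed
  define \<delta> where "\<delta> j = (2::real) powr - (real j + real k0)" for j :: nat
  have \<delta>: "0 < \<delta> j" "\<delta> j \<le> 1 / (8 * n\<^sup>2)" "32 * n * \<delta> j \<le> 2 powr - (real j + 1)" for j
  proof -
    show "0 < \<delta> j" by (simp add: \<delta>_def)
    have eq: "\<delta> j = 2 powr - real j * (1 / 2 ^ k0)"
    proof -
      have "- (real j + real k0) = - real j + - real k0" by simp
      then show ?thesis unfolding \<delta>_def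
        by (simp only: powr_add) (simp add: powr_minus powr_realpow divide_inverse)
    qed
    have p1: "(2::real) powr - real j \<le> 1" using powr_mono[of "- real j" 0 2] by simp
    have "\<delta> j \<le> 1 * (1 / 2 ^ k0)" unfolding eq using p1 by (intro mult_right_mono) auto
    also have "\<dots> \<le> 1 / (8 * n\<^sup>2)"
    proof -
      have "0 < 8 * n\<^sup>2" using n by simp
      moreover have "8 * n\<^sup>2 \<le> 2 ^ k0" using k0 n n2 by linarith
      ultimately show ?thesis by (simp add: frac_le)
    qed
    finally show "\<delta> j \<le> 1 / (8 * n\<^sup>2)" .
    have "32 * n * (1 / 2 ^ k0) \<le> 1 / 2"
    proof -
      have "64 * n \<le> 2 ^ k0" using k0 n2 by linarith
      then show ?thesis by (simp add: field_simps)
    qed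
    then have "2 powr - real j * (32 * n * (1 / 2 ^ k0)) \<le> 2 powr - real j * (1 / 2)"
      by (intro mult_left_mono) auto
    also have "\<dots> = 2 powr - (real j + 1)"
    proof -
      have "- (real j + 1) = - real j - 1" by simp
      then show ?thesis by (simp only: powr_diff powr_one zero_le_numeral)
    qed
    finally show "32 * n * \<delta> j \<le> 2 powr - (real j + 1)" unfolding eq by (simp add: mult_ac)
  qed
  show ?thesis
  proof (cases "s = \<infinity>")
    case True
    have s1: "s' = 1" using s' True conj_exp_infinity by simp
    define E where "E = esssup sphere_measure (\<lambda>x. ennreal (norm (\<Omega> x)))"
    have "E < \<infinity>" using \<Omega>L True by (simp add: sphere_L_def E_def)
    then obtain M where M: "0 \<le> M" "E = ennreal M" by (cases E) auto
    have "AE x in sphere_measure. ennreal (norm (\<Omega> x)) \<le> ennreal M"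
      using esssup_AE[of "\<lambda>x. ennreal (norm (\<Omega> x))" sphere_measure] by (simp add: M(2)[symmetric] E_def)
    then have "AE x in sphere_borel. norm (\<Omega> x) \<le> M"
      using M unfolding sphere_measure_eq by (simp add: AE_completion_iff)
    then have "AE x in lborel. norm (\<Omega> (sgn x)) \<le> M" by (rule AE_sphere_borel_imp_AE_lborel)
    then have bound: "AE x in lborel. norm (\<Omega> x) \<le> M"
      using AE_neq_zero by eventually_elim (simp add: homogeneous_zero_sgn[OF hom])
    have eq: "AE x in lborel. \<Omega> x = \<Omega>' x" by (rule borel_version_AE_lborel[OF bv hom])
    have bound': "AE x in lborel. norm (\<Omega>' x) \<le> M" using bound eq by eventually_elim simp
    have key: "annular_bound s' \<rho> g (c * \<rho> powr (n * (1 - 1 / s')))"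
      if "AE y in lborel. y \<in> annulus \<rho> \<longrightarrow> g y \<le> c" "0 \<le> c" "0 < \<rho>" for g :: "real^'n \<Rightarrow> real" and c \<rho>
      using annular_bound_AE[OF that(1,2)] s1 that(3) by simp
    show ?thesis
    proof (rule that[of k0 M D])
      show "1 \<le> k0" by fact
      show "0 \<le> M" by fact
      show "0 \<le> D j" for j by fact
      show "summable (\<lambda>j. D j * 2 powr (\<beta> * real j))" by fact
      fix \<rho> :: real and h :: "real^'n"
      assume \<rho>: "0 < \<rho>"
      have shift: "AE y in lborel. P (y + h)" if "AE y in lborel. P y" for P :: "real^'n \<Rightarrow> bool"
        using AE_lborel_affine[OF that, of 1 h] by (simp add: add.commute)
      show "annular_bound s' \<rho> (\<lambda>y. norm (\<Omega>' (y + h))) (M * \<rho> powr (n * (1 - 1 / s')))"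
        using shift[OF bound'] by (intro key M(1) \<rho>) (auto elim: eventually_mono)
      fix j assume h: "norm h < 2 powr - (real j + real k0) * \<rho>"
      show "annular_bound s' \<rho> (\<lambda>y. norm (\<Omega>' (y + h) - \<Omega>' y)) (D j * \<rho> powr (n * (1 - 1 / s')))"
      proof (intro key \<rho> D(1))
        show "AE y in lborel. y \<in> annulus \<rho> \<longrightarrow> norm (\<Omega>' (y + h) - \<Omega>' y) \<le> D j"
          using shift[OF eq] eq
        proof (eventually_elim, intro impI)
          case (elim y)
          assume y: "y \<in> annulus \<rho>"
          have hd: "norm h < \<delta> j * \<rho>" using h by (simp add: \<delta>_def)
          have "\<delta> j \<le> 1 / 8"
          proof -
            have "1 / (8 * n\<^sup>2) \<le> 1 / 8" using n n2 by (intro divide_left_mono) auto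
            then show ?thesis using \<delta>(2)[of j] by linarith
          qed
          then have "\<delta> j * \<rho> \<le> 1 / 8 * \<rho>" using \<rho> by (intro mult_right_mono) auto
          then have "norm h < \<rho>" using hd \<rho> by linarith
          have y\<rho>: "\<rho> \<le> norm y" using y by (simp add: annulus_def)
          have "y \<noteq> 0" using y\<rho> \<rho> by auto
          have "y + h \<noteq> 0" using y\<rho> \<open>norm h < \<rho>\<close> by (metis add_eq_0_iff2 norm_minus_cancel not_less)
          have "norm (sgn (y + h) - sgn y) \<le> 2 * norm h / norm y"
            using norm_sgn_diff_le[OF \<open>y + h \<noteq> 0\<close> \<open>y \<noteq> 0\<close>] by simp
          also have "\<dots> \<le> 2 * norm h / \<rho>" using y\<rho> \<rho> \<open>y \<noteq> 0\<close> by (intro divide_left_mono) auto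
          also have "\<dots> < 2 * \<delta> j" using hd \<rho> by (simp add: field_simps)
          finally have lt: "norm (sgn (y + h) - sgn y) < 2 * \<delta> j" .
          have "8 * \<delta> j \<le> 32 * n * \<delta> j" using \<delta>(1)[of j] n by (intro mult_right_mono) auto
          then have c1: "4 * norm (sgn (y + h) - sgn y) < 2 powr - (real j + 1)" using lt \<delta>(3)[of j] by linarith
          have c2: "norm (sgn (y + h) - sgn y) < 2" using lt \<open>\<delta> j \<le> 1 / 8\<close> by linarith
          show "norm (\<Omega>' (y + h) - \<Omega>' y) \<le> D j"
            unfolding elim[symmetric]
            using dini_pointwise[OF hom _ D(1) \<open>y + h \<noteq> 0\<close> \<open>y \<noteq> 0\<close> c1 c2] D(2)[of j] True by simp
        qed
      qed
    qed
  next
    case False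
    then obtain \<sigma> where \<sigma>: "s = ennreal \<sigma>" "0 \<le> \<sigma>" by (cases s) auto
    have \<sigma>1: "1 < \<sigma>" using s \<sigma> by simp
    have s'\<sigma>: "s' = \<sigma> / (\<sigma> - 1)" using s' \<sigma> \<sigma>1 by (simp add: conj_exp_real)
    have s'1: "1 < s'" "1 / \<sigma> + 1 / s' = 1" "1 - 1 / s' = 1 / \<sigma>" using \<sigma>1 unfolding s'\<sigma> by (auto simp: field_simps)
    obtain M0 where M0: "0 \<le> M0" "\<And>R. 0 < R \<Longrightarrow>
       (\<integral>\<^sup>+x\<in>ball 0 R. ennreal (norm (\<Omega>' x) powr \<sigma>) \<partial>lborel) \<le> ennreal (M0 * R ^ CARD('n))"
      using borel_version_power_ball[OF \<Omega>L bv, of \<sigma>] \<sigma> \<sigma>1 by auto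
    define M where "M = (M0 * 4 ^ CARD('n)) powr (1 / \<sigma>)"
    define T where "T = translation_const TYPE('n) \<sigma> * (unit_ball_vol n * 3 ^ CARD('n))"
    have T: "0 \<le> T" unfolding T_def using n
      by (intro mult_nonneg_nonneg translation_const_nonneg unit_ball_vol_nonneg) auto
    define c where "c = T powr (1 / \<sigma>)"
    have M\<sigma>: "M powr \<sigma> = M0 * 4 ^ CARD('n)" using M0(1) \<sigma>1 by (simp add: M_def powr_powr)
    have c\<sigma>: "c powr \<sigma> = T" using T \<sigma>1 by (simp add: c_def powr_powr)
    have \<rho>\<sigma>: "(\<rho> powr (n * (1 - 1 / s'))) powr \<sigma> = \<rho> ^ CARD('n)" if "0 < \<rho>" for \<rho>
      using that \<sigma>1 by (simp add: s'1(3) powr_powr n_def powr_realpow)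
    show ?thesis
    proof (rule that[of k0 M "\<lambda>j. c * D j"])
      show "1 \<le> k0" by fact
      show "0 \<le> M" by (simp add: M_def)
      show "0 \<le> c * D j" for j using D(1)[of j] by (simp add: c_def)
      show "summable (\<lambda>j. c * D j * 2 powr (\<beta> * real j))"
        using summable_mult[OF D(3), of c] by (simp only: mult.assoc)
      fix \<rho> :: real and h :: "real^'n"
      assume \<rho>: "0 < \<rho>"
      {
        assume h: "norm h \<le> \<rho>"
        have "(\<integral>\<^sup>+y\<in>annulus \<rho>. ennreal (norm (\<Omega>' (y + h)) powr \<sigma>) \<partial>lborel)
           \<le> (\<integral>\<^sup>+y. ennreal (norm (\<Omega>' (y + h)) powr \<sigma>) * indicator (ball 0 (4 * \<rho>)) (y + h) \<partial>lborel)"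
        proof (intro nn_integral_mono mult_left_mono)
          fix y
          have "y + h \<in> ball 0 (4 * \<rho>)" if "y \<in> annulus \<rho>"
            using that h norm_triangle_ineq[of y h] \<rho> by (simp add: annulus_def)
          then show "indicator (annulus \<rho>) y \<le> (indicator (ball 0 (4 * \<rho>)) (y + h) :: ennreal)"
            by (auto split: split_indicator)
        qed auto
        also have "\<dots> = (\<integral>\<^sup>+x\<in>ball 0 (4 * \<rho>). ennreal (norm (\<Omega>' x) powr \<sigma>) \<partial>lborel)"
          by (rule nn_integral_lborel_shift[of "\<lambda>y. ennreal (norm (\<Omega>' y) powr \<sigma>) * indicator (ball 0 (4 * \<rho>)) y"])
            measurable
        also have "\<dots> \<le> ennreal (M0 * (4 * \<rho>) ^ CARD('n))" using \<rho> by (intro M0) auto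
        also have "M0 * (4 * \<rho>) ^ CARD('n) = (M * \<rho> powr (n * (1 - 1 / s'))) powr \<sigma>"
          using \<rho> by (simp add: powr_mult \<rho>\<sigma> M\<sigma> power_mult_distrib)
        finally have "(\<integral>\<^sup>+y\<in>annulus \<rho>. ennreal (norm (\<Omega>' (y + h)) powr \<sigma>) \<partial>lborel)
           \<le> ennreal ((M * \<rho> powr (n * (1 - 1 / s'))) powr \<sigma>)" .
        then show "annular_bound s' \<rho> (\<lambda>y. norm (\<Omega>' (y + h))) (M * \<rho> powr (n * (1 - 1 / s')))"
          by (intro annular_bound_Holder[OF _ _ \<sigma>1 s'1(1,2)]) (auto simp: M_def)
      }
      fix j assume h: "norm h < 2 powr - (real j + real k0) * \<rho>"
      have "(\<integral>\<^sup>+y\<in>annulus \<rho>. ennreal (norm (\<Omega>' (y + h) - \<Omega>' y) powr \<sigma>) \<partial>lborel) \<le> ennreal (T * D j powr \<sigma> * \<rho> ^ CARD('n))"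
        unfolding T_def n_def
        using \<sigma>1 D(1)[of j] D(2)[of j] \<sigma>(1) \<delta>[of j] \<rho> h
        by (intro dini_translation_power[OF bv, where \<delta> = "\<delta> j" and \<epsilon> = "2 powr - (real j + 1)"]) (auto simp: n_def \<delta>_def)
      also have "T * D j powr \<sigma> * \<rho> ^ CARD('n) = (c * D j * \<rho> powr (n * (1 - 1 / s'))) powr \<sigma>"
        using \<rho> D(1)[of j] by (simp add: powr_mult \<rho>\<sigma> c\<sigma>)
      finally show "annular_bound s' \<rho> (\<lambda>y. norm (\<Omega>' (y + h) - \<Omega>' y)) (c * D j * \<rho> powr (n * (1 - 1 / s')))"
        using D(1)[of j] by (intro annular_bound_Holder[OF _ _ \<sigma>1 s'1(1,2)]) (auto simp: c_def)
    qed
  qed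
qed

section \<open>Smoothness and local size of the kernel\<close>

lemma powr_minus_Lipschitz:
  fixes a m x y :: real
  assumes "0 < a" "0 < m" "a \<le> x" "a \<le> y"
  shows "\<bar>x powr - m - y powr - m\<bar> \<le> m * a powr (- m - 1) * \<bar>x - y\<bar>"
proof -
  have aux: "\<bar>v powr - m - u powr - m\<bar> \<le> m * a powr (- m - 1) * \<bar>v - u\<bar>" if "a \<le> u" "u < v" for u v
  proof -
    have "\<exists>z>u. z < v \<and> v powr - m - u powr - m = (v - u) * (- m * z powr (- m - 1))"
    proof (rule MVT2[OF \<open>u < v\<close>])
      fix z assume "u \<le> z" "z \<le> v"
      then have "0 < z" using that assms by linarith
      then show "((\<lambda>z. z powr - m) has_real_derivative - m * z powr (- m - 1)) (at z)"
        by (auto intro!: derivative_eq_intros)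
    qed
    then obtain z where z: "u < z" "v powr - m - u powr - m = (v - u) * (- m * z powr (- m - 1))" by blast
    have "z powr (- m - 1) \<le> a powr (- m - 1)"
      using z that assms by (intro powr_mono2') auto
    then have "\<bar>v - u\<bar> * (m * z powr (- m - 1)) \<le> \<bar>v - u\<bar> * (m * a powr (- m - 1))"
      using assms by (intro mult_left_mono) auto
    moreover have "\<bar>v powr - m - u powr - m\<bar> = \<bar>v - u\<bar> * (m * z powr (- m - 1))"
      unfolding z(2) using assms by (simp add: abs_mult)
    ultimately show ?thesis by (simp add: mult_ac)
  qed
  consider "x < y" | "y < x" | "x = y" by linarith
  then show ?thesis
  proof cases
    case 1
    then show ?thesis using aux[of x y] assms by (simp add: abs_minus_commute)
  next
    case 2
    then show ?thesis using aux[of y x] assms by simp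
  qed simp
qed

definition kernel :: "(real^'n \<Rightarrow> complex) \<Rightarrow> real \<Rightarrow> real^'n \<Rightarrow> complex" where
  "kernel \<Omega> m x = \<Omega> x / of_real (norm x powr m)"

lemma kernel_altdef: "kernel \<Omega> m x = of_real (norm x powr - m) * \<Omega> x"
  by (simp add: kernel_def powr_minus divide_inverse mult.commute)

lemma norm_kernel: "norm (kernel \<Omega> m x) = norm x powr - m * norm (\<Omega> x)"
  by (simp add: kernel_altdef norm_mult)

lemma borel_measurable_kernel [measurable]:
  "\<Omega> \<in> borel_measurable borel \<Longrightarrow> kernel \<Omega> m \<in> borel_measurable borel"
  unfolding kernel_altdef[abs_def] scaleR_conv_of_real[symmetric] by measurable

text \<open>The difference of the two values is split into the variation of the power of the norm and that of \<open>\<Omega>\<close>.\<close>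

lemma kernel_difference:
  assumes "0 < m" "0 < \<rho>" "\<rho> \<le> norm y" "norm h \<le> \<epsilon> * \<rho>" "\<epsilon> \<le> 1 / 2" "0 \<le> \<epsilon>"
  shows "norm (kernel \<Omega> m (y + h) - kernel \<Omega> m y)
    \<le> \<rho> powr - m * (m * 2 powr (m + 1) * \<epsilon> * norm (\<Omega> (y + h)) + norm (\<Omega> (y + h) - \<Omega> y))"
proof -
  define t where "t = norm (y + h)"
  define u where "u = norm y"
  have h2: "norm h \<le> \<rho> / 2"
    using assms mult_right_mono[of \<epsilon> "1 / 2" \<rho>] by linarith
  have t: "\<rho> / 2 \<le> t" and tu: "\<bar>t - u\<bar> \<le> \<epsilon> * \<rho>"
    using norm_triangle_ineq3[of "y + h" y] h2 assms by (auto simp: t_def u_def)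
  have u: "\<rho> / 2 \<le> u" using assms by (simp add: u_def)
  have "\<bar>t powr - m - u powr - m\<bar> \<le> m * (\<rho> / 2) powr (- m - 1) * \<bar>t - u\<bar>"
    using assms t u by (intro powr_minus_Lipschitz) auto
  also have "\<dots> \<le> m * (\<rho> / 2) powr (- m - 1) * (\<epsilon> * \<rho>)" using assms tu by (intro mult_left_mono) auto
  also have "\<dots> = \<rho> powr - m * (m * 2 powr (m + 1) * \<epsilon>)"
  proof -
    have "(\<rho> / 2) powr (- m - 1) = \<rho> powr (- m - 1) / 2 powr (- m - 1)"
      using assms by (simp add: powr_divide)
    also have "\<rho> powr (- m - 1) = \<rho> powr - m / \<rho>" using assms by (simp add: powr_diff)
    also have "2 powr (- m - 1) = inverse (2 powr (m + 1) :: real)" by (simp flip: powr_minus)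
    finally have eq: "(\<rho> / 2) powr (- m - 1) = \<rho> powr - m / \<rho> * 2 powr (m + 1)"
      by (simp only: divide_inverse inverse_inverse_eq)
    have "m * (r / \<rho> * c) * (\<epsilon> * \<rho>) = r * (m * c * \<epsilon>)" for r c using assms by simp
    then show ?thesis unfolding eq .
  qed
  finally have 1: "\<bar>t powr - m - u powr - m\<bar> \<le> \<rho> powr - m * (m * 2 powr (m + 1) * \<epsilon>)" .
  have 2: "u powr - m \<le> \<rho> powr - m" using assms by (intro powr_mono2') (auto simp: u_def)
  have "kernel \<Omega> m (y + h) - kernel \<Omega> m y = of_real (t powr - m - u powr - m) * \<Omega> (y + h) + of_real (u powr - m) * (\<Omega> (y + h) - \<Omega> y)"
    by (simp add: kernel_altdef t_def u_def algebra_simps)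
  then have "norm (kernel \<Omega> m (y + h) - kernel \<Omega> m y)
     \<le> \<bar>t powr - m - u powr - m\<bar> * norm (\<Omega> (y + h)) + u powr - m * norm (\<Omega> (y + h) - \<Omega> y)"
    by (metis norm_triangle_ineq norm_mult norm_of_real abs_of_nonneg powr_ge_zero)
  also have "\<dots> \<le> \<rho> powr - m * (m * 2 powr (m + 1) * \<epsilon>) * norm (\<Omega> (y + h)) + \<rho> powr - m * norm (\<Omega> (y + h) - \<Omega> y)"
    using 1 2 by (intro add_mono mult_right_mono) auto
  finally show ?thesis by (simp add: algebra_simps)
qed

text \<open>The variation of the power of the norm contributes a multiple of \<open>2 powr - (j + k0)\<close> to \<open>d j\<close>, which is summable against
  \<open>2 powr (\<theta> * j)\<close> because \<open>\<theta> < 1\<close>; the variation of \<open>\<Omega>\<close> contributes the Dini modulus, for which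
  \<open>\<theta> < \<beta>\<close> suffices.\<close>

lemma kernel_smoothness:
  fixes \<Omega> \<Omega>' :: "real^'n \<Rightarrow> complex"
  defines "n \<equiv> real CARD('n)"
  assumes dini: "dini s \<beta> \<Omega>" "0 < \<beta>" and s: "1 < s" and s': "s' = enn2real (conj_exp s)"
    and bv: "borel_version \<Omega> \<Omega>'" and m: "0 < m" and \<theta>: "\<theta> < \<beta>" "\<theta> < 1"
  obtains k0 :: nat and d :: "nat \<Rightarrow> real" where
    "\<And>j. 0 \<le> d j" "summable (\<lambda>j. d j * 2 powr (\<theta> * real j))"
    "\<And>j \<rho> h. 0 < \<rho> \<Longrightarrow> norm h < 2 powr - (real j + real k0) * \<rho> \<Longrightarrow>
       annular_bound s' \<rho> (\<lambda>y. norm (kernel \<Omega>' m (y + h) - kernel \<Omega>' m y)) (d j * \<rho> powr (n * (1 - 1 / s') - m))"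
proof -
  have [measurable]: "\<Omega>' \<in> borel_measurable borel" using bv by (simp add: borel_version_def)
  show ?thesis
  proof (rule dini_translation_estimates[OF dini s s' bv, folded n_def])
    fix k0 :: nat and M :: real and \<eta> :: "nat \<Rightarrow> real"
    assume k0: "1 \<le> k0" and M: "0 \<le> M" and \<eta>: "\<And>j. 0 \<le> \<eta> j" "summable (\<lambda>j. \<eta> j * 2 powr (\<beta> * real j))"
      and H1: "\<And>\<rho> h. 0 < \<rho> \<Longrightarrow> norm h \<le> \<rho> \<Longrightarrow>
         annular_bound s' \<rho> (\<lambda>y. norm (\<Omega>' (y + h))) (M * \<rho> powr (n * (1 - 1 / s')))"
      and H2: "\<And>j \<rho> h. 0 < \<rho> \<Longrightarrow> norm h < 2 powr - (real j + real k0) * \<rho> \<Longrightarrow>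
         annular_bound s' \<rho> (\<lambda>y. norm (\<Omega>' (y + h) - \<Omega>' y)) (\<eta> j * \<rho> powr (n * (1 - 1 / s')))"
    define \<epsilon> where "\<epsilon> j = (2::real) powr - (real j + real k0)" for j :: nat
    define c where "c = m * 2 powr (m + 1)"
    have c: "0 \<le> c" using m by (simp add: c_def)
    have \<epsilon>: "0 \<le> \<epsilon> j" "\<epsilon> j \<le> 1 / 2" for j
    proof -
      have "\<epsilon> j \<le> 2 powr (- 1)" unfolding \<epsilon>_def using k0 by (intro powr_mono) auto
      then show "\<epsilon> j \<le> 1 / 2" by simp
    qed (simp add: \<epsilon>_def)
    define d where "d j = c * \<epsilon> j * M + \<eta> j" for j
    show thesis
    proof (rule that[of d k0])
      show "0 \<le> d j" for j using c \<epsilon>(1)[of j] M \<eta>(1)[of j] by (simp add: d_def)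
      have "summable (\<lambda>j. c * M * 2 powr - real k0 * (2 powr (\<theta> - 1)) ^ j)"
      proof (intro summable_mult summable_geometric)
        have "(2::real) powr (\<theta> - 1) < 2 powr 0" using \<theta> by (intro powr_less_mono) auto
        then show "norm ((2::real) powr (\<theta> - 1)) < 1" by simp
      qed
      moreover have "c * M * 2 powr - real k0 * (2 powr (\<theta> - 1)) ^ j = c * \<epsilon> j * M * 2 powr (\<theta> * real j)" for j
      proof -
        have "2 powr - real k0 * (2 powr (\<theta> - 1)) ^ j = 2 powr (- real k0 + (\<theta> - 1) * real j)"
        proof -
          have "(2 powr (\<theta> - 1)) ^ j = (2 powr (\<theta> - 1)) powr real j"
            by (rule powr_realpow[symmetric]) simp
          then show ?thesis unfolding powr_add powr_powr by (simp only:)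
        qed
        also have "- real k0 + (\<theta> - 1) * real j = - (real j + real k0) + \<theta> * real j" by (simp add: algebra_simps)
        also have "2 powr \<dots> = \<epsilon> j * 2 powr (\<theta> * real j)" unfolding \<epsilon>_def by (rule powr_add)
        finally show ?thesis by (simp add: mult_ac)
      qed
      ultimately have s1: "summable (\<lambda>j. c * \<epsilon> j * M * 2 powr (\<theta> * real j))" by simp
      have s2: "summable (\<lambda>j. \<eta> j * 2 powr (\<theta> * real j))"
      proof (rule summable_comparison_test[OF _ \<eta>(2)], intro exI[of _ 0] allI impI)
        fix j
        have "\<theta> * real j \<le> \<beta> * real j" using \<theta> by (intro mult_right_mono) auto
        then have "(2::real) powr (\<theta> * real j) \<le> 2 powr (\<beta> * real j)" by (intro powr_mono) auto
        then show "norm (\<eta> j * 2 powr (\<theta> * real j)) \<le> \<eta> j * 2 powr (\<beta> * real j)"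
          using \<eta>(1)[of j] by (simp add: abs_mult mult_left_mono)
      qed
      show "summable (\<lambda>j. d j * 2 powr (\<theta> * real j))"
        using summable_add[OF s1 s2] by (simp add: d_def distrib_right)
      fix j and \<rho> :: real and h :: "real^'n"
      assume \<rho>: "0 < \<rho>" and h: "norm h < 2 powr - (real j + real k0) * \<rho>"
      have h': "norm h \<le> \<epsilon> j * \<rho>" using h by (simp add: \<epsilon>_def)
      have "\<epsilon> j * \<rho> \<le> 1 / 2 * \<rho>" using \<epsilon> \<rho> by (intro mult_right_mono) auto
      then have h\<rho>: "norm h \<le> \<rho>" using h' \<rho> by linarith
      define a where "a = \<rho> powr - m * (c * \<epsilon> j)"
      define P where "P = \<rho> powr (n * (1 - 1 / s'))"
      have "annular_bound s' \<rho> (\<lambda>y. norm (kernel \<Omega>' m (y + h) - kernel \<Omega>' m y)) (a * (M * P) + \<rho> powr - m * (\<eta> j * P))"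
        unfolding P_def
      proof (rule annular_bound_combine[OF _ _ _ _ _ _ _ _ _ H1[OF \<rho> h\<rho>] H2[OF \<rho> h]])
        fix y :: "real^'n" assume "y \<in> annulus \<rho>"
        then have "norm (kernel \<Omega>' m (y + h) - kernel \<Omega>' m y)
            \<le> \<rho> powr - m * (m * 2 powr (m + 1) * \<epsilon> j * norm (\<Omega>' (y + h)) + norm (\<Omega>' (y + h) - \<Omega>' y))"
          using m \<rho> h' \<epsilon>[of j] by (intro kernel_difference) (auto simp: annulus_def)
        also have "\<dots> = a * norm (\<Omega>' (y + h)) + \<rho> powr - m * norm (\<Omega>' (y + h) - \<Omega>' y)"
          by (simp add: a_def c_def algebra_simps)
        finally show "norm (kernel \<Omega>' m (y + h) - kernel \<Omega>' m y)
            \<le> a * norm (\<Omega>' (y + h)) + \<rho> powr - m * norm (\<Omega>' (y + h) - \<Omega>' y)" .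
      qed (use c \<epsilon>(1)[of j] M \<eta>(1)[of j] in \<open>auto simp: a_def\<close>)
      also have "a * (M * P) + \<rho> powr - m * (\<eta> j * P) = d j * (P * \<rho> powr - m)"
        by (simp add: a_def d_def algebra_simps)
      also have "P * \<rho> powr - m = \<rho> powr (n * (1 - 1 / s') - m)"
        unfolding P_def by (simp flip: powr_add)
      finally show "annular_bound s' \<rho> (\<lambda>y. norm (kernel \<Omega>' m (y + h) - kernel \<Omega>' m y)) (d j * \<rho> powr (n * (1 - 1 / s') - m))" .
    qed
  qed
qed

lemma dyadic_ge_one:
  fixes t :: real assumes "1 \<le> t"
  shows "\<exists>j::nat. 2 ^ j \<le> t \<and> t < 2 * 2 ^ j"
proof -
  define j where "j = (LEAST j. t < 2 ^ Suc j)"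
  obtain k :: nat where "t < 2 ^ k" using real_arch_pow[of 2 t] by auto
  also have "2 ^ k \<le> (2::real) ^ Suc k" by simp
  finally have ex: "t < 2 ^ Suc k" .
  have "t < 2 ^ Suc j" unfolding j_def using ex by (rule LeastI)
  moreover have "2 ^ j \<le> t"
  proof (cases j)
    case 0 then show ?thesis using assms by simp
  next
    case (Suc i)
    then have "\<not> t < 2 ^ Suc i" unfolding j_def by (intro not_less_Least) simp
    then show ?thesis using Suc by simp
  qed
  ultimately show ?thesis by auto
qed

lemma dyadic_less_one:
  fixes t :: real assumes "0 < t" "t < 1"
  shows "\<exists>j::nat. (1 / 2) ^ Suc j \<le> t \<and> t < (1 / 2) ^ j"
proof -
  define j where "j = (LEAST j. (1 / 2) ^ Suc j \<le> t)"
  obtain k :: nat where "(1 / 2) ^ k < t" using real_arch_pow_inv[of t "1 / 2"] assms by auto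
  moreover have "(1 / 2) ^ Suc k \<le> (1 / 2 :: real) ^ k" by simp
  ultimately have ex: "(1 / 2) ^ Suc k \<le> t" by linarith
  have "(1 / 2) ^ Suc j \<le> t" unfolding j_def using ex by (rule LeastI)
  moreover have "t < (1 / 2) ^ j"
  proof (cases j)
    case 0 then show ?thesis using assms by simp
  next
    case (Suc i)
    then have "\<not> (1 / 2) ^ Suc i \<le> t" unfolding j_def by (intro not_less_Least) simp
    then show ?thesis using Suc by simp
  qed
  ultimately show ?thesis by auto
qed

text \<open>On the annulus of radius \<open>R * 2 powr - (i + 1)\<close> the power of the norm is essentially constant, and
  integrating the power of \<open>\<Omega>\<close> there gives a geometric series, convergent because \<open>m * l < n\<close>.\<close>

lemma kernel_local_power:
  fixes \<Omega> \<Omega>' :: "real^'n \<Rightarrow> complex"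
  defines "n \<equiv> real CARD('n)"
  assumes "\<Omega> \<in> sphere_L s" and bv: "borel_version \<Omega> \<Omega>'" and l: "0 < l" "ennreal l \<le> s" and m: "0 < m" "m * l < n"
  obtains M where "0 \<le> M" "\<And>R. 0 < R \<Longrightarrow>
     (\<integral>\<^sup>+x\<in>ball 0 R. ennreal (norm (kernel \<Omega>' m x) powr l) \<partial>lborel) \<le> ennreal (M * R powr (n - m * l))"
proof -
  have [measurable]: "\<Omega>' \<in> borel_measurable borel" using bv by (simp add: borel_version_def)
  obtain M0 where M0: "0 \<le> M0" "\<And>R. 0 < R \<Longrightarrow>
      (\<integral>\<^sup>+x\<in>ball 0 R. ennreal (norm (\<Omega>' x) powr l) \<partial>lborel) \<le> ennreal (M0 * R ^ CARD('n))"
    using borel_version_power_ball[OF assms(2) bv l] by blast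
  define q where "q = (1 / 2 :: real) powr (n - m * l)"
  have q: "0 < q" "q < 1"
    using m powr_less_mono2[of "n - m * l" "1 / 2" 1] by (auto simp: q_def)
  define S where "S = (\<Sum>i. q ^ Suc i)"
  have sumq: "summable (\<lambda>i. q ^ Suc i)" using q by (simp add: summable_geometric)
  have S: "0 \<le> S" unfolding S_def using q by (intro suminf_nonneg sumq) auto
  show ?thesis
  proof (rule that[of "M0 * 2 ^ CARD('n) * S"])
    show "0 \<le> M0 * 2 ^ CARD('n) * S" using M0 S by simp
    fix R :: real assume R: "0 < R"
    define \<rho> where "\<rho> i = R * (1 / 2) ^ Suc i" for i
    have \<rho>: "0 < \<rho> i" for i using R by (simp add: \<rho>_def)
    have "(\<integral>\<^sup>+x\<in>ball 0 R. ennreal (norm (kernel \<Omega>' m x) powr l) \<partial>lborel)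
       \<le> (\<integral>\<^sup>+x. (\<Sum>i. ennreal (norm (kernel \<Omega>' m x) powr l) * indicator (annulus (\<rho> i)) x) \<partial>lborel)"
    proof (rule nn_integral_mono)
      fix x :: "real^'n"
      show "ennreal (norm (kernel \<Omega>' m x) powr l) * indicator (ball 0 R) x
         \<le> (\<Sum>i. ennreal (norm (kernel \<Omega>' m x) powr l) * indicator (annulus (\<rho> i)) x)"
      proof (cases "x \<in> ball 0 R \<and> x \<noteq> 0")
        case True
        then obtain i where i: "(1 / 2) ^ Suc i \<le> norm x / R" "norm x / R < (1 / 2) ^ i"
          using dyadic_less_one[of "norm x / R"] R by auto
        have "x \<in> annulus (\<rho> i)"
          using i R by (simp add: annulus_def \<rho>_def field_simps)
        then have "ennreal (norm (kernel \<Omega>' m x) powr l) * indicator (ball 0 R) x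
          \<le> (\<Sum>i\<in>{i}. ennreal (norm (kernel \<Omega>' m x) powr l) * indicator (annulus (\<rho> i)) x)"
          by (simp split: split_indicator)
        also have "\<dots> \<le> (\<Sum>i. ennreal (norm (kernel \<Omega>' m x) powr l) * indicator (annulus (\<rho> i)) x)"
          by (intro sum_le_suminf) auto
        finally show ?thesis .
      next
        case False
        then show ?thesis using l by (auto simp: norm_kernel)
      qed
    qed
    also have "\<dots> = (\<Sum>i. \<integral>\<^sup>+x\<in>annulus (\<rho> i). ennreal (norm (kernel \<Omega>' m x) powr l) \<partial>lborel)"
      by (intro nn_integral_suminf) measurable
    also have "\<dots> \<le> (\<Sum>i. ennreal (M0 * 2 ^ CARD('n) * R powr (n - m * l) * q ^ Suc i))"
    proof (intro suminf_le)
      fix i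
      have "(\<integral>\<^sup>+x\<in>annulus (\<rho> i). ennreal (norm (kernel \<Omega>' m x) powr l) \<partial>lborel)
         \<le> (\<integral>\<^sup>+x. ennreal (\<rho> i powr (- m * l)) * (ennreal (norm (\<Omega>' x) powr l) * indicator (ball 0 (2 * \<rho> i)) x) \<partial>lborel)"
      proof (rule nn_integral_mono)
        fix x
        show "ennreal (norm (kernel \<Omega>' m x) powr l) * indicator (annulus (\<rho> i)) x
          \<le> ennreal (\<rho> i powr (- m * l)) * (ennreal (norm (\<Omega>' x) powr l) * indicator (ball 0 (2 * \<rho> i)) x)"
        proof (cases "x \<in> annulus (\<rho> i)")
          case True
          then have x: "\<rho> i \<le> norm x" "x \<in> ball 0 (2 * \<rho> i)" by (auto simp: annulus_def)
          have "norm (kernel \<Omega>' m x) powr l = norm x powr (- m * l) * norm (\<Omega>' x) powr l"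
            by (simp add: norm_kernel powr_mult powr_powr)
          also have "\<dots> \<le> \<rho> i powr (- m * l) * norm (\<Omega>' x) powr l"
            using x \<rho>[of i] m l by (intro mult_right_mono powr_mono2') (auto simp: mult_nonneg_nonneg)
          finally have "ennreal (norm (kernel \<Omega>' m x) powr l) \<le> ennreal (\<rho> i powr (- m * l) * norm (\<Omega>' x) powr l)"
            by (rule ennreal_leI)
          then show ?thesis using True x by (simp add: ennreal_mult)
        qed simp
      qed
      also have "\<dots> = ennreal (\<rho> i powr (- m * l)) * (\<integral>\<^sup>+x\<in>ball 0 (2 * \<rho> i). ennreal (norm (\<Omega>' x) powr l) \<partial>lborel)"
        by (rule nn_integral_cmult) measurable
      also have "\<dots> \<le> ennreal (\<rho> i powr (- m * l)) * ennreal (M0 * (2 * \<rho> i) ^ CARD('n))"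
        using \<rho>[of i] by (intro mult_left_mono M0) auto
      also have "\<dots> = ennreal (\<rho> i powr (- m * l) * (M0 * (2 * \<rho> i) ^ CARD('n)))"
        using M0 \<rho>[of i] by (simp add: ennreal_mult)
      also have "\<rho> i powr (- m * l) * (M0 * (2 * \<rho> i) ^ CARD('n)) = M0 * 2 ^ CARD('n) * (\<rho> i powr (n - m * l))"
      proof -
        have "\<rho> i powr (n - m * l) = \<rho> i powr n * \<rho> i powr (- m * l)"
          by (subst powr_add[symmetric]) simp
        also have "\<rho> i powr n = \<rho> i ^ CARD('n)" using \<rho>[of i] by (simp add: n_def powr_realpow)
        finally show ?thesis by (simp add: power_mult_distrib mult_ac)
      qed
      also have "\<rho> i powr (n - m * l) = R powr (n - m * l) * q ^ Suc i"
      proof -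
        have "((1 / 2) ^ Suc i) powr (n - m * l) = q ^ Suc i"
        proof -
          have "((1 / 2 :: real) ^ Suc i) powr (n - m * l) = ((1 / 2) powr real (Suc i)) powr (n - m * l)"
            by (subst powr_realpow) auto
          also have "\<dots> = q powr real (Suc i)" unfolding q_def powr_powr by (simp add: mult.commute)
          also have "\<dots> = q ^ Suc i" using q by (subst powr_realpow) auto
          finally show ?thesis .
        qed
        then show ?thesis using R by (simp add: \<rho>_def powr_mult del: power_Suc)
      qed
      finally show "(\<integral>\<^sup>+x\<in>annulus (\<rho> i). ennreal (norm (kernel \<Omega>' m x) powr l) \<partial>lborel)
         \<le> ennreal (M0 * 2 ^ CARD('n) * R powr (n - m * l) * q ^ Suc i)" by (simp only: mult.assoc)
    qed auto
    also have "\<dots> = ennreal (\<Sum>i. M0 * 2 ^ CARD('n) * R powr (n - m * l) * q ^ Suc i)"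
      using M0 q sumq by (intro suminf_ennreal2 summable_mult) auto
    also have "(\<Sum>i. M0 * 2 ^ CARD('n) * R powr (n - m * l) * q ^ Suc i) = M0 * 2 ^ CARD('n) * S * R powr (n - m * l)"
      unfolding S_def using suminf_mult[OF sumq, of "M0 * 2 ^ CARD('n) * R powr (n - m * l)"] by (simp only: mult_ac)
    finally show "(\<integral>\<^sup>+x\<in>ball 0 R. ennreal (norm (kernel \<Omega>' m x) powr l) \<partial>lborel)
        \<le> ennreal (M0 * 2 ^ CARD('n) * S * R powr (n - m * l))" .
  qed
qed

section \<open>Near part, far part and mean oscillation\<close>

text \<open>Young's convolution inequality for \<open>L\<^sup>1\<close> and \<open>L\<^sup>l\<close>. Hoelder's inequality with respect to the measure
  with density \<open>\<phi>\<close> bounds \<open>Near x powr l\<close> by \<open>I0 powr (l - 1) * G x\<close>, where \<open>G\<close> is the convolution of \<open>\<phi>\<close> with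
  the \<open>l\<close>-th power of the kernel, and \<open>G\<close> is integrated by Tonelli's theorem.\<close>

lemma near_part:
  fixes K :: "'a::euclidean_space \<Rightarrow> complex" and \<phi> :: "'a \<Rightarrow> real"
  assumes [measurable]: "K \<in> borel_measurable borel" "\<phi> \<in> borel_measurable borel"
    and \<phi>: "\<And>x. 0 \<le> \<phi> x" and l: "1 \<le> l"
    and I0: "(\<integral>\<^sup>+y\<in>ball c R. ennreal (\<phi> y) \<partial>lborel) \<le> ennreal I0" "0 \<le> I0"
    and A: "(\<integral>\<^sup>+x\<in>ball 0 (R + r). ennreal (norm (K x) powr l) \<partial>lborel) \<le> ennreal A" "0 \<le> A"
  defines "Near \<equiv> \<lambda>x. \<integral>\<^sup>+y\<in>ball c R. ennreal (norm (K (x - y)) * \<phi> y) \<partial>lborel"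
  shows "(\<integral>\<^sup>+x\<in>ball c r. ennreal (enn2real (Near x) powr l) \<partial>lborel) \<le> ennreal (I0 powr l * A)"
    and "AE x in lborel. x \<in> ball c r \<longrightarrow> Near x < \<infinity>"
proof -
  define G where "G x = (\<integral>\<^sup>+y\<in>ball c R. ennreal (norm (K (x - y)) powr l * \<phi> y) \<partial>lborel)" for x
  have [measurable]: "G \<in> borel_measurable borel" unfolding G_def indicator_ball by measurable
  have GI: "(\<integral>\<^sup>+x\<in>ball c r. G x \<partial>lborel) \<le> ennreal (A * I0)"
  proof -
    have "(\<integral>\<^sup>+x\<in>ball c r. G x \<partial>lborel)
       = (\<integral>\<^sup>+x. \<integral>\<^sup>+y. ennreal (norm (K (x - y)) powr l * \<phi> y) * indicator (ball c R) y * indicator (ball c r) x \<partial>lborel \<partial>lborel)"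
      unfolding G_def indicator_ball by (subst nn_integral_multc) auto
    also have "\<dots> = (\<integral>\<^sup>+y. \<integral>\<^sup>+x. ennreal (norm (K (x - y)) powr l * \<phi> y) * indicator (ball c R) y * indicator (ball c r) x \<partial>lborel \<partial>lborel)"
      unfolding indicator_ball by (rule lborel_pair.Fubini') measurable
    also have "\<dots> \<le> (\<integral>\<^sup>+y. ennreal A * (ennreal (\<phi> y) * indicator (ball c R) y) \<partial>lborel)"
    proof (rule nn_integral_mono)
      fix y
      show "(\<integral>\<^sup>+x. ennreal (norm (K (x - y)) powr l * \<phi> y) * indicator (ball c R) y * indicator (ball c r) x \<partial>lborel)
        \<le> ennreal A * (ennreal (\<phi> y) * indicator (ball c R) y)"
      proof (cases "y \<in> ball c R")
        case True
        have "(\<integral>\<^sup>+x. ennreal (norm (K (x - y)) powr l * \<phi> y) * indicator (ball c R) y * indicator (ball c r) x \<partial>lborel)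
          \<le> (\<integral>\<^sup>+x. ennreal (\<phi> y) * (ennreal (norm (K (x + (- y))) powr l) * indicator (ball 0 (R + r)) (x + (- y))) \<partial>lborel)"
        proof (rule nn_integral_mono)
          fix x
          have "x + (- y) \<in> ball 0 (R + r)" if "x \<in> ball c r"
            using that True norm_triangle_ineq[of "x - c" "c - y"] by (simp add: dist_norm norm_minus_commute)
          then show "ennreal (norm (K (x - y)) powr l * \<phi> y) * indicator (ball c R) y * indicator (ball c r) x
             \<le> ennreal (\<phi> y) * (ennreal (norm (K (x + (- y))) powr l) * indicator (ball 0 (R + r)) (x + (- y)))"
            using True \<phi>[of y] by (auto simp: ennreal_mult mult.commute split: split_indicator)
        qed
        also have "\<dots> = (\<integral>\<^sup>+x. ennreal (\<phi> y) * (ennreal (norm (K x) powr l) * indicator (ball 0 (R + r)) x) \<partial>lborel)"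
          by (rule nn_integral_lborel_shift[of "\<lambda>x. ennreal (\<phi> y) * (ennreal (norm (K x) powr l) * indicator (ball 0 (R + r)) x)"]) measurable
        also have "\<dots> = ennreal (\<phi> y) * (\<integral>\<^sup>+x\<in>ball 0 (R + r). ennreal (norm (K x) powr l) \<partial>lborel)"
          by (rule nn_integral_cmult) measurable
        also have "\<dots> \<le> ennreal (\<phi> y) * ennreal A" by (intro mult_left_mono A) auto
        finally show ?thesis using True by (simp add: mult.commute)
      qed simp
    qed
    also have "\<dots> = ennreal A * (\<integral>\<^sup>+y\<in>ball c R. ennreal (\<phi> y) \<partial>lborel)"
      by (rule nn_integral_cmult) measurable
    also have "\<dots> \<le> ennreal A * ennreal I0" by (intro mult_left_mono I0) auto
    finally show ?thesis using A I0 by (simp add: ennreal_mult)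
  qed
  have NearG: "Near x < \<infinity> \<and> ennreal (enn2real (Near x) powr l) \<le> ennreal (I0 powr (l - 1)) * G x" if fin: "G x < \<infinity>" for x
  proof -
    obtain g where g: "0 \<le> g" "G x = ennreal g" using fin by (cases "G x") auto
    have "Near x \<le> ennreal (g powr (1 / l) * I0 powr (1 - 1 / l))"
    proof (cases "l = 1")
      case True
      have "Near x = G x" using \<phi> by (simp add: Near_def G_def True)
      show ?thesis
      proof (cases "I0 = 0")
        case False
        then show ?thesis using \<open>Near x = G x\<close> g True by simp
      next
        case True
        then have "(\<integral>\<^sup>+y\<in>ball c R. ennreal (\<phi> y) \<partial>lborel) = 0" using I0 by simp
        then have "AE y in lborel. ennreal (\<phi> y) * indicator (ball c R) y = 0"
          by (subst (asm) nn_integral_0_iff_AE) auto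
        then have "Near x = (\<integral>\<^sup>+y. 0 \<partial>(lborel :: 'a measure))"
          unfolding Near_def by (intro nn_integral_cong_AE) (auto elim!: eventually_mono simp: ennreal_eq_0_iff \<phi> mult_nonneg_nonpos split: split_indicator_asm)
        then show ?thesis by simp
      qed
    next
      case False
      then have l1: "1 < l" using l by simp
      define l' where "l' = l / (l - 1)"
      have l': "1 < l'" "1 / l + 1 / l' = 1" "1 / l' = 1 - 1 / l" using l1 by (auto simp: l'_def field_simps)
      have "Near x = (\<integral>\<^sup>+y\<in>ball c R. ennreal ((norm (K (x - y)) * \<phi> y powr (1 / l)) * \<phi> y powr (1 / l')) \<partial>lborel)"
        unfolding Near_def
      proof (intro nn_integral_cong)
        fix y
        have "\<phi> y powr (1 / l) * \<phi> y powr (1 / l') = \<phi> y"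
          using \<phi>[of y] l'(2) by (simp flip: powr_add)
        then show "ennreal (norm (K (x - y)) * \<phi> y) * indicator (ball c R) y
           = ennreal ((norm (K (x - y)) * \<phi> y powr (1 / l)) * \<phi> y powr (1 / l')) * indicator (ball c R) y"
          by (simp only: mult.assoc)
      qed
      also have "\<dots> \<le> ennreal (g powr (1 / l) * I0 powr (1 / l'))"
      proof (rule set_nn_integral_Holder_bound[OF _ _ _ _ _ l1 l'(1,2)])
        show "(\<integral>\<^sup>+y\<in>ball c R. ennreal ((norm (K (x - y)) * \<phi> y powr (1 / l)) powr l) \<partial>lborel) \<le> ennreal ((g powr (1 / l)) powr l)"
          using g l1 \<phi> by (simp add: powr_mult powr_powr G_def)
        show "(\<integral>\<^sup>+y\<in>ball c R. ennreal ((\<phi> y powr (1 / l')) powr l') \<partial>lborel) \<le> ennreal ((I0 powr (1 / l')) powr l')"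
          using I0 l'(1) \<phi> by (simp add: powr_powr)
      qed (use \<phi> in auto)
      finally show ?thesis by (simp add: l'(3))
    qed
    then have N: "Near x < \<infinity>" "enn2real (Near x) \<le> g powr (1 / l) * I0 powr (1 - 1 / l)"
      by (auto intro: le_less_trans simp: enn2real_leI)
    have "enn2real (Near x) powr l \<le> (g powr (1 / l) * I0 powr (1 - 1 / l)) powr l"
      using N l by (intro powr_mono2) auto
    also have "\<dots> = I0 powr (l - 1) * g"
    proof -
      have "(1 - 1 / l) * l = l - 1" using l by (simp add: field_simps)
      then show ?thesis using g l by (simp add: powr_mult powr_powr mult.commute)
    qed
    finally show ?thesis using N g by (simp add: ennreal_mult[symmetric] ennreal_leI)
  qed
  have fin: "AE x in lborel. x \<in> ball c r \<longrightarrow> G x < \<infinity>"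
  proof -
    have "(\<integral>\<^sup>+x\<in>ball c r. G x \<partial>lborel) \<noteq> \<infinity>" using GI by (auto simp: top_unique)
    then have "AE x in lborel. G x * indicator (ball c r) x \<noteq> \<infinity>"
      by (intro nn_integral_noteq_infinite) auto
    then show ?thesis by eventually_elim (auto simp: top.not_eq_extremum)
  qed
  then show "AE x in lborel. x \<in> ball c r \<longrightarrow> Near x < \<infinity>"
    using NearG by (auto elim: eventually_mono)
  have "(\<integral>\<^sup>+x\<in>ball c r. ennreal (enn2real (Near x) powr l) \<partial>lborel)
     \<le> (\<integral>\<^sup>+x. ennreal (I0 powr (l - 1)) * (G x * indicator (ball c r) x) \<partial>lborel)"
    using fin NearG by (intro nn_integral_mono_AE) (auto elim!: eventually_mono split: split_indicator)
  also have "\<dots> = ennreal (I0 powr (l - 1)) * (\<integral>\<^sup>+x\<in>ball c r. G x \<partial>lborel)"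
    by (rule nn_integral_cmult) measurable
  also have "\<dots> \<le> ennreal (I0 powr (l - 1)) * ennreal (A * I0)" by (intro mult_left_mono GI) auto
  also have "\<dots> = ennreal (I0 powr l * A)"
  proof -
    have "I0 powr (l - 1) * I0 = I0 powr l"
      using I0 l by (cases "I0 = 0") (auto simp: powr_diff)
    then have "I0 powr (l - 1) * (A * I0) = I0 powr l * A" by (metis mult.assoc mult.commute)
    then show ?thesis using I0 A by (simp add: ennreal_mult[symmetric])
  qed
  finally show "(\<integral>\<^sup>+x\<in>ball c r. ennreal (enn2real (Near x) powr l) \<partial>lborel) \<le> ennreal (I0 powr l * A)" .
qed

lemma nn_integral_lborel_reflect:
  fixes f :: "'a::euclidean_space \<Rightarrow> ennreal"
  assumes [measurable]: "f \<in> borel_measurable borel"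
  shows "(\<integral>\<^sup>+y. f (c - y) \<partial>lborel) = (\<integral>\<^sup>+y. f y \<partial>lborel)"
  using nn_integral_lborel_scale[OF assms, of "-1" c] by simp

text \<open>After the substitution of \<open>c - y\<close> for \<open>y\<close> the domain is the union of the annuli of radius
  \<open>2 ^ (j + k0) * r\<close>. On the \<open>j\<close>-th one the powers of the radius cancel, and \<open>d j * 2 powr (\<theta> * j)\<close> is left.\<close>

lemma far_part:
  fixes K :: "real^'n \<Rightarrow> complex" and \<phi> :: "real^'n \<Rightarrow> real" and d :: "nat \<Rightarrow> real"
  assumes [measurable]: "K \<in> borel_measurable borel" "\<phi> \<in> borel_measurable borel"
    and \<phi>: "\<And>x. 0 \<le> \<phi> x" and r: "0 < r" and s': "0 < s'"
    and d: "\<And>j. 0 \<le> d j" "summable (\<lambda>j. d j * 2 powr (\<theta> * real j))"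
    and smooth: "\<And>j \<rho> h. 0 < \<rho> \<Longrightarrow> norm h < 2 powr - (real j + real k0) * \<rho> \<Longrightarrow>
       annular_bound s' \<rho> (\<lambda>y. norm (K (y + h) - K y)) (d j * \<rho> powr (- b))"
    and growth: "\<And>j::nat. (\<integral>\<^sup>+y\<in>ball c (2 ^ j * r). ennreal (\<phi> y powr s') \<partial>lborel)
       \<le> ennreal ((B * 2 powr (\<theta> * real j) * (2 ^ j * r) powr b) powr s')" and B: "0 \<le> B"
    and x: "x \<in> ball c r"
  shows "(\<integral>\<^sup>+y\<in>- ball c (2 ^ k0 * r). ennreal (norm (K (x - y) - K (c - y)) * \<phi> y) \<partial>lborel)
    \<le> ennreal ((\<Sum>j. d j * 2 powr (\<theta> * real j)) * 2 powr (\<theta> * (real k0 + 1) + b) * B)"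
proof -
  define h where "h = x - c"
  define \<rho> where "\<rho> j = 2 ^ (j + k0) * r" for j :: nat
  have \<rho>: "0 < \<rho> j" for j using r by (simp add: \<rho>_def)
  define F where "F y = \<phi> (c - y)" for y
  have [measurable]: "F \<in> borel_measurable borel" unfolding F_def by measurable
  define g where "g y = ennreal (norm (K (y + h) - K y) * F y)" for y
  have [measurable]: "g \<in> borel_measurable borel" unfolding g_def by measurable
  have [measurable]: "- ball c (2 ^ k0 * r) \<in> sets borel" by (intro borel_comp) auto
  have [measurable]: "- ball (0::real^'n) (2 ^ k0 * r) \<in> sets borel" by (intro borel_comp) auto
  define S0 where "S0 = 2 powr (\<theta> * (real k0 + 1) + b) * B"
  have S0: "0 \<le> S0" using B by (simp add: S0_def)
  have "(\<integral>\<^sup>+y\<in>- ball c (2 ^ k0 * r). ennreal (norm (K (x - y) - K (c - y)) * \<phi> y) \<partial>lborel)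
    = (\<integral>\<^sup>+y. ennreal (norm (K (x - (c - y)) - K (c - (c - y))) * \<phi> (c - y)) * indicator (- ball c (2 ^ k0 * r)) (c - y) \<partial>lborel)"
    by (rule nn_integral_lborel_reflect[symmetric]) measurable
  also have "\<dots> = (\<integral>\<^sup>+y\<in>- ball 0 (2 ^ k0 * r). g y \<partial>lborel)"
    by (intro nn_integral_cong) (auto simp: g_def F_def h_def algebra_simps dist_norm split: split_indicator)
  also have "\<dots> \<le> (\<integral>\<^sup>+y. (\<Sum>j. g y * indicator (annulus (\<rho> j)) y) \<partial>lborel)"
  proof (rule nn_integral_mono)
    fix y :: "real^'n"
    show "g y * indicator (- ball 0 (2 ^ k0 * r)) y \<le> (\<Sum>j. g y * indicator (annulus (\<rho> j)) y)"
    proof (cases "y \<in> ball 0 (2 ^ k0 * r)")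
      case False
      then have "1 \<le> norm y / (2 ^ k0 * r)" using r by (simp add: field_simps)
      then obtain j where j: "2 ^ j \<le> norm y / (2 ^ k0 * r)" "norm y / (2 ^ k0 * r) < 2 * 2 ^ j"
        using dyadic_ge_one by blast
      have "y \<in> annulus (\<rho> j)"
        using j r by (simp add: annulus_def \<rho>_def field_simps power_add)
      then have "g y * indicator (- ball 0 (2 ^ k0 * r)) y \<le> (\<Sum>j\<in>{j}. g y * indicator (annulus (\<rho> j)) y)"
        by (simp split: split_indicator)
      also have "\<dots> \<le> (\<Sum>j. g y * indicator (annulus (\<rho> j)) y)"
        by (intro sum_le_suminf) auto
      finally show ?thesis .
    qed simp
  qed
  also have "\<dots> = (\<Sum>j. \<integral>\<^sup>+y\<in>annulus (\<rho> j). g y \<partial>lborel)"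
    by (intro nn_integral_suminf) measurable
  also have "\<dots> \<le> (\<Sum>j. ennreal (S0 * (d j * 2 powr (\<theta> * real j))))"
  proof (intro suminf_le)
    fix j :: nat
    define A where "A = B * 2 powr (\<theta> * real (j + k0 + 1)) * (2 ^ (j + k0 + 1) * r) powr b"
    have "(\<integral>\<^sup>+y\<in>annulus (\<rho> j). g y \<partial>lborel) \<le> ennreal (d j * \<rho> j powr (- b) * A)"
      unfolding g_def
    proof (rule annular_boundD[OF smooth[OF \<rho>]])
      have "norm h < r" using x by (simp add: h_def dist_norm norm_minus_commute)
      moreover have "2 powr - (real j + real k0) * \<rho> j = r"
      proof -
        have "(2::real) ^ (j + k0) = 2 powr (real j + real k0)" by (simp add: powr_realpow flip: of_nat_add)
        moreover have "(2::real) powr - (real j + real k0) * 2 powr (real j + real k0) = 1" by (simp flip: powr_add)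
        ultimately show ?thesis by (simp only: \<rho>_def mult.assoc[symmetric] mult_1_left)
      qed
      ultimately show "norm h < 2 powr - (real j + real k0) * \<rho> j" by simp
      show "0 \<le> F y" for y by (simp add: F_def \<phi>)
      show "0 \<le> A" using B by (simp add: A_def)
      have "(\<integral>\<^sup>+y\<in>annulus (\<rho> j). ennreal (F y powr s') \<partial>lborel)
        \<le> (\<integral>\<^sup>+y. ennreal (\<phi> (c - y) powr s') * indicator (ball c (2 ^ (j + k0 + 1) * r)) (c - y) \<partial>lborel)"
        by (intro nn_integral_mono) (auto simp: F_def annulus_def \<rho>_def dist_norm split: split_indicator)
      also have "\<dots> = (\<integral>\<^sup>+y\<in>ball c (2 ^ (j + k0 + 1) * r). ennreal (\<phi> y powr s') \<partial>lborel)"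
        by (rule nn_integral_lborel_reflect) measurable
      also have "\<dots> \<le> ennreal (A powr s')" unfolding A_def by (rule growth)
      finally show "(\<integral>\<^sup>+y\<in>annulus (\<rho> j). ennreal (F y powr s') \<partial>lborel) \<le> ennreal (A powr s')" .
    qed measurable
    also have "d j * \<rho> j powr (- b) * A = S0 * (d j * 2 powr (\<theta> * real j))"
    proof -
      have "2 ^ (j + k0 + 1) * r = 2 * \<rho> j" by (simp add: \<rho>_def)
      then have e1: "(2 ^ (j + k0 + 1) * r) powr b = 2 powr b * \<rho> j powr b" using \<rho>[of j] by (simp only: powr_mult)
      have "\<theta> * real (j + k0 + 1) = \<theta> * real j + \<theta> * (real k0 + 1)" by (simp add: algebra_simps)
      then have e2: "(2::real) powr (\<theta> * real (j + k0 + 1)) = 2 powr (\<theta> * real j) * 2 powr (\<theta> * (real k0 + 1))"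
        by (simp only: powr_add)
      have e3: "\<rho> j powr (- b) * \<rho> j powr b = 1" using \<rho>[of j] by (simp flip: powr_add)
      have e4: "S0 = 2 powr (\<theta> * (real k0 + 1)) * 2 powr b * B" unfolding S0_def powr_add ..
      have "d j * p * (B * (t * u) * (v * w)) = u * v * B * (d j * t) * (p * w)" for p t u v w by simp
      then show ?thesis unfolding A_def e1 e2 e4 by (simp only: e3 mult_1_right)
    qed
    finally show "(\<integral>\<^sup>+y\<in>annulus (\<rho> j). g y \<partial>lborel) \<le> ennreal (S0 * (d j * 2 powr (\<theta> * real j)))" .
  qed auto
  also have "\<dots> = ennreal (\<Sum>j. S0 * (d j * 2 powr (\<theta> * real j)))"
    using S0 d by (intro suminf_ennreal2 summable_mult) auto
  also have "(\<Sum>j. S0 * (d j * 2 powr (\<theta> * real j))) = (\<Sum>j. d j * 2 powr (\<theta> * real j)) * 2 powr (\<theta> * (real k0 + 1) + b) * B"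
    using suminf_mult[OF d(2), of S0] by (simp only: S0_def mult_ac)
  finally show ?thesis .
qed

text \<open>Any constant \<open>z\<close> is admitted in place of the mean value of \<open>T\<close>, so local integrability of \<open>T\<close> is not
  presupposed.\<close>

definition mean_oscillation_bound :: "real \<Rightarrow> ('a::euclidean_space \<Rightarrow> real \<Rightarrow> real) \<Rightarrow> ('a \<Rightarrow> complex) \<Rightarrow> bool" where
  "mean_oscillation_bound l E T \<longleftrightarrow> (\<forall>c r. 0 < r \<longrightarrow>
     (\<exists>z. (\<integral>\<^sup>+x\<in>ball c r. ennreal (norm (T x - z) powr l) \<partial>lborel) \<le> ennreal (E c r powr l) * emeasure lborel (ball c r)))"

text \<open>A Bochner integral, hence 0 at the points where it does not converge absolutely.\<close>

definition convolution :: "('a::euclidean_space \<Rightarrow> complex) \<Rightarrow> ('a \<Rightarrow> complex) \<Rightarrow> 'a \<Rightarrow> complex" where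
  "convolution K f x = (LINT y|lborel. K (x - y) * f y)"

text \<open>Let \<open>P x\<close> be the integral of the modulus of \<open>K (x - y) * f y\<close>. If \<open>P\<close> is finite at one point \<open>x0\<close>, then the far bound
  for the balls around \<open>x0\<close> together with the almost everywhere finiteness of the near parts shows that \<open>P\<close> is
  finite almost everywhere; the far part of the integral then converges at the centre of every ball
  and is taken as the constant. If \<open>P\<close> is infinite everywhere, then the Bochner integral is 0 everywhere.\<close>

lemma singular_integral_oscillation:
  fixes K f :: "'a::euclidean_space \<Rightarrow> complex" and W :: "'a \<Rightarrow> real \<Rightarrow> real"
  assumes [measurable]: "K \<in> borel_measurable borel" "f \<in> borel_measurable borel"
    and l: "1 \<le> l" and \<Lambda>: "1 \<le> \<Lambda>"
    and W: "\<And>c r. 0 \<le> W c r" and S: "0 \<le> S" "0 \<le> a"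
    and near: "\<And>c r. 0 < r \<Longrightarrow>
      (\<integral>\<^sup>+x\<in>ball c r. ennreal (enn2real (\<integral>\<^sup>+y\<in>ball c (\<Lambda> * r). ennreal (norm (K (x - y)) * norm (f y)) \<partial>lborel) powr l) \<partial>lborel)
        \<le> ennreal ((a * W c r) powr l) * emeasure lborel (ball c r)"
    and near_fin: "\<And>c r. 0 < r \<Longrightarrow> AE x in lborel. x \<in> ball c r \<longrightarrow>
      (\<integral>\<^sup>+y\<in>ball c (\<Lambda> * r). ennreal (norm (K (x - y)) * norm (f y)) \<partial>lborel) < \<infinity>"
    and far: "\<And>c r x. 0 < r \<Longrightarrow> x \<in> ball c r \<Longrightarrow>
      (\<integral>\<^sup>+y\<in>- ball c (\<Lambda> * r). ennreal (norm (K (x - y) - K (c - y)) * norm (f y)) \<partial>lborel) \<le> ennreal (S * W c r)"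
    and r: "0 < r"
  defines "T \<equiv> convolution K f"
  shows "\<exists>z. (\<integral>\<^sup>+x\<in>ball c r. ennreal (norm (T x - z) powr l) \<partial>lborel)
     \<le> ennreal (2 powr l * ((a * W c r) powr l + (S * W c r) powr l)) * emeasure lborel (ball c r)"
proof -
  define P where "P x = (\<integral>\<^sup>+y. ennreal (norm (K (x - y)) * norm (f y)) \<partial>lborel)" for x
  \<comment> \<open>The function \<open>P\<close> decides at which points the integral converges.\<close>
  have P_int: "integrable lborel (\<lambda>y. K (x - y) * f y) \<longleftrightarrow> P x < \<infinity>" for x
    by (simp add: integrable_iff_bounded P_def norm_mult)
  have ball_sets: "- ball c' (\<Lambda> * r') \<in> sets borel" for c' :: 'a and r' by (intro borel_comp) auto
  note [measurable] = ball_sets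
  have split: "(\<integral>\<^sup>+y. g y \<partial>lborel) = (\<integral>\<^sup>+y\<in>ball c' \<rho>. g y \<partial>lborel) + (\<integral>\<^sup>+y\<in>- ball c' \<rho>. g y \<partial>lborel)"
    if [measurable]: "g \<in> borel_measurable borel" for g and c' :: 'a and \<rho>
  proof -
    have [measurable]: "- ball c' \<rho> \<in> sets borel" by (intro borel_comp) auto
    show ?thesis
      by (subst nn_integral_add[symmetric]) (auto intro!: nn_integral_cong split: split_indicator)
  qed
  have tri: "(\<integral>\<^sup>+y\<in>- ball c' (\<Lambda> * r'). ennreal (norm (K (x - y)) * norm (f y)) \<partial>lborel)
     \<le> (\<integral>\<^sup>+y\<in>- ball c' (\<Lambda> * r'). ennreal (norm (K (z - y)) * norm (f y)) \<partial>lborel)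
        + (\<integral>\<^sup>+y\<in>- ball c' (\<Lambda> * r'). ennreal (norm (K (x - y) - K (z - y)) * norm (f y)) \<partial>lborel)" for c' r' x z
  proof -
    have "(\<integral>\<^sup>+y\<in>- ball c' (\<Lambda> * r'). ennreal (norm (K (x - y)) * norm (f y)) \<partial>lborel)
      \<le> (\<integral>\<^sup>+y. ennreal (norm (K (z - y)) * norm (f y)) * indicator (- ball c' (\<Lambda> * r')) y
           + ennreal (norm (K (x - y) - K (z - y)) * norm (f y)) * indicator (- ball c' (\<Lambda> * r')) y \<partial>lborel)"
    proof (rule nn_integral_mono)
      fix y
      have "norm (K (x - y)) * norm (f y) \<le> (norm (K (z - y)) + norm (K (x - y) - K (z - y))) * norm (f y)"
        using norm_triangle_ineq[of "K (z - y)" "K (x - y) - K (z - y)"] by (intro mult_right_mono) auto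
      then have "ennreal (norm (K (x - y)) * norm (f y))
         \<le> ennreal (norm (K (z - y)) * norm (f y) + norm (K (x - y) - K (z - y)) * norm (f y))"
        by (intro ennreal_leI) (simp add: distrib_right)
      then show "ennreal (norm (K (x - y)) * norm (f y)) * indicator (- ball c' (\<Lambda> * r')) y
        \<le> ennreal (norm (K (z - y)) * norm (f y)) * indicator (- ball c' (\<Lambda> * r')) y
           + ennreal (norm (K (x - y) - K (z - y)) * norm (f y)) * indicator (- ball c' (\<Lambda> * r')) y"
        by (auto simp: ennreal_plus split: split_indicator)
    qed
    then show ?thesis by (simp add: nn_integral_add)
  qed
  show ?thesis
  proof (cases "\<exists>x. P x < \<infinity>")
    case False
    have "T x = 0" for x unfolding T_def convolution_def using False P_int by (intro not_integrable_integral_eq) auto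
    then show ?thesis using l by (intro exI[of _ 0]) simp
  next
    case True
    then obtain x0 where x0: "P x0 < \<infinity>" by blast
    have Pfin: "AE x in lborel. P x < \<infinity>"
    proof -
      have "AE x in lborel. x \<in> ball x0 (real (Suc k)) \<longrightarrow> P x < \<infinity>" for k
        using near_fin[of "real (Suc k)" x0, simplified]
      proof eventually_elim
        case (elim x)
        show ?case
        proof
          assume x: "x \<in> ball x0 (real (Suc k))"
          have "(\<integral>\<^sup>+y\<in>- ball x0 (\<Lambda> * real (Suc k)). ennreal (norm (K (x - y)) * norm (f y)) \<partial>lborel)
             \<le> P x0 + ennreal (S * W x0 (real (Suc k)))"
          proof (rule order_trans[OF tri[where c' = x0 and r' = "real (Suc k)" and x = x and z = x0]], rule add_mono)
            show "(\<integral>\<^sup>+y\<in>- ball x0 (\<Lambda> * real (Suc k)). ennreal (norm (K (x0 - y)) * norm (f y)) \<partial>lborel) \<le> P x0"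
              unfolding P_def by (intro nn_integral_mono) (auto split: split_indicator)
            show "(\<integral>\<^sup>+y\<in>- ball x0 (\<Lambda> * real (Suc k)). ennreal (norm (K (x - y) - K (x0 - y)) * norm (f y)) \<partial>lborel)
               \<le> ennreal (S * W x0 (real (Suc k)))"
              by (rule far[OF _ x]) simp
          qed
          also have "\<dots> < \<infinity>" using x0 by simp
          finally show "P x < \<infinity>"
            unfolding P_def using elim x
            by (subst split[of _ x0 "\<Lambda> * real (Suc k)"]) auto
        qed
      qed
      then have "AE x in lborel. \<forall>k. x \<in> ball x0 (real (Suc k)) \<longrightarrow> P x < \<infinity>"
        unfolding AE_all_countable by blast
      then show ?thesis
      proof eventually_elim
        case (elim x)
        obtain k where "dist x0 x < real k" using reals_Archimedean2 by blast
        then have "x \<in> ball x0 (real (Suc k))" by simp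
        then show ?case using elim by blast
      qed
    qed
    obtain z where z: "z \<in> ball c r" "P z < \<infinity>"
    proof -
      obtain N where N: "N \<in> null_sets lborel" "{x. \<not> P x < \<infinity>} \<subseteq> N"
        using Pfin by (auto simp: eventually_ae_filter)
      have "\<not> ball c r \<subseteq> N"
      proof
        assume "ball c r \<subseteq> N"
        then have "emeasure lborel (ball c r) \<le> emeasure lborel N" using N by (intro emeasure_mono) auto
        moreover have "0 < emeasure lborel (ball c r)" using r by (simp add: emeasure_ball)
        ultimately show False using N by auto
      qed
      then show ?thesis using that N by blast
    qed
    define g where "g y = indicator (- ball c (\<Lambda> * r)) y *\<^sub>R (K (c - y) * f y)" for y
    have g_int: "integrable lborel g"
    proof -
      have gm: "g \<in> borel_measurable borel" unfolding g_def by measurable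
      have "(\<integral>\<^sup>+y. ennreal (norm (g y)) \<partial>lborel) = (\<integral>\<^sup>+y\<in>- ball c (\<Lambda> * r). ennreal (norm (K (c - y)) * norm (f y)) \<partial>lborel)"
        by (intro nn_integral_cong) (auto simp: g_def norm_mult split: split_indicator)
      also have "\<dots> \<le> P z + ennreal (S * W c r)"
      proof (rule order_trans[OF tri[where c' = c and r' = r and x = c and z = z]], rule add_mono)
        show "(\<integral>\<^sup>+y\<in>- ball c (\<Lambda> * r). ennreal (norm (K (z - y)) * norm (f y)) \<partial>lborel) \<le> P z"
          unfolding P_def by (intro nn_integral_mono) (auto split: split_indicator)
        show "(\<integral>\<^sup>+y\<in>- ball c (\<Lambda> * r). ennreal (norm (K (c - y) - K (z - y)) * norm (f y)) \<partial>lborel) \<le> ennreal (S * W c r)"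
          using far[OF r z(1)] by (simp add: norm_minus_commute)
      qed
      also have "\<dots> < \<infinity>" using z by simp
      finally show ?thesis using gm by (simp add: integrable_iff_bounded)
    qed
    \<comment> \<open>The constant with which \<open>T\<close> is compared on the ball.\<close>
    define w where "w = (LINT y|lborel. g y)"
    define Nr where "Nr x = (\<integral>\<^sup>+y\<in>ball c (\<Lambda> * r). ennreal (norm (K (x - y)) * norm (f y)) \<partial>lborel)" for x
    have [measurable]: "Nr \<in> borel_measurable borel" unfolding Nr_def indicator_ball by measurable
    have pw: "AE x in lborel. x \<in> ball c r \<longrightarrow> norm (T x - w) powr l \<le> 2 powr l * (enn2real (Nr x) powr l + (S * W c r) powr l)"
      using Pfin
    proof (eventually_elim, intro impI)
      case (elim x)
      assume x: "x \<in> ball c r"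
      have int: "integrable lborel (\<lambda>y. K (x - y) * f y)" using elim P_int by simp
      have "Nr x \<le> P x" unfolding Nr_def P_def by (intro nn_integral_mono) (auto split: split_indicator)
      then have Nfin: "Nr x < \<infinity>" using elim by (rule le_less_trans)
      have int2: "integrable lborel (\<lambda>y. K (x - y) * f y - g y)" using int g_int by simp
      have "T x - w = (LINT y|lborel. K (x - y) * f y - g y)"
        unfolding T_def convolution_def w_def using int g_int by (rule Bochner_Integration.integral_diff[symmetric])
      then have "ennreal (norm (T x - w)) \<le> (\<integral>\<^sup>+y. ennreal (norm (K (x - y) * f y - g y)) \<partial>lborel)"
        using integral_norm_bound_ennreal[OF int2] by simp
      also have "\<dots> = (\<integral>\<^sup>+y\<in>ball c (\<Lambda> * r). ennreal (norm (K (x - y) * f y - g y)) \<partial>lborel)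
          + (\<integral>\<^sup>+y\<in>- ball c (\<Lambda> * r). ennreal (norm (K (x - y) * f y - g y)) \<partial>lborel)"
        using int2 by (intro split) (auto dest: borel_measurable_integrable)
      also have "(\<integral>\<^sup>+y\<in>ball c (\<Lambda> * r). ennreal (norm (K (x - y) * f y - g y)) \<partial>lborel) = Nr x"
        unfolding Nr_def by (intro nn_integral_cong) (auto simp: g_def norm_mult split: split_indicator)
      also have "(\<integral>\<^sup>+y\<in>- ball c (\<Lambda> * r). ennreal (norm (K (x - y) * f y - g y)) \<partial>lborel)
         = (\<integral>\<^sup>+y\<in>- ball c (\<Lambda> * r). ennreal (norm (K (x - y) - K (c - y)) * norm (f y)) \<partial>lborel)"
        by (intro nn_integral_cong) (auto simp: g_def left_diff_distrib[symmetric] norm_mult split: split_indicator)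
      also have "Nr x + \<dots> \<le> ennreal (enn2real (Nr x)) + ennreal (S * W c r)"
        using far[OF r x] Nfin by (intro add_mono) auto
      also have "\<dots> = ennreal (enn2real (Nr x) + S * W c r)"
        using S W by (simp add: ennreal_plus)
      finally have "norm (T x - w) \<le> enn2real (Nr x) + S * W c r"
        using S W by (subst (asm) ennreal_le_iff) (auto intro: add_nonneg_nonneg)
      then have "norm (T x - w) powr l \<le> (enn2real (Nr x) + S * W c r) powr l"
        using l by (intro powr_mono2) auto
      also have "\<dots> \<le> 2 powr l * (enn2real (Nr x) powr l + (S * W c r) powr l)"
        using l S W by (intro powr_add_le_two_powr) auto
      finally show "norm (T x - w) powr l \<le> 2 powr l * (enn2real (Nr x) powr l + (S * W c r) powr l)" .
    qed
    have "(\<integral>\<^sup>+x\<in>ball c r. ennreal (norm (T x - w) powr l) \<partial>lborel)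
      \<le> (\<integral>\<^sup>+x. ennreal (2 powr l) * (ennreal (enn2real (Nr x) powr l) * indicator (ball c r) x
            + ennreal ((S * W c r) powr l) * indicator (ball c r) x) \<partial>lborel)"
    proof (rule nn_integral_mono_AE)
      show "AE x in lborel. ennreal (norm (T x - w) powr l) * indicator (ball c r) x
        \<le> ennreal (2 powr l) * (ennreal (enn2real (Nr x) powr l) * indicator (ball c r) x
            + ennreal ((S * W c r) powr l) * indicator (ball c r) x)"
        using pw
      proof eventually_elim
        case (elim x)
        show ?case
        proof (cases "x \<in> ball c r")
          case True
          then have "ennreal (norm (T x - w) powr l) \<le> ennreal (2 powr l * (enn2real (Nr x) powr l + (S * W c r) powr l))"
            using elim by (intro ennreal_leI) auto
          then show ?thesis using True by (simp add: ennreal_mult ennreal_plus)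
        qed simp
      qed
    qed
    also have "\<dots> = ennreal (2 powr l) * ((\<integral>\<^sup>+x\<in>ball c r. ennreal (enn2real (Nr x) powr l) \<partial>lborel)
        + ennreal ((S * W c r) powr l) * emeasure lborel (ball c r))"
      by (simp add: nn_integral_cmult nn_integral_add nn_integral_cmult_indicator)
    also have "\<dots> \<le> ennreal (2 powr l) * (ennreal ((a * W c r) powr l) * emeasure lborel (ball c r)
        + ennreal ((S * W c r) powr l) * emeasure lborel (ball c r))"
      unfolding Nr_def by (intro mult_left_mono add_mono near r) auto
    also have "\<dots> = ennreal (2 powr l * ((a * W c r) powr l + (S * W c r) powr l)) * emeasure lborel (ball c r)"
      by (simp add: ennreal_mult ennreal_plus distrib_right mult.assoc)
    finally show ?thesis by blast
  qed
qed

section \<open>Campanato norms from mean oscillations\<close>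

lemma set_nn_integral_Jensen_bound:
  fixes g :: "'a \<Rightarrow> real"
  assumes [measurable]: "g \<in> borel_measurable M" "S \<in> sets M" and g: "\<And>x. 0 \<le> g x"
    and \<mu>: "emeasure M S = ennreal \<mu>" "0 < \<mu>" and \<sigma>: "1 \<le> \<sigma>" and X: "0 \<le> X"
    and I: "(\<integral>\<^sup>+x\<in>S. ennreal (g x powr \<sigma>) \<partial>M) \<le> ennreal (X powr \<sigma>)"
  shows "(\<integral>\<^sup>+x\<in>S. ennreal (g x) \<partial>M) \<le> ennreal (X * \<mu> powr (1 - 1 / \<sigma>))"
proof (cases "\<sigma> = 1")
  case True
  then show ?thesis using I X \<mu> g by simp
next
  case False
  then have \<sigma>1: "1 < \<sigma>" using \<sigma> by simp
  define \<sigma>' where "\<sigma>' = \<sigma> / (\<sigma> - 1)"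
  have \<sigma>': "1 < \<sigma>'" "1 / \<sigma> + 1 / \<sigma>' = 1" "1 - 1 / \<sigma> = 1 / \<sigma>'" using \<sigma>1 by (auto simp: \<sigma>'_def field_simps)
  have "(\<integral>\<^sup>+x\<in>S. ennreal (g x * 1) \<partial>M) \<le> ennreal (X * \<mu> powr (1 / \<sigma>'))"
  proof (rule set_nn_integral_Holder_bound[OF _ _ _ _ _ \<sigma>1 \<sigma>'(1,2) _ _ I])
    show "(\<integral>\<^sup>+x\<in>S. ennreal (1 powr \<sigma>') \<partial>M) \<le> ennreal ((\<mu> powr (1 / \<sigma>')) powr \<sigma>')"
      using \<mu> \<sigma>'(1) by (simp add: powr_powr)
  qed (use g X in auto)
  then show ?thesis by (simp add: \<sigma>'(3))
qed

lemma locally_integrable_measurable: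
  fixes f :: "real^'n \<Rightarrow> 'b::{banach,second_countable_topology}"
  assumes "locally_integrable f"
  shows "f \<in> borel_measurable lebesgue"
proof (rule borel_measurable_LIMSEQ_metric)
  fix k :: nat
  have "set_integrable lebesgue (cball 0 (real k)) f"
    using assms compact_cball unfolding locally_integrable_def by blast
  then show "(\<lambda>x. indicator (cball 0 (real k)) x *\<^sub>R f x) \<in> borel_measurable lebesgue"
    unfolding set_integrable_def by (rule borel_measurable_integrable)
next
  fix x :: "real^'n"
  obtain k0 :: nat where k0: "norm x \<le> real k0" using real_arch_simple by blast
  have "eventually (\<lambda>k. indicator (cball 0 (real k)) x *\<^sub>R f x = f x) sequentially"
    using eventually_ge_at_top[of k0]
  proof eventually_elim
    case (elim k)
    then have "norm x \<le> real k" using k0 by linarith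
    then show ?case by simp
  qed
  then show "(\<lambda>k. indicator (cball 0 (real k)) x *\<^sub>R f x) \<longlonglongrightarrow> f x"
    by (rule tendsto_eventually)
qed

lemma ball_sets_lebesgue [measurable]: "ball (c::'a::euclidean_space) r \<in> sets lebesgue"
  by simp

lemma emeasure_lebesgue_ball:
  fixes c :: "real^'n"
  assumes "0 < r"
  shows "emeasure lebesgue (ball c r) = ennreal (unit_ball_vol CARD('n) * r ^ CARD('n))"
    "measure lebesgue (ball c r) = unit_ball_vol CARD('n) * r ^ CARD('n)"
    "0 < unit_ball_vol CARD('n) * r ^ CARD('n)"
  using assms by (auto simp: emeasure_ball content_ball measure_completion)

text \<open>The mean value of \<open>T\<close> over the ball differs from \<open>z\<close> by at most \<open>E c r\<close>, by Jensen's inequality. The factor 4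
  arises from \<open>2 powr l * (1 + 1) \<le> 4 powr l\<close>.\<close>

lemma campanato_from_oscillation:
  fixes T :: "real^'n \<Rightarrow> complex"
  assumes [measurable]: "T \<in> borel_measurable lebesgue" and l: "1 \<le> l" and E: "\<And>c r. 0 \<le> E c r"
    and osc: "mean_oscillation_bound l E T"
  shows "locally_integrable T"
    and "0 < r \<Longrightarrow> ball_avg c r (\<lambda>x. norm (T x - ball_mean c r T) powr l) epow (1 / l) \<le> ennreal (4 * E c r)"
proof -
  have main: "set_integrable lebesgue (ball c r) T \<and>
      ball_avg c r (\<lambda>x. norm (T x - ball_mean c r T) powr l) \<le> ennreal ((4 * E c r) powr l)"
    if r: "0 < r" for c r
  proof -
    define \<mu> where "\<mu> = unit_ball_vol CARD('n) * r ^ CARD('n)"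
    note \<mu> = emeasure_lebesgue_ball(1,2)[OF r, of c, folded \<mu>_def] emeasure_lebesgue_ball(3)[OF r, where 'n = 'n, folded \<mu>_def]
    obtain z where z: "(\<integral>\<^sup>+x\<in>ball c r. ennreal (norm (T x - z) powr l) \<partial>lebesgue) \<le> ennreal (E c r powr l) * emeasure lebesgue (ball c r)"
      using osc r unfolding mean_oscillation_bound_def nn_integral_completion by auto
    have z': "(\<integral>\<^sup>+x\<in>ball c r. ennreal (norm (T x - z) powr l) \<partial>lebesgue) \<le> ennreal ((E c r * \<mu> powr (1 / l)) powr l)"
      using z \<mu> E[of c r] l by (simp add: powr_mult powr_powr ennreal_mult)
    have z1: "(\<integral>\<^sup>+x\<in>ball c r. ennreal (norm (T x - z)) \<partial>lebesgue) \<le> ennreal (E c r * \<mu>)"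
    proof -
      have "(\<integral>\<^sup>+x\<in>ball c r. ennreal (norm (T x - z)) \<partial>lebesgue) \<le> ennreal (E c r * \<mu> powr (1 / l) * \<mu> powr (1 - 1 / l))"
        using \<mu> l E[of c r] by (intro set_nn_integral_Jensen_bound[OF _ _ _ _ _ _ _ z']) auto
      also have "E c r * \<mu> powr (1 / l) * \<mu> powr (1 - 1 / l) = E c r * (\<mu> powr (1 / l) * \<mu> powr (1 - 1 / l))" by simp
      also have "\<mu> powr (1 / l) * \<mu> powr (1 - 1 / l) = \<mu>" using \<mu> by (simp flip: powr_add)
      finally show ?thesis .
    qed
    have diff_int: "integrable lebesgue (\<lambda>x. indicator (ball c r) x *\<^sub>R (T x - z))"
    proof (rule integrableI_bounded)
      have "(\<integral>\<^sup>+x. ennreal (norm (indicator (ball c r) x *\<^sub>R (T x - z))) \<partial>lebesgue) = (\<integral>\<^sup>+x\<in>ball c r. ennreal (norm (T x - z)) \<partial>lebesgue)"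
        by (intro nn_integral_cong) (auto split: split_indicator)
      also have "\<dots> < \<infinity>" using z1 by (rule le_less_trans) simp
      finally show "(\<integral>\<^sup>+x. ennreal (norm (indicator (ball c r) x *\<^sub>R (T x - z))) \<partial>lebesgue) < \<infinity>" .
    qed simp
    have const_int: "integrable lebesgue (\<lambda>x. indicator (ball c r) x *\<^sub>R z)"
      using \<mu> by (intro integrable_real_indicator integrable_scaleR_left) auto
    have T_int: "set_integrable lebesgue (ball c r) T"
      unfolding set_integrable_def
      using Bochner_Integration.integrable_add[OF diff_int const_int] by (simp add: scaleR_diff_right)
    define t where "t = ball_mean c r T"
    have "(LINT x:ball c r|lebesgue. T x) = (LINT x|lebesgue. indicator (ball c r) x *\<^sub>R (T x - z)) + (LINT x|lebesgue. indicator (ball c r) x *\<^sub>R z)"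
      unfolding set_lebesgue_integral_def
      by (subst Bochner_Integration.integral_add[OF diff_int const_int, symmetric]) (simp add: scaleR_diff_right)
    also have "(LINT x|lebesgue. indicator (ball c r) x *\<^sub>R z) = of_real \<mu> * z"
      using \<mu> by (subst integral_scaleR_left) (auto simp: scaleR_conv_of_real integrable_real_indicator)
    finally have tz: "of_real \<mu> * (t - z) = (LINT x|lebesgue. indicator (ball c r) x *\<^sub>R (T x - z))"
      using \<mu> by (simp add: t_def ball_mean_def field_simps)
    have "ennreal (norm (of_real \<mu> * (t - z))) \<le> (\<integral>\<^sup>+x. ennreal (norm (indicator (ball c r) x *\<^sub>R (T x - z))) \<partial>lebesgue)"
      unfolding tz by (rule integral_norm_bound_ennreal[OF diff_int])
    also have "\<dots> = (\<integral>\<^sup>+x\<in>ball c r. ennreal (norm (T x - z)) \<partial>lebesgue)"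
      by (intro nn_integral_cong) (auto split: split_indicator)
    also note z1
    finally have "\<mu> * norm (t - z) \<le> \<mu> * E c r"
      using \<mu> E[of c r] by (simp add: norm_mult mult.commute)
    then have tE: "norm (t - z) \<le> E c r" using \<mu> by simp
    have "(\<integral>\<^sup>+x\<in>ball c r. ennreal (norm (T x - t) powr l) \<partial>lebesgue)
       \<le> (\<integral>\<^sup>+x. ennreal (2 powr l) * (ennreal (norm (T x - z) powr l) * indicator (ball c r) x + ennreal (E c r powr l) * indicator (ball c r) x) \<partial>lebesgue)"
    proof (rule nn_integral_mono)
      fix x
      have "norm (T x - t) powr l \<le> 2 powr l * (norm (T x - z) powr l + E c r powr l)"
      proof -
        have "norm (T x - t) powr l \<le> (norm (T x - z) + E c r) powr l"
          using norm_triangle_ineq[of "T x - z" "z - t"] tE l by (intro powr_mono2) (auto simp: norm_minus_commute)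
        also have "\<dots> \<le> 2 powr l * (norm (T x - z) powr l + E c r powr l)"
          using l E[of c r] by (intro powr_add_le_two_powr) auto
        finally show ?thesis .
      qed
      then have "ennreal (norm (T x - t) powr l) \<le> ennreal (2 powr l * (norm (T x - z) powr l + E c r powr l))"
        by (rule ennreal_leI)
      then show "ennreal (norm (T x - t) powr l) * indicator (ball c r) x
        \<le> ennreal (2 powr l) * (ennreal (norm (T x - z) powr l) * indicator (ball c r) x + ennreal (E c r powr l) * indicator (ball c r) x)"
        by (auto simp: ennreal_mult ennreal_plus split: split_indicator)
    qed
    also have "\<dots> = ennreal (2 powr l) * ((\<integral>\<^sup>+x\<in>ball c r. ennreal (norm (T x - z) powr l) \<partial>lebesgue) + ennreal (E c r powr l) * emeasure lebesgue (ball c r))"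
      by (simp add: nn_integral_cmult nn_integral_add nn_integral_cmult_indicator)
    also have "\<dots> \<le> ennreal (2 powr l) * (ennreal (E c r powr l) * emeasure lebesgue (ball c r) + ennreal (E c r powr l) * emeasure lebesgue (ball c r))"
      by (intro mult_left_mono add_right_mono z) auto
    also have "\<dots> = ennreal (2 powr l * (E c r powr l + E c r powr l) * \<mu>)"
      using \<mu> by (simp add: ennreal_mult[symmetric] flip: ennreal_plus)
    also have "\<dots> \<le> ennreal ((4 * E c r) powr l * \<mu>)"
    proof (intro ennreal_leI mult_right_mono)
      have "(4::real) powr l = 2 powr l * 2 powr l" by (simp flip: powr_mult)
      moreover have "2 \<le> (2::real) powr l" using powr_mono[of 1 l 2] l by simp
      ultimately show "2 powr l * (E c r powr l + E c r powr l) \<le> (4 * E c r) powr l"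
        using E[of c r] by (simp add: powr_mult mult_right_mono)
    qed (use \<mu> in simp)
    finally have "ball_avg c r (\<lambda>x. norm (T x - t) powr l) \<le> ennreal ((4 * E c r) powr l * \<mu>) / ennreal \<mu>"
      unfolding ball_avg_def \<mu>(1) by (intro divide_right_mono_ennreal)
    also have "\<dots> = ennreal ((4 * E c r) powr l)" using \<mu>(3) by (simp add: divide_ennreal)
    finally show ?thesis using T_int by (simp add: t_def)
  qed
  show "locally_integrable T"
    unfolding locally_integrable_def
  proof (intro allI impI)
    fix K :: "(real^'n) set" assume K: "compact K"
    obtain r where r: "0 < r" "K \<subseteq> ball 0 r"
      using compact_imp_bounded[OF K] bounded_subset_ballD[of K 0] by blast
    have "K \<in> sets lebesgue" using K by (simp add: borel_compact)
    then show "T absolutely_integrable_on K" using main[OF r(1), of 0] r(2) set_integrable_subset by blast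
  qed
  assume r: "0 < r"
  define A where "A = ball_avg c r (\<lambda>x. norm (T x - ball_mean c r T) powr l)"
  have "A \<le> ennreal ((4 * E c r) powr l)" using main[OF r] by (simp add: A_def)
  then obtain t where t: "0 \<le> t" "A = ennreal t" by (cases A) (auto simp: top_unique)
  then have "t powr (1 / l) \<le> ((4 * E c r) powr l) powr (1 / l)"
    using \<open>A \<le> _\<close> l by (intro powr_mono2) auto
  also have "\<dots> = 4 * E c r" using l E[of c r] by (simp add: powr_powr)
  finally show "A epow (1 / l) \<le> ennreal (4 * E c r)" using t by (simp add: epow_def ennreal_leI)
qed

lemma nn_integral_ball_pos:
  fixes u :: "real^'n \<Rightarrow> real"
  assumes [measurable]: "u \<in> borel_measurable lebesgue" and pos: "AE x in lebesgue. 0 < u x" and r: "0 < r"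
  shows "(\<integral>\<^sup>+x\<in>ball c r. ennreal (u x) \<partial>lebesgue) \<noteq> 0"
proof
  assume "(\<integral>\<^sup>+x\<in>ball c r. ennreal (u x) \<partial>lebesgue) = 0"
  then have "AE x in lebesgue. ennreal (u x) * indicator (ball c r) x = 0"
    by (subst (asm) nn_integral_0_iff_AE) auto
  then have "AE x in lebesgue. x \<notin> ball c r"
    using pos by eventually_elim (auto simp: ennreal_eq_0_iff split: split_indicator_asm)
  then have "ball c r \<in> null_sets lebesgue"
    by (subst (asm) AE_iff_null_sets[symmetric]) auto
  then show False using emeasure_lebesgue_ball(1)[OF r, of c] emeasure_lebesgue_ball(3)[OF r, where 'n = 'n] by (auto simp: null_sets_def ennreal_eq_0_iff)
qed

section \<open>Consequences of the weight condition\<close>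

lemma epow_ennreal: "0 \<le> t \<Longrightarrow> ennreal t epow a = ennreal (t powr a)"
  by (simp add: epow_def)

lemma epow_eq_0_iff: "x epow a = 0 \<longleftrightarrow> x = 0"
  by (cases x) (auto simp: epow_def ennreal_eq_0_iff)

lemma ennreal_divide_pos:
  assumes "0 < \<mu>" shows "ennreal t / ennreal \<mu> = ennreal (t / \<mu>)"
  using assms by (cases "0 \<le> t") (auto simp: divide_ennreal ennreal_neg divide_nonpos_pos not_le)

text \<open>Hoelder's inequality between \<open>L\<^sup>p\<close> with weight \<open>\<omega> powr p\<close> and \<open>L\<^sup>\<sigma>\<close>, with the dual power of the
  weight already eliminated by the class condition. Here \<open>V c r\<close> stands for the integral of \<open>\<omega> powr q\<close> over
  the ball. The cases \<open>\<sigma> < p\<close> and \<open>\<sigma> = p\<close> of the class condition lead to the same formula.\<close>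

definition weighted_test :: "(real^'n \<Rightarrow> real) \<Rightarrow> real \<Rightarrow> real \<Rightarrow> real \<Rightarrow> real \<Rightarrow> (real^'n \<Rightarrow> real \<Rightarrow> real) \<Rightarrow> bool" where
  "weighted_test \<omega> \<sigma> p q C0 V \<longleftrightarrow> (\<forall>c r g X. 0 < r \<longrightarrow> g \<in> borel_measurable lebesgue \<longrightarrow> (\<forall>x. 0 \<le> g x) \<longrightarrow> 0 \<le> X \<longrightarrow>
      (\<integral>\<^sup>+x\<in>ball c r. ennreal (g x powr p * \<omega> x powr p) \<partial>lebesgue) \<le> ennreal (X powr p) \<longrightarrow>
      (\<integral>\<^sup>+x\<in>ball c r. ennreal (g x powr \<sigma>) \<partial>lebesgue)
        \<le> ennreal (C0 * X powr \<sigma> * (unit_ball_vol CARD('n) * r ^ CARD('n)) powr (1 - \<sigma> / p) *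
             (unit_ball_vol CARD('n) * r ^ CARD('n) / V c r) powr (\<sigma> / q)))"

text \<open>The condition bounds a product of two averages. The first one is that of \<open>\<omega> powr q\<close> and is positive, so the
  second one, \<open>Z\<close>, is at most \<open>C0 * (\<mu> r / V c r) powr (\<sigma> / q)\<close>; conversely \<open>Z\<close> is positive, hence \<open>V c r\<close> is finite.
  The remaining step is Hoelder's inequality for the factors \<open>(g * \<omega>) powr \<sigma>\<close> and \<open>\<omega> powr - \<sigma>\<close>.\<close>

lemma A_class_testing:
  fixes \<omega> :: "real^'n \<Rightarrow> real"
  assumes \<omega>: "weight \<omega>" "(\<lambda>x. \<omega> x powr \<sigma>) \<in> A_class (p / \<sigma>) (q / \<sigma>)"
    and e: "0 < \<sigma>" "\<sigma> \<le> p" "p < q"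
  obtains C0 :: real and V :: "real^'n \<Rightarrow> real \<Rightarrow> real" where "0 < C0"
    "\<And>c r. 0 < r \<Longrightarrow> 0 < V c r" "\<And>c r. 0 < r \<Longrightarrow> wmeas (\<lambda>x. \<omega> x powr q) (ball c r) = ennreal (V c r)"
    "weighted_test \<omega> \<sigma> p q C0 V"
proof -
  define \<mu> where "\<mu> r = unit_ball_vol CARD('n) * r ^ CARD('n)" for r :: real
  have \<omega>m [measurable]: "\<omega> \<in> borel_measurable lebesgue"
    using \<omega>(1) by (intro locally_integrable_measurable) (simp add: weight_def)
  have \<omega>0: "0 \<le> \<omega> x" and \<omega>pos: "AE x in lebesgue. 0 < \<omega> x" for x using \<omega>(1) by (auto simp: weight_def)
  define a where "a = p / \<sigma>"
  define a' where "a' = enn2real (conj_exp (ennreal a))"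
  define Y where "Y c r = wmeas (\<lambda>x. \<omega> x powr q) (ball c r)" for c r
  define Z where "Z c r = (if a = 1 then esssup (restrict_space lebesgue (ball c r)) (\<lambda>x. ennreal (1 / \<omega> x powr \<sigma>))
      else ball_avg c r (\<lambda>x. (\<omega> x powr \<sigma>) powr - a') epow (1 / a'))" for c r
  have a1: "1 \<le> a" "a \<noteq> 1 \<Longrightarrow> 1 < a" using e by (auto simp: a_def)
  have a'_eq: "a' = a / (a - 1)" "1 < a'" "1 / a + 1 / a' = 1" "1 / a' = 1 - \<sigma> / p" if "a \<noteq> 1"
  proof -
    show eq: "a' = a / (a - 1)" using a1 that by (simp add: a'_def conj_exp_real)
    show "1 < a'" "1 / a + 1 / a' = 1" using a1 that unfolding eq by (auto simp: field_simps)
    then show "1 / a' = 1 - \<sigma> / p" by (simp add: a_def)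
  qed
  have q0: "0 < q" using e by linarith
  have wb: "(\<omega> x powr \<sigma>) powr (q / \<sigma>) = \<omega> x powr q" for x using e by (simp add: powr_powr)
  have \<mu>: "0 < \<mu> r" "emeasure lebesgue (ball c r) = ennreal (\<mu> r)" if "0 < r" for r and c :: "real^'n"
    using emeasure_lebesgue_ball[OF that] by (auto simp: \<mu>_def)
  obtain C0 where C0: "0 < C0" "\<And>c r. 0 < r \<Longrightarrow> (Y c r / ennreal (\<mu> r)) epow (\<sigma> / q) * Z c r \<le> ennreal C0"
  proof -
    obtain C where C: "C > 0" "\<And>c r. r > 0 \<Longrightarrow>
      ball_avg c r (\<lambda>x. (\<omega> x powr \<sigma>) powr (q / \<sigma>)) epow (1 / (q / \<sigma>)) * Z c r \<le> ennreal C"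
      using \<omega>(2) unfolding A_class_def Z_def a'_def a_def Let_def by blast
    show ?thesis
    proof (rule that[OF C(1)])
      fix c r assume r: "(0::real) < r"
      show "(Y c r / ennreal (\<mu> r)) epow (\<sigma> / q) * Z c r \<le> ennreal C"
        using C(2)[OF r, of c] unfolding wb by (simp add: Y_def wmeas_def ball_avg_def \<mu>[OF r])
    qed
  qed
  have Y0: "Y c r \<noteq> 0" if r: "0 < r" for c r
    unfolding Y_def wmeas_def using \<omega>pos by (intro nn_integral_ball_pos r) (auto elim: eventually_mono)
  have Z0: "Z c r \<noteq> 0" if r: "0 < r" for c r
  proof (cases "a = 1")
    case True
    show ?thesis
    proof
      assume "Z c r = 0"
      then have "AE x in restrict_space lebesgue (ball c r). ennreal (1 / \<omega> x powr \<sigma>) \<le> 0"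
        using esssup_AE[of "\<lambda>x. ennreal (1 / \<omega> x powr \<sigma>)" "restrict_space lebesgue (ball c r)"] True
        by (simp add: Z_def)
      then have "AE x in lebesgue. x \<in> ball c r \<longrightarrow> ennreal (1 / \<omega> x powr \<sigma>) \<le> 0"
        by (subst (asm) AE_restrict_space_iff) auto
      then have "AE x in lebesgue. ennreal (1 / \<omega> x powr \<sigma>) * indicator (ball c r) x = 0"
        by eventually_elim (auto split: split_indicator)
      then have "(\<integral>\<^sup>+x\<in>ball c r. ennreal (1 / \<omega> x powr \<sigma>) \<partial>lebesgue) = (\<integral>\<^sup>+x. 0 \<partial>(lebesgue :: (real^'n) measure))"
        by (rule nn_integral_cong_AE)
      moreover have "(\<integral>\<^sup>+x\<in>ball c r. ennreal (1 / \<omega> x powr \<sigma>) \<partial>lebesgue) \<noteq> 0"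
        using \<omega>pos by (intro nn_integral_ball_pos r) (auto elim: eventually_mono)
      ultimately show False by simp
    qed
  next
    case False
    have "(\<integral>\<^sup>+x\<in>ball c r. ennreal ((\<omega> x powr \<sigma>) powr - a') \<partial>lebesgue) \<noteq> 0"
      using \<omega>pos by (intro nn_integral_ball_pos r) (auto elim: eventually_mono)
    then show ?thesis
      using False \<mu>(1)[OF r] \<mu>(2)[OF r, of c] by (simp add: Z_def epow_eq_0_iff ball_avg_def ennreal_divide_eq_0_iff)
  qed
  define V where "V c r = enn2real (Y c r)" for c r
  have Yfin: "Y c r \<noteq> \<infinity>" if r: "0 < r" for c r
  proof
    assume "Y c r = \<infinity>"
    then have "(Y c r / ennreal (\<mu> r)) epow (\<sigma> / q) * Z c r = \<infinity>"
      using Z0[OF r, of c] by (simp add: epow_def ennreal_top_divide ennreal_top_mult)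
    then show False using C0(2)[OF r, of c] by (simp add: top_unique)
  qed
  have V: "Y c r = ennreal (V c r)" "0 < V c r" if r: "0 < r" for c r
    using Yfin[OF r, of c] Y0[OF r, of c] unfolding V_def by (cases "Y c r"; auto simp: ennreal_eq_0_iff)+
  have Zle: "Z c r \<le> ennreal (C0 * (\<mu> r / V c r) powr (\<sigma> / q))" if r: "0 < r" for c r
  proof -
    define k where "k = (V c r / \<mu> r) powr (\<sigma> / q)"
    have k: "0 < k" using V[OF r, of c] \<mu>[OF r] by (simp add: k_def)
    have "(Y c r / ennreal (\<mu> r)) epow (\<sigma> / q) = ennreal k"
      using V[OF r, of c] \<mu>(1)[OF r] by (simp add: k_def epow_ennreal ennreal_divide_pos)
    then have le: "ennreal k * Z c r \<le> ennreal C0" using C0(2)[OF r, of c] by simp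
    have "Z c r \<noteq> \<infinity>"
    proof
      assume "Z c r = \<infinity>"
      then have "ennreal k * Z c r = \<infinity>" using k by (simp add: ennreal_mult_top)
      then show False using le by (simp add: top_unique)
    qed
    then obtain \<zeta> where \<zeta>: "0 \<le> \<zeta>" "Z c r = ennreal \<zeta>" by (cases "Z c r") auto
    then have "k * \<zeta> \<le> C0" using le k C0(1) by (simp add: ennreal_mult[symmetric])
    then have "\<zeta> \<le> C0 / k" using k by (simp add: field_simps)
    also have "C0 / k = C0 * (\<mu> r / V c r) powr (\<sigma> / q)"
      using V[OF r, of c] \<mu>[OF r] by (simp add: k_def powr_divide)
    finally show ?thesis using \<zeta> by (simp add: ennreal_leI)
  qed
  show ?thesis
  proof (rule that[of C0 V])
    show "0 < C0" by fact
    show "0 < V c r" if "0 < r" for c r using V that by blast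
    show "wmeas (\<lambda>x. \<omega> x powr q) (ball c r) = ennreal (V c r)" if "0 < r" for c r
      using V that by (simp add: Y_def)
    show "weighted_test \<omega> \<sigma> p q C0 V"
      unfolding weighted_test_def \<mu>_def[symmetric]
    proof (intro allI impI)
      fix c :: "real^'n" and r X :: real and g :: "real^'n \<Rightarrow> real"
      assume r: "0 < r" and gm: "g \<in> borel_measurable lebesgue" and g: "\<forall>x. 0 \<le> g x" and X: "0 \<le> X"
        and I: "(\<integral>\<^sup>+x\<in>ball c r. ennreal (g x powr p * \<omega> x powr p) \<partial>lebesgue) \<le> ennreal (X powr p)"
      note [measurable] = gm
      define \<zeta> where "\<zeta> = C0 * (\<mu> r / V c r) powr (\<sigma> / q)"
      have \<zeta>0: "0 \<le> \<zeta>" using C0(1) by (simp add: \<zeta>_def)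
      have Z\<zeta>: "Z c r \<le> ennreal \<zeta>" using Zle[OF r] by (simp add: \<zeta>_def)
      have "(\<integral>\<^sup>+x\<in>ball c r. ennreal (g x powr \<sigma>) \<partial>lebesgue) \<le> ennreal (X powr \<sigma> * (\<zeta> * \<mu> r powr (1 - \<sigma> / p)))"
      proof (cases "a = 1")
        case True
        then have p\<sigma>: "p = \<sigma>" using e by (simp add: a_def)
        have "AE x in restrict_space lebesgue (ball c r). ennreal (1 / \<omega> x powr \<sigma>) \<le> ennreal \<zeta>"
          using esssup_AE[of "\<lambda>x. ennreal (1 / \<omega> x powr \<sigma>)" "restrict_space lebesgue (ball c r)"] True Z\<zeta>
          by (auto simp: Z_def elim!: eventually_mono)
        then have ae: "AE x in lebesgue. x \<in> ball c r \<longrightarrow> 1 / \<omega> x powr \<sigma> \<le> \<zeta>"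
          using \<zeta>0 by (subst (asm) AE_restrict_space_iff) auto
        have "(\<integral>\<^sup>+x\<in>ball c r. ennreal (g x powr \<sigma>) \<partial>lebesgue)
           \<le> (\<integral>\<^sup>+x. ennreal \<zeta> * (ennreal (g x powr p * \<omega> x powr p) * indicator (ball c r) x) \<partial>lebesgue)"
        proof (rule nn_integral_mono_AE)
          show "AE x in lebesgue. ennreal (g x powr \<sigma>) * indicator (ball c r) x
            \<le> ennreal \<zeta> * (ennreal (g x powr p * \<omega> x powr p) * indicator (ball c r) x)"
            using ae \<omega>pos
          proof eventually_elim
            case (elim x)
            show ?case
            proof (cases "x \<in> ball c r")
              case True
              then have "1 \<le> \<zeta> * \<omega> x powr \<sigma>" using elim by (simp add: field_simps)
              then have "g x powr \<sigma> * 1 \<le> g x powr \<sigma> * (\<zeta> * \<omega> x powr \<sigma>)" by (intro mult_left_mono) auto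
              then have "ennreal (g x powr \<sigma>) \<le> ennreal (\<zeta> * (g x powr p * \<omega> x powr p))"
                unfolding p\<sigma> by (intro ennreal_leI) (simp add: mult_ac)
              then show ?thesis using True \<zeta>0 by (simp add: ennreal_mult)
            qed simp
          qed
        qed
        also have "\<dots> = ennreal \<zeta> * (\<integral>\<^sup>+x\<in>ball c r. ennreal (g x powr p * \<omega> x powr p) \<partial>lebesgue)"
          by (rule nn_integral_cmult) measurable
        also have "\<dots> \<le> ennreal \<zeta> * ennreal (X powr p)" by (intro mult_left_mono I) auto
        also have "\<dots> = ennreal (X powr \<sigma> * (\<zeta> * \<mu> r powr (1 - \<sigma> / p)))"
          using \<zeta>0 \<mu>(1)[OF r] e by (simp add: p\<sigma> ennreal_mult[symmetric] mult.commute)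
        finally show ?thesis .
      next
        case False
        note a' = a'_eq[OF False]
        define h where "h x = \<omega> x powr - \<sigma>" for x
        have hpow: "h x powr a' = (\<omega> x powr \<sigma>) powr - a'" for x by (simp add: h_def powr_powr)
        have [measurable]: "h \<in> borel_measurable lebesgue" unfolding h_def by measurable
        have hI: "(\<integral>\<^sup>+x\<in>ball c r. ennreal (h x powr a') \<partial>lebesgue) \<le> ennreal ((\<zeta> * \<mu> r powr (1 / a')) powr a')"
        proof -
          define J where "J = (\<integral>\<^sup>+x\<in>ball c r. ennreal (h x powr a') \<partial>lebesgue)"
          have "Z c r = (J / ennreal (\<mu> r)) epow (1 / a')"
            using False \<mu>(2)[OF r, of c] by (simp add: Z_def ball_avg_def J_def hpow)
          then have le: "(J / ennreal (\<mu> r)) epow (1 / a') \<le> ennreal \<zeta>" using Z\<zeta> by simp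
          have "J \<noteq> \<infinity>"
          proof
            assume "J = \<infinity>"
            then have "(J / ennreal (\<mu> r)) epow (1 / a') = \<infinity>" by (simp add: epow_def ennreal_top_divide)
            then show False using le by (simp add: top_unique)
          qed
          then obtain t where t: "0 \<le> t" "J = ennreal t" by (cases J) auto
          then have "(t / \<mu> r) powr (1 / a') \<le> \<zeta>"
            using le \<mu>(1)[OF r] \<zeta>0 by (simp add: ennreal_divide_pos epow_ennreal)
          then have "((t / \<mu> r) powr (1 / a')) powr a' \<le> \<zeta> powr a'" using a' by (intro powr_mono2) auto
          then have "t / \<mu> r \<le> \<zeta> powr a'" using a'(2) t \<mu>(1)[OF r] by (simp add: powr_powr)
          then have "t \<le> \<zeta> powr a' * \<mu> r" using \<mu>(1)[OF r] by (simp add: field_simps)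
          also have "\<dots> = (\<zeta> * \<mu> r powr (1 / a')) powr a'"
            using a'(2) \<zeta>0 \<mu>(1)[OF r] by (simp add: powr_mult powr_powr)
          finally show ?thesis using t by (simp add: J_def ennreal_leI)
        qed
        have "(\<integral>\<^sup>+x\<in>ball c r. ennreal (g x powr \<sigma>) \<partial>lebesgue)
           = (\<integral>\<^sup>+x\<in>ball c r. ennreal ((g x powr \<sigma> * \<omega> x powr \<sigma>) * h x) \<partial>lebesgue)"
        proof (rule nn_integral_cong_AE)
          show "AE x in lebesgue. ennreal (g x powr \<sigma>) * indicator (ball c r) x
            = ennreal ((g x powr \<sigma> * \<omega> x powr \<sigma>) * h x) * indicator (ball c r) x"
            using \<omega>pos
          proof eventually_elim
            case (elim x)
            then have "\<omega> x powr \<sigma> * h x = 1" by (simp add: h_def flip: powr_add)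
            then show ?case by (simp add: mult.assoc)
          qed
        qed
        also have "\<dots> \<le> ennreal (X powr \<sigma> * (\<zeta> * \<mu> r powr (1 / a')))"
        proof (rule set_nn_integral_Holder_bound[OF _ _ _ _ _ a1(2)[OF False] a'(2,3) _ _ _ hI])
          show "(\<integral>\<^sup>+x\<in>ball c r. ennreal ((g x powr \<sigma> * \<omega> x powr \<sigma>) powr a) \<partial>lebesgue) \<le> ennreal ((X powr \<sigma>) powr a)"
            using I e g \<omega>0 X by (simp add: powr_mult powr_powr a_def)
        qed (use \<zeta>0 in \<open>auto simp: h_def\<close>)
        finally show ?thesis by (simp only: a'(4))
      qed
      also have "X powr \<sigma> * (\<zeta> * \<mu> r powr (1 - \<sigma> / p)) = C0 * X powr \<sigma> * \<mu> r powr (1 - \<sigma> / p) * (\<mu> r / V c r) powr (\<sigma> / q)"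
        by (simp add: \<zeta>_def)
      finally show "(\<integral>\<^sup>+x\<in>ball c r. ennreal (g x powr \<sigma>) \<partial>lebesgue)
          \<le> ennreal (C0 * X powr \<sigma> * \<mu> r powr (1 - \<sigma> / p) * (\<mu> r / V c r) powr (\<sigma> / q))" .
    qed
  qed
qed

text \<open>The inequality that results from testing with the indicator of a smaller ball, solved for \<open>V'\<close>.\<close>

lemma weight_growth_algebra:
  fixes C0 M M' V V' p q \<sigma> :: real
  assumes pos: "0 < M" "0 < M'" "0 < V" "0 < V'" "0 < C0" and e: "0 < \<sigma>" "0 < q"
    and le: "M \<le> C0 * (V powr (1 / q) * M powr (1 / p - 1 / q)) powr \<sigma> * M' powr (1 - \<sigma> / p) * (M' / V') powr (\<sigma> / q)"
  shows "V' \<le> C0 powr (q / \<sigma>) * (M' / M) powr (1 + q / \<sigma> - q / p) * V"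
proof -
  define k where "k = 1 - \<sigma> / p + \<sigma> / q"
  have "(V powr (1 / q) * M powr (1 / p - 1 / q)) powr \<sigma> = V powr (\<sigma> / q) * M powr (1 - k)"
    using pos by (simp add: powr_mult powr_powr k_def algebra_simps)
  moreover have "M' powr (1 - \<sigma> / p) * (M' / V') powr (\<sigma> / q) = M' powr k / V' powr (\<sigma> / q)"
    using pos by (simp add: powr_divide k_def powr_add)
  ultimately have "M \<le> C0 * V powr (\<sigma> / q) * M powr (1 - k) * (M' powr k / V' powr (\<sigma> / q))"
    using le by (simp add: mult.assoc)
  also have "M powr (1 - k) = M / M powr k" using pos by (simp add: powr_diff)
  finally have "M * (M powr k * V' powr (\<sigma> / q)) \<le> M * (C0 * V powr (\<sigma> / q) * M' powr k)"
    using pos by (simp add: field_simps)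
  then have "M powr k * V' powr (\<sigma> / q) \<le> C0 * V powr (\<sigma> / q) * M' powr k" using pos by simp
  then have "V' powr (\<sigma> / q) \<le> C0 * V powr (\<sigma> / q) * (M' / M) powr k"
    using pos by (simp add: powr_divide field_simps)
  then have "(V' powr (\<sigma> / q)) powr (q / \<sigma>) \<le> (C0 * V powr (\<sigma> / q) * (M' / M) powr k) powr (q / \<sigma>)"
    using e by (intro powr_mono2) auto
  also have "(V' powr (\<sigma> / q)) powr (q / \<sigma>) = V'" using e pos by (simp add: powr_powr)
  also have "(C0 * V powr (\<sigma> / q) * (M' / M) powr k) powr (q / \<sigma>)
      = C0 powr (q / \<sigma>) * (V powr (\<sigma> / q)) powr (q / \<sigma>) * ((M' / M) powr k) powr (q / \<sigma>)"
    using pos by (simp add: powr_mult)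
  also have "(V powr (\<sigma> / q)) powr (q / \<sigma>) = V" using e pos by (simp add: powr_powr)
  also have "((M' / M) powr k) powr (q / \<sigma>) = (M' / M) powr (1 + q / \<sigma> - q / p)"
  proof -
    have "k * (q / \<sigma>) = 1 + q / \<sigma> - q / p" using e by (simp add: k_def field_simps)
    then show ?thesis by (simp only: powr_powr)
  qed
  finally show ?thesis by (simp add: mult_ac)
qed

text \<open>The testing inequality on the large ball is applied to the indicator function of the small one; the
  integral of \<open>\<omega> powr p\<close> over the small ball is estimated by \<open>V c r\<close> with Jensen's inequality.\<close>

lemma A_class_growth:
  fixes V :: "real^'n \<Rightarrow> real \<Rightarrow> real" and \<omega> :: "real^'n \<Rightarrow> real"
  defines "\<mu> \<equiv> \<lambda>r. unit_ball_vol CARD('n) * r ^ CARD('n)"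
  assumes \<omega>: "weight \<omega>" and e: "0 < \<sigma>" "\<sigma> \<le> p" "p < q" and C0: "0 < C0"
    and V: "\<And>c r. 0 < r \<Longrightarrow> 0 < V c r" "\<And>c r. 0 < r \<Longrightarrow> wmeas (\<lambda>x. \<omega> x powr q) (ball c r) = ennreal (V c r)"
    and test: "weighted_test \<omega> \<sigma> p q C0 V"
    and r: "0 < r" and \<Lambda>: "1 \<le> \<Lambda>"
  shows "V c (\<Lambda> * r) \<le> C0 powr (q / \<sigma>) * \<Lambda> powr (real CARD('n) * (1 + q / \<sigma> - q / p)) * V c r"
proof -
  have [measurable]: "\<omega> \<in> borel_measurable lebesgue"
    using \<omega> by (intro locally_integrable_measurable) (simp add: weight_def)
  have p0: "0 < p" "0 < q" using e by auto
  have \<mu>: "0 < \<mu> \<rho>" "emeasure lebesgue (ball c' \<rho>) = ennreal (\<mu> \<rho>)" if "0 < \<rho>" for \<rho> and c' :: "real^'n"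
    using emeasure_lebesgue_ball[OF that] by (auto simp: \<mu>_def)
  have \<Lambda>r: "0 < \<Lambda> * r" "r \<le> \<Lambda> * r" using r \<Lambda> by auto
  define X where "X = V c r powr (1 / q) * \<mu> r powr (1 / p - 1 / q)"
  have "(\<integral>\<^sup>+x\<in>ball c r. ennreal (\<omega> x powr p) \<partial>lebesgue) \<le> ennreal (V c r powr (p / q) * \<mu> r powr (1 - 1 / (q / p)))"
  proof (rule set_nn_integral_Jensen_bound)
    show "(\<integral>\<^sup>+x\<in>ball c r. ennreal ((\<omega> x powr p) powr (q / p)) \<partial>lebesgue) \<le> ennreal ((V c r powr (p / q)) powr (q / p))"
      using V(1)[OF r, of c] V(2)[OF r, of c] p0 by (simp add: powr_powr wmeas_def)
  qed (use \<mu>[OF r] e p0 in \<open>auto simp: field_simps\<close>)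
  also have "V c r powr (p / q) * \<mu> r powr (1 - 1 / (q / p)) = X powr p"
    using V(1)[OF r, of c] \<mu>(1)[OF r] p0 by (simp add: X_def powr_mult powr_powr left_diff_distrib)
  finally have XI: "(\<integral>\<^sup>+x\<in>ball c r. ennreal (\<omega> x powr p) \<partial>lebesgue) \<le> ennreal (X powr p)" .
  have "(\<integral>\<^sup>+x\<in>ball c (\<Lambda> * r). ennreal ((indicator (ball c r) x :: real) powr \<sigma>) \<partial>lebesgue)
    \<le> ennreal (C0 * X powr \<sigma> * \<mu> (\<Lambda> * r) powr (1 - \<sigma> / p) * (\<mu> (\<Lambda> * r) / V c (\<Lambda> * r)) powr (\<sigma> / q))"
    unfolding \<mu>_def
  proof (rule test[unfolded weighted_test_def, rule_format, OF \<Lambda>r(1)])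
    have "(\<integral>\<^sup>+x\<in>ball c (\<Lambda> * r). ennreal ((indicator (ball c r) x :: real) powr p * \<omega> x powr p) \<partial>lebesgue)
       = (\<integral>\<^sup>+x\<in>ball c r. ennreal (\<omega> x powr p) \<partial>lebesgue)"
      using \<Lambda>r p0 by (intro nn_integral_cong) (auto split: split_indicator)
    then show "(\<integral>\<^sup>+x\<in>ball c (\<Lambda> * r). ennreal ((indicator (ball c r) x :: real) powr p * \<omega> x powr p) \<partial>lebesgue) \<le> ennreal (X powr p)"
      using XI by simp
  qed (auto simp: X_def)
  moreover have "(\<integral>\<^sup>+x\<in>ball c (\<Lambda> * r). ennreal ((indicator (ball c r) x :: real) powr \<sigma>) \<partial>lebesgue) = ennreal (\<mu> r)"
  proof -
    have "(\<integral>\<^sup>+x\<in>ball c (\<Lambda> * r). ennreal ((indicator (ball c r) x :: real) powr \<sigma>) \<partial>lebesgue)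
      = (\<integral>\<^sup>+x. indicator (ball c r) x \<partial>lebesgue)"
      using \<Lambda>r by (intro nn_integral_cong) (auto split: split_indicator)
    then show ?thesis using \<mu>(2)[OF r, of c] by simp
  qed
  ultimately have "ennreal (\<mu> r) \<le> ennreal (C0 * X powr \<sigma> * \<mu> (\<Lambda> * r) powr (1 - \<sigma> / p) * (\<mu> (\<Lambda> * r) / V c (\<Lambda> * r)) powr (\<sigma> / q))"
    by simp
  then have "\<mu> r \<le> C0 * X powr \<sigma> * \<mu> (\<Lambda> * r) powr (1 - \<sigma> / p) * (\<mu> (\<Lambda> * r) / V c (\<Lambda> * r)) powr (\<sigma> / q)"
    using C0 by (subst (asm) ennreal_le_iff) auto
  then have "V c (\<Lambda> * r) \<le> C0 powr (q / \<sigma>) * (\<mu> (\<Lambda> * r) / \<mu> r) powr (1 + q / \<sigma> - q / p) * V c r"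
    unfolding X_def using \<mu>(1)[OF r] \<mu>(1)[OF \<Lambda>r(1)] V(1)[OF r, of c] V(1)[OF \<Lambda>r(1), of c] C0 e p0
    by (intro weight_growth_algebra) auto
  also have "\<mu> (\<Lambda> * r) / \<mu> r = \<Lambda> powr real CARD('n)"
  proof -
    have "0 < unit_ball_vol (real CARD('n))" by (rule unit_ball_vol_pos) simp
    then have "unit_ball_vol (real CARD('n)) \<noteq> 0" by (rule less_imp_neq[symmetric])
    then show ?thesis using r \<Lambda> by (simp add: \<mu>_def power_mult_distrib powr_realpow)
  qed
  finally show ?thesis by (simp only: powr_powr)
qed

lemma morrey_norm_ball:
  assumes N: "morrey_norm p \<kappa> (\<lambda>x. \<omega> x powr p) \<nu> f \<le> ennreal N" "0 \<le> N" and p: "0 < p"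
    and V: "wmeas \<nu> (ball c r) = ennreal V" "0 < V" and r: "0 < r"
  shows "(\<integral>\<^sup>+x\<in>ball c r. ennreal (norm (f x) powr p * \<omega> x powr p) \<partial>lebesgue) \<le> ennreal ((N * V powr (\<kappa> / p)) powr p)"
proof -
  define I where "I = (\<integral>\<^sup>+x\<in>ball c r. ennreal (norm (f x) powr p * \<omega> x powr p) \<partial>lebesgue)"
  have "(I / (wmeas \<nu> (ball c r) epow \<kappa>)) epow (1 / p) \<le> morrey_norm p \<kappa> (\<lambda>x. \<omega> x powr p) \<nu> f"
    unfolding morrey_norm_def I_def using r by (intro SUP_upper2[of "(c, r)"]) auto
  also have "\<dots> \<le> ennreal N" by (rule N)
  finally have le: "(I / ennreal (V powr \<kappa>)) epow (1 / p) \<le> ennreal N" using V by (simp add: epow_ennreal)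
  have "I \<noteq> \<infinity>"
  proof
    assume "I = \<infinity>"
    then have "(I / ennreal (V powr \<kappa>)) epow (1 / p) = \<infinity>" by (simp add: epow_def ennreal_top_divide)
    then show False using le by (simp add: top_unique)
  qed
  then obtain i where i: "0 \<le> i" "I = ennreal i" by (cases I) auto
  then have "(i / V powr \<kappa>) powr (1 / p) \<le> N"
    using le V N by (simp add: ennreal_divide_pos epow_ennreal)
  then have "((i / V powr \<kappa>) powr (1 / p)) powr p \<le> N powr p" using p by (intro powr_mono2) auto
  then have "i / V powr \<kappa> \<le> N powr p" using p i V by (simp add: powr_powr)
  then have "i \<le> N powr p * V powr \<kappa>" using V by (simp add: field_simps)
  also have "\<dots> = (N * V powr (\<kappa> / p)) powr p" using N V p by (simp add: powr_mult powr_powr)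
  finally show ?thesis using i by (simp add: I_def ennreal_leI)
qed

definition local_power_bound :: "real \<Rightarrow> real \<Rightarrow> ('a::euclidean_space \<Rightarrow> real \<Rightarrow> real) \<Rightarrow> ('a \<Rightarrow> complex) \<Rightarrow> bool" where
  "local_power_bound \<sigma> b A f \<longleftrightarrow> (\<forall>c r. 0 < r \<longrightarrow>
     (\<integral>\<^sup>+y\<in>ball c r. ennreal (norm (f y) powr \<sigma>) \<partial>lborel) \<le> ennreal ((A c r * r powr b) powr \<sigma>))"

text \<open>The testing inequality applied to \<open>norm (f x)\<close>. As \<open>1 / p - 1 / q = \<alpha> / n\<close>, the powers of the volume
  of the ball combine to \<open>r powr (n / \<sigma> - \<alpha>)\<close>.\<close>

lemma morrey_local_power_bound:
  fixes f :: "real^'n \<Rightarrow> complex" and \<omega> :: "real^'n \<Rightarrow> real" and V :: "real^'n \<Rightarrow> real \<Rightarrow> real"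
  defines "n \<equiv> real CARD('n)"
  assumes N: "morrey_norm p \<kappa> (\<lambda>x. \<omega> x powr p) (\<lambda>x. \<omega> x powr q) f \<le> ennreal N" "0 \<le> N"
    and e: "0 < \<sigma>" "0 < p" "1 / q = 1 / p - \<alpha> / n" and C0: "0 < C0"
    and V: "\<And>c r. 0 < r \<Longrightarrow> 0 < V c r" "\<And>c r. 0 < r \<Longrightarrow> wmeas (\<lambda>x. \<omega> x powr q) (ball c r) = ennreal (V c r)"
    and test: "weighted_test \<omega> \<sigma> p q C0 V"
    and f: "f \<in> borel_measurable lebesgue" "AE x in lborel. f x = f' x"
  shows "local_power_bound \<sigma> (n / \<sigma> - \<alpha>)
    (\<lambda>c r. C0 powr (1 / \<sigma>) * unit_ball_vol n powr (1 / \<sigma> - \<alpha> / n) * N * V c r powr (\<kappa> / p - 1 / q)) f'"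
  unfolding local_power_bound_def
proof (intro allI impI)
  fix c :: "real^'n" and r :: real assume r: "0 < r"
  define v where "v = unit_ball_vol n"
  define \<mu> where "\<mu> = v * r ^ CARD('n)"
  define k where "k = 1 - \<sigma> * \<alpha> / n"
  have n0: "0 < n" by (simp add: n_def)
  have v: "0 < v" unfolding v_def n_def by (rule unit_ball_vol_pos) simp
  have \<mu>: "0 < \<mu>" using v r by (simp add: \<mu>_def)
  have Vr: "0 < V c r" using V(1) r by blast
  have "(\<integral>\<^sup>+y\<in>ball c r. ennreal (norm (f' y) powr \<sigma>) \<partial>lborel) = (\<integral>\<^sup>+y\<in>ball c r. ennreal (norm (f y) powr \<sigma>) \<partial>lebesgue)"
    unfolding nn_integral_completion using f(2) by (intro nn_integral_cong_AE) (auto elim: eventually_mono)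
  also have "\<dots> \<le> ennreal (C0 * (N * V c r powr (\<kappa> / p)) powr \<sigma> * \<mu> powr (1 - \<sigma> / p) * (\<mu> / V c r) powr (\<sigma> / q))"
    using f(1) N V r e(2) morrey_norm_ball[OF N e(2) V(2)[OF r] V(1)[OF r] r, of c]
    unfolding \<mu>_def v_def n_def
    by (intro test[unfolded weighted_test_def, rule_format]) auto
  also have "C0 * (N * V c r powr (\<kappa> / p)) powr \<sigma> * \<mu> powr (1 - \<sigma> / p) * (\<mu> / V c r) powr (\<sigma> / q)
      = (C0 powr (1 / \<sigma>) * v powr (1 / \<sigma> - \<alpha> / n) * N * V c r powr (\<kappa> / p - 1 / q) * r powr (n / \<sigma> - \<alpha>)) powr \<sigma>"
  proof -
    have x: "(1 / \<sigma> - \<alpha> / n) * \<sigma> = k" "(n / \<sigma> - \<alpha>) * \<sigma> = n * k" "(\<kappa> / p - 1 / q) * \<sigma> = \<sigma> * \<kappa> / p - \<sigma> / q"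
      using e(1) n0 by (auto simp: k_def algebra_simps)
    have e1: "(C0 powr (1 / \<sigma>) * v powr (1 / \<sigma> - \<alpha> / n) * N * V c r powr (\<kappa> / p - 1 / q) * r powr (n / \<sigma> - \<alpha>)) powr \<sigma>
        = C0 * v powr k * N powr \<sigma> * (V c r powr (\<sigma> * \<kappa> / p) / V c r powr (\<sigma> / q)) * r powr (n * k)"
      using C0 v N(2) Vr e(1) r by (simp only: powr_mult powr_powr x) (simp add: powr_diff)
    have "1 - \<sigma> / p + \<sigma> / q = k"
    proof -
      have "\<sigma> / q = \<sigma> * (1 / q)" by simp
      also have "\<dots> = \<sigma> / p - \<sigma> * \<alpha> / n" unfolding e(3) by (simp add: right_diff_distrib)
      finally show ?thesis by (simp add: k_def)
    qed
    then have e2: "\<mu> powr (1 - \<sigma> / p) * (\<mu> / V c r) powr (\<sigma> / q) = \<mu> powr k / V c r powr (\<sigma> / q)"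
      using \<mu> Vr by (auto simp: powr_divide powr_add)
    have "\<mu> = v * r powr n" using r by (simp add: \<mu>_def n_def powr_realpow)
    then have e3: "\<mu> powr k = v powr k * r powr (n * k)" using v r by (simp add: powr_mult powr_powr)
    have e4: "(N * V c r powr (\<kappa> / p)) powr \<sigma> = N powr \<sigma> * V c r powr (\<sigma> * \<kappa> / p)"
      using N(2) Vr by (simp add: powr_mult powr_powr mult.commute)
    show ?thesis unfolding e1 mult.assoc[of _ "\<mu> powr (1 - \<sigma> / p)"] e2 e3 e4 by simp
  qed
  finally show "(\<integral>\<^sup>+y\<in>ball c r. ennreal (norm (f' y) powr \<sigma>) \<partial>lborel)
      \<le> ennreal ((C0 powr (1 / \<sigma>) * unit_ball_vol n powr (1 / \<sigma> - \<alpha> / n) * N * V c r powr (\<kappa> / p - 1 / q) * r powr (n / \<sigma> - \<alpha>)) powr \<sigma>)"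
    unfolding v_def .
qed

section \<open>Boundedness of the operator\<close>

text \<open>For every fixed \<open>x\<close> the two integrands agree for almost every \<open>y\<close>, so the identity holds at every
  \<open>x\<close>, including the points where the integral does not converge.\<close>

lemma T_op_eq_kernel:
  fixes \<Omega> \<Omega>' :: "real^'n \<Rightarrow> complex"
  assumes bv: "borel_version \<Omega> \<Omega>'" and hom: "homogeneous_zero \<Omega>"
    and f' [measurable]: "f' \<in> borel_measurable borel" and ff': "AE x in lborel. f x = f' x"
  shows "T_op \<Omega> \<alpha> f x = convolution (kernel \<Omega>' (real CARD('n) - \<alpha>)) f' x"
proof -
  have [measurable]: "\<Omega>' \<in> borel_measurable borel" using bv by (simp add: borel_version_def)
  define G where "G y = kernel \<Omega>' (real CARD('n) - \<alpha>) (x - y) * f' y" for y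
  have Gb [measurable]: "G \<in> borel_measurable borel" unfolding G_def by measurable
  have "AE y in lborel. \<Omega> (x + (- 1) *\<^sub>R y) = \<Omega>' (x + (- 1) *\<^sub>R y)"
    by (rule AE_lborel_affine[OF borel_version_AE_lborel[OF bv hom]]) simp
  then have eq: "AE y in lborel. \<Omega> (x - y) / of_real (norm (x - y) powr (real CARD('n) - \<alpha>)) * f y = G y"
    using ff' by eventually_elim (simp add: G_def kernel_def)
  have Gm: "G \<in> borel_measurable lebesgue" using Gb by (simp add: measurable_completion)
  have eq': "AE y in lebesgue. G y = \<Omega> (x - y) / of_real (norm (x - y) powr (real CARD('n) - \<alpha>)) * f y"
    using AE_completion[OF eq] by eventually_elim simp
  have "T_op \<Omega> \<alpha> f x = (LINT y|lebesgue. G y)"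
    unfolding T_op_def using eq' by (intro integral_cong_AE borel_measurable_AE[OF Gm eq'] Gm) (auto elim: eventually_mono)
  also have "\<dots> = (LINT y|lborel. G y)" by (rule integral_completion) simp
  finally show ?thesis by (simp add: G_def convolution_def)
qed

text \<open>The near and far estimates combined. The function \<open>U\<close> stands for \<open>V powr (\<gamma> / n)\<close>, and \<open>C\<close> is chosen before
  \<open>f\<close> and \<open>N\<close>.\<close>

lemma campanato_bound:
  fixes K :: "real^'n \<Rightarrow> complex" and U :: "real^'n \<Rightarrow> real \<Rightarrow> real" and d :: "nat \<Rightarrow> real"
  defines "n \<equiv> real CARD('n)"
  assumes Km [measurable]: "K \<in> borel_measurable borel" and l: "1 \<le> l" and \<sigma>: "1 \<le> \<sigma>"
    and b: "b = m - n * (1 - 1 / \<sigma>)"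
    and M: "0 \<le> M" "\<And>R. 0 < R \<Longrightarrow> (\<integral>\<^sup>+x\<in>ball 0 R. ennreal (norm (K x) powr l) \<partial>lborel) \<le> ennreal (M * R powr (n - m * l))"
    and d: "\<And>j. 0 \<le> d j" "summable (\<lambda>j. d j * 2 powr (\<theta> * real j))"
    and smooth: "\<And>j \<rho> h. 0 < \<rho> \<Longrightarrow> norm h < 2 powr - (real j + real k0) * \<rho> \<Longrightarrow>
       annular_bound \<sigma> \<rho> (\<lambda>y. norm (K (y + h) - K y)) (d j * \<rho> powr (- b))"
    and U: "\<And>c r. 0 \<le> U c r"
    and C: "0 \<le> C2" "0 \<le> C3" "\<And>c r (j::nat). 0 < r \<Longrightarrow> U c (2 ^ j * r) \<le> C3 * 2 powr (\<theta> * real j) * U c r"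
  shows "\<exists>C\<ge>0. \<forall>f N. f \<in> borel_measurable borel \<longrightarrow> 0 \<le> N \<longrightarrow>
     local_power_bound \<sigma> b (\<lambda>c r. C2 * N * U c r) f \<longrightarrow>
     mean_oscillation_bound l (\<lambda>c r. C * (N * U c r)) (convolution K f)"
proof -
  define v where "v = unit_ball_vol n"
  have v: "0 < v" unfolding v_def n_def by (rule unit_ball_vol_pos) simp
  define \<Lambda> where "\<Lambda> = (2::real) ^ k0"
  have \<Lambda>: "1 \<le> \<Lambda>" by (simp add: \<Lambda>_def)
  define S where "S = (\<Sum>j. d j * 2 powr (\<theta> * real j)) * 2 powr (\<theta> * (real k0 + 1) + b) * (C2 * C3)"
  define C4 where "C4 = C2 * C3 * 2 powr (\<theta> * real k0) * v powr (1 - 1 / \<sigma>) * \<Lambda> powr m"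
  define Q where "Q = M * (\<Lambda> + 1) powr (n - m * l) / v"
  define a where "a = C4 * Q powr (1 / l)"
  have pos: "0 \<le> S" "0 \<le> C4" "0 \<le> a" "0 \<le> Q"
    using C(1,2) d(1) M(1) v by (auto simp: S_def C4_def a_def Q_def intro!: mult_nonneg_nonneg suminf_nonneg d(2))
  define Co where "Co = 2 * (a powr l + S powr l) powr (1 / l)"
  show ?thesis
  proof (rule exI[of _ Co], intro conjI allI impI)
    show "0 \<le> Co" by (simp add: Co_def)
    fix f :: "real^'n \<Rightarrow> complex" and N :: real
    assume f [measurable]: "f \<in> borel_measurable borel" and N: "0 \<le> N"
      and "local_power_bound \<sigma> b (\<lambda>c r. C2 * N * U c r) f"
    then have fI: "\<forall>c r. 0 < r \<longrightarrow> (\<integral>\<^sup>+y\<in>ball c r. ennreal (norm (f y) powr \<sigma>) \<partial>lborel) \<le> ennreal ((C2 * N * U c r * r powr b) powr \<sigma>)"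
      by (simp add: local_power_bound_def)
    define W where "W c r = N * U c r" for c r
    have W: "0 \<le> W c r" for c r using N U by (simp add: W_def)
    have E: "emeasure lborel (ball c r) = ennreal (v * r ^ CARD('n))" "0 < v * r ^ CARD('n)" if "0 < r" for c :: "real^'n" and r
      using that v by (auto simp: emeasure_ball v_def n_def)
    have local: "(\<integral>\<^sup>+y\<in>ball c (\<Lambda> * r). ennreal (norm (f y)) \<partial>lborel) \<le> ennreal (C4 * W c r * r powr m)"
      if r: "0 < r" for c r
    proof -
      have \<Lambda>r: "0 < \<Lambda> * r" using r \<Lambda> by simp
      have "(\<integral>\<^sup>+y\<in>ball c (\<Lambda> * r). ennreal (norm (f y)) \<partial>lborel)
         \<le> ennreal ((C2 * N * U c (\<Lambda> * r) * (\<Lambda> * r) powr b) * (v * (\<Lambda> * r) ^ CARD('n)) powr (1 - 1 / \<sigma>))"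
        using E(1)[OF \<Lambda>r, of c] E(2)[OF \<Lambda>r] \<sigma> C N U[of c "\<Lambda> * r"] fI \<Lambda>r
        by (intro set_nn_integral_Jensen_bound) auto
      also have "\<dots> \<le> ennreal (C4 * W c r * r powr m)"
      proof (rule ennreal_leI)
        have e1: "(v * (\<Lambda> * r) ^ CARD('n)) powr (1 - 1 / \<sigma>) = v powr (1 - 1 / \<sigma>) * (\<Lambda> * r) powr (n * (1 - 1 / \<sigma>))"
          using v \<Lambda>r by (simp add: powr_mult n_def powr_powr flip: powr_realpow)
        have e2: "(\<Lambda> * r) powr b * (\<Lambda> * r) powr (n * (1 - 1 / \<sigma>)) = \<Lambda> powr m * r powr m"
        proof -
          have "(\<Lambda> * r) powr b * (\<Lambda> * r) powr (n * (1 - 1 / \<sigma>)) = (\<Lambda> * r) powr m"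
            unfolding powr_add[symmetric] b by simp
          then show ?thesis using \<Lambda> r by (simp add: powr_mult)
        qed
        have "C2 * N * U c (\<Lambda> * r) * (\<Lambda> * r) powr b * (v * (\<Lambda> * r) ^ CARD('n)) powr (1 - 1 / \<sigma>)
           = C2 * N * v powr (1 - 1 / \<sigma>) * ((\<Lambda> * r) powr b * (\<Lambda> * r) powr (n * (1 - 1 / \<sigma>))) * U c (\<Lambda> * r)"
          unfolding e1 by simp
        also have "\<dots> = C2 * N * v powr (1 - 1 / \<sigma>) * (\<Lambda> powr m * r powr m) * U c (\<Lambda> * r)" unfolding e2 ..
        also have "\<dots> \<le> C2 * N * v powr (1 - 1 / \<sigma>) * (\<Lambda> powr m * r powr m) * (C3 * 2 powr (\<theta> * real k0) * U c r)"
          using C N C(3)[OF r, of c k0] unfolding \<Lambda>_def by (intro mult_left_mono) auto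
        also have "\<dots> = C4 * W c r * r powr m" by (simp add: C4_def W_def)
        finally show "C2 * N * U c (\<Lambda> * r) * (\<Lambda> * r) powr b * (v * (\<Lambda> * r) ^ CARD('n)) powr (1 - 1 / \<sigma>) \<le> C4 * W c r * r powr m" .
      qed
      finally show ?thesis .
    qed
    have nearA: "(\<integral>\<^sup>+x\<in>ball 0 (\<Lambda> * r + r). ennreal (norm (K x) powr l) \<partial>lborel) \<le> ennreal (Q * v * r powr (n - m * l))"
      if r: "0 < r" for r
    proof -
      have "(\<integral>\<^sup>+x\<in>ball 0 (\<Lambda> * r + r). ennreal (norm (K x) powr l) \<partial>lborel) \<le> ennreal (M * (\<Lambda> * r + r) powr (n - m * l))"
        using r \<Lambda> by (intro M(2)) (simp add: add_pos_pos)
      also have "M * (\<Lambda> * r + r) powr (n - m * l) = Q * v * r powr (n - m * l)"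
      proof -
        have "\<Lambda> * r + r = (\<Lambda> + 1) * r" by (simp add: algebra_simps)
        then show ?thesis using v r \<Lambda> by (simp add: powr_mult Q_def)
      qed
      finally show ?thesis .
    qed
    have nearE: "ennreal ((C4 * W c r * r powr m) powr l * (Q * v * r powr (n - m * l)))
       = ennreal ((a * W c r) powr l) * emeasure lborel (ball c r)" if r: "0 < r" for c r
    proof -
      have "(C4 * W c r * r powr m) powr l * (Q * v * r powr (n - m * l))
         = (C4 powr l * Q * W c r powr l) * (v * (r powr (m * l) * r powr (n - m * l)))"
        using pos W[of c r] by (simp add: powr_mult powr_powr)
      also have "r powr (m * l) * r powr (n - m * l) = r ^ CARD('n)"
        using r by (simp add: n_def powr_realpow flip: powr_add)
      also have "C4 powr l * Q * W c r powr l = (a * W c r) powr l"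
        using pos W[of c r] l by (simp add: a_def powr_mult powr_powr)
      finally have eq: "(C4 * W c r * r powr m) powr l * (Q * v * r powr (n - m * l)) = (a * W c r) powr l * (v * r ^ CARD('n))" .
      show ?thesis unfolding eq E(1)[OF r] by (rule ennreal_mult) (use E(2)[OF r] in auto)
    qed
    show "mean_oscillation_bound l (\<lambda>c r. Co * (N * U c r)) (convolution K f)"
      unfolding mean_oscillation_bound_def
    proof (intro allI impI)
      fix c :: "real^'n" and r :: real assume r: "0 < r"
      have "\<exists>z. (\<integral>\<^sup>+x\<in>ball c r. ennreal (norm (convolution K f x - z) powr l) \<partial>lborel)
         \<le> ennreal (2 powr l * ((a * W c r) powr l + (S * W c r) powr l)) * emeasure lborel (ball c r)"
      proof (rule singular_integral_oscillation[where \<Lambda> = \<Lambda>])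
        fix c :: "real^'n" and r :: real assume r: "0 < r"
        have I0: "0 \<le> C4 * W c r * r powr m" using pos W[of c r] by simp
        have A0: "0 \<le> Q * v * r powr (n - m * l)" using pos v by simp
        note np = near_part[OF Km _ _ l local[OF r, of c] I0 nearA[OF r] A0]
        show "(\<integral>\<^sup>+x\<in>ball c r. ennreal (enn2real (\<integral>\<^sup>+y\<in>ball c (\<Lambda> * r). ennreal (norm (K (x - y)) * norm (f y)) \<partial>lborel) powr l) \<partial>lborel)
            \<le> ennreal ((a * W c r) powr l) * emeasure lborel (ball c r)"
          unfolding nearE[OF r, symmetric] by (rule np(1)) auto
        show "AE x in lborel. x \<in> ball c r \<longrightarrow> (\<integral>\<^sup>+y\<in>ball c (\<Lambda> * r). ennreal (norm (K (x - y)) * norm (f y)) \<partial>lborel) < \<infinity>"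
          by (rule np(2)) auto
        fix x :: "real^'n" assume x: "x \<in> ball c r"
        have "(\<integral>\<^sup>+y\<in>- ball c (2 ^ k0 * r). ennreal (norm (K (x - y) - K (c - y)) * norm (f y)) \<partial>lborel)
           \<le> ennreal ((\<Sum>j. d j * 2 powr (\<theta> * real j)) * 2 powr (\<theta> * (real k0 + 1) + b) * (C2 * C3 * W c r))"
        proof (rule far_part[OF Km _ _ r _ d smooth _ _ x])
          fix j :: nat
          have jr: "0 < 2 ^ j * r" using r by simp
          have "(\<integral>\<^sup>+y\<in>ball c (2 ^ j * r). ennreal (norm (f y) powr \<sigma>) \<partial>lborel) \<le> ennreal ((C2 * N * U c (2 ^ j * r) * (2 ^ j * r) powr b) powr \<sigma>)"
            using fI jr by blast
          also have "\<dots> \<le> ennreal ((C2 * C3 * W c r * 2 powr (\<theta> * real j) * (2 ^ j * r) powr b) powr \<sigma>)"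
          proof (intro ennreal_leI powr_mono2)
            show "0 \<le> C2 * N * U c (2 ^ j * r) * (2 ^ j * r) powr b" using C N U by simp
            have "C2 * N * U c (2 ^ j * r) \<le> C2 * N * (C3 * 2 powr (\<theta> * real j) * U c r)"
              using C N by (intro mult_left_mono) (auto simp: r)
            also have "\<dots> = C2 * C3 * W c r * 2 powr (\<theta> * real j)" by (simp add: W_def)
            finally show "C2 * N * U c (2 ^ j * r) * (2 ^ j * r) powr b \<le> C2 * C3 * W c r * 2 powr (\<theta> * real j) * (2 ^ j * r) powr b"
              by (rule mult_right_mono) simp
          qed (use \<sigma> in simp)
          finally show "(\<integral>\<^sup>+y\<in>ball c (2 ^ j * r). ennreal (norm (f y) powr \<sigma>) \<partial>lborel)
            \<le> ennreal ((C2 * C3 * W c r * 2 powr (\<theta> * real j) * (2 ^ j * r) powr b) powr \<sigma>)" .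
        qed (use \<sigma> C W in auto)
        also have "(\<Sum>j. d j * 2 powr (\<theta> * real j)) * 2 powr (\<theta> * (real k0 + 1) + b) * (C2 * C3 * W c r) = S * W c r"
          by (simp add: S_def)
        finally show "(\<integral>\<^sup>+y\<in>- ball c (\<Lambda> * r). ennreal (norm (K (x - y) - K (c - y)) * norm (f y)) \<partial>lborel) \<le> ennreal (S * W c r)"
          by (simp add: \<Lambda>_def)
      qed (use l \<Lambda> W pos r in auto)
      also have "2 powr l * ((a * W c r) powr l + (S * W c r) powr l) = (Co * (N * U c r)) powr l"
      proof -
        have "Co powr l = 2 powr l * (a powr l + S powr l)"
          using l by (simp add: Co_def powr_mult powr_powr)
        then show ?thesis
          using pos W[of c r] by (simp add: powr_mult W_def[symmetric] distrib_right mult.assoc)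
      qed
      finally show "\<exists>z. (\<integral>\<^sup>+x\<in>ball c r. ennreal (norm (convolution K f x - z) powr l) \<partial>lborel)
          \<le> ennreal ((Co * (N * U c r)) powr l) * emeasure lborel (ball c r)" .
    qed
  qed
qed

theorem theorem2p5:
  fixes \<Omega> :: "real^'n \<Rightarrow> complex" and \<omega> :: "real^'n \<Rightarrow> real"
    and s :: ennreal and n s' \<alpha> \<beta> p q \<kappa> l \<gamma> \<tau> :: real
  assumes n: "n = real CARD('n)" "2 \<le> CARD('n)"
    and \<alpha>: "0 < \<alpha>" "\<alpha> < n" "\<alpha> < 1 + n / p"
    and s: "ennreal (n / (n - \<alpha>)) < s" "s \<le> \<infinity>"
    and \<beta>: "0 < \<beta>" "\<beta> \<le> 1"
    and \<Omega>: "dini s \<beta> \<Omega>"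
    and s': "s' = enn2real (conj_exp s)"
    and p: "1 \<le> s'" "s' \<le> p" "p < n / \<alpha>"
    and q: "1 / q = 1 / p - \<alpha> / n"
    and \<kappa>: "p / q < \<kappa>" "\<kappa> < 1"
    and \<omega>: "weight \<omega>" "(\<lambda>x. \<omega> x powr s') \<in> A_class (p / s') (q / s')"
    and l: "1 \<le> l" "l < n / (n - \<alpha>)"
    and \<gamma>: "\<gamma> = n * (\<kappa> / p - 1 / q)"
    and \<tau>: "\<tau> = (if s' < p then 1 + (q / s') / enn2real (conj_exp (ennreal (p / s'))) else 1)"
    and \<tau>\<gamma>: "\<tau> * \<gamma> < \<beta>"
  shows "\<exists>C::real. C > 0 \<and>
    (\<forall>f \<in> morrey p \<kappa> (\<lambda>x. \<omega> x powr p) (\<lambda>x. \<omega> x powr q).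
       T_op \<Omega> \<alpha> f \<in> campanato \<gamma> l (\<lambda>x. \<omega> x powr q) \<and>
       campanato_norm \<gamma> l (\<lambda>x. \<omega> x powr q) (T_op \<Omega> \<alpha> f)
         \<le> ennreal C * morrey_norm p \<kappa> (\<lambda>x. \<omega> x powr p) (\<lambda>x. \<omega> x powr q) f)"
proof -
  define m where "m = n - \<alpha>"
  define \<theta> where "\<theta> = \<tau> * \<gamma>"
  define b where "b = n / s' - \<alpha>"
  have m: "0 < m" "m * l < n"
    using \<alpha> l by (auto simp: m_def field_simps)
  have n0: "0 < n" using \<alpha> by linarith
  have p0: "0 < p" using p by linarith
  have q0: "0 < q" and pq: "p < q"
  proof -
    have "\<alpha> / n < 1 / p" using p(3) p0 n0 \<alpha>(1) by (simp add: field_simps)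
    then have pos: "0 < 1 / q" using q by simp
    then show "0 < q" by simp
    have "1 / q < 1 / p" using q \<alpha>(1) n0 by simp
    then show "p < q" using \<open>0 < q\<close> p0 by (simp add: field_simps)
  qed
  have \<gamma>0: "0 < \<gamma>"
  proof -
    have "1 / q < \<kappa> / p" using \<kappa>(1) p0 q0 by (simp add: field_simps)
    then show ?thesis using n0 by (simp add: \<gamma>)
  qed
  \<comment> \<open>In both cases of its definition, \<open>\<tau>\<close> is the growth exponent of \<open>A_class_growth\<close> divided by the dimension.\<close>
  have \<tau>_eq: "\<tau> = 1 + q / s' - q / p"
  proof (cases "s' < p")
    case True
    then have a: "1 < p / s'" using p by simp
    have "enn2real (conj_exp (ennreal (p / s'))) = (p / s') / (p / s' - 1)"
      unfolding conj_exp_real[OF a] by (rule enn2real_ennreal) (use a p p0 in \<open>intro divide_nonneg_nonneg; simp\<close>)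
    also have "\<dots> = p / (p - s')" using p True by (simp add: field_simps)
    finally have "\<tau> = 1 + (q / s') / (p / (p - s'))" using True by (simp add: \<tau>)
    then show ?thesis using True p p0 by (simp add: field_simps)
  next
    case False
    then show ?thesis using p by (simp add: \<tau>)
  qed
  have \<theta>: "\<theta> < \<beta>" "\<theta> < 1" using \<tau>\<gamma> \<beta> by (auto simp: \<theta>_def)
  have n\<alpha>: "1 < n / (n - \<alpha>)" using \<alpha> by (simp add: field_simps)
  have s1: "1 < s"
  proof -
    have "1 < ennreal (n / (n - \<alpha>))" using n\<alpha> by simp
    then show ?thesis using s(1) by (rule less_trans)
  qed
  have ls: "ennreal l \<le> s" using l(2) s(1) by (meson ennreal_leI less_imp_le order_trans)
  have hom: "homogeneous_zero \<Omega>" and \<Omega>L: "\<Omega> \<in> sphere_L s" using \<Omega> by (auto simp: dini_def)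
  obtain \<Omega>' where bv: "borel_version \<Omega> \<Omega>'"
    using borel_version_exists \<Omega>L by (auto simp: sphere_L_def)
  define K where "K = kernel \<Omega>' m"
  have [measurable]: "\<Omega>' \<in> borel_measurable borel" using bv by (simp add: borel_version_def)
  have Km [measurable]: "K \<in> borel_measurable borel" unfolding K_def by measurable
  have l0: "0 < l" using l(1) by linarith
  obtain M where M: "0 \<le> M" "\<And>R. 0 < R \<Longrightarrow>
     (\<integral>\<^sup>+x\<in>ball 0 R. ennreal (norm (K x) powr l) \<partial>lborel) \<le> ennreal (M * R powr (n - m * l))"
    using kernel_local_power[OF \<Omega>L bv l0 ls m(1) m(2)[unfolded n(1)], folded n(1) K_def] by blast
  have s'0: "0 < s'" using p by linarith
  \<comment> \<open>The exponent of the radius in the local bound for \<open>f\<close> is opposite to that in the smoothness of \<open>K\<close>.\<close>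
  have b_eq: "b = m - n * (1 - 1 / s')" by (simp add: b_def m_def algebra_simps)
  show ?thesis
  proof (rule A_class_testing[OF \<omega> s'0 p(2) pq], rule kernel_smoothness[OF \<Omega> \<beta>(1) s1 s' bv m(1) \<theta>, folded K_def n(1)])
    fix C0 :: real and V :: "real^'n \<Rightarrow> real \<Rightarrow> real" and k0 :: nat and d :: "nat \<Rightarrow> real"
    assume C0: "0 < C0" and V: "\<And>c r. 0 < r \<Longrightarrow> 0 < V c r"
      "\<And>c r. 0 < r \<Longrightarrow> wmeas (\<lambda>x. \<omega> x powr q) (ball c r) = ennreal (V c r)"
      and test: "weighted_test \<omega> s' p q C0 V"
      and d: "\<And>j. 0 \<le> d j" "summable (\<lambda>j. d j * 2 powr (\<theta> * real j))"
      and smooth: "\<And>j \<rho> h. 0 < \<rho> \<Longrightarrow> norm h < 2 powr - (real j + real k0) * \<rho> \<Longrightarrow>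
        annular_bound s' \<rho> (\<lambda>y. norm (K (y + h) - K y)) (d j * \<rho> powr (n * (1 - 1 / s') - m))"
    have smooth': "annular_bound s' \<rho> (\<lambda>y. norm (K (y + h) - K y)) (d j * \<rho> powr (- b))"
      if "0 < \<rho>" "norm h < 2 powr - (real j + real k0) * \<rho>" for j \<rho> h
      using smooth[OF that] unfolding b_eq by simp
    define U where "U c r = V c r powr (\<gamma> / n)" for c r
    have U: "0 \<le> U c r" for c r by (simp add: U_def)
    define C3 where "C3 = (C0 powr (q / s')) powr (\<gamma> / n)"
    have C3: "0 \<le> C3" by (simp add: C3_def)
    have growth: "U c (2 ^ j * r) \<le> C3 * 2 powr (\<theta> * real j) * U c r" if r: "0 < r" for c r and j :: nat
    proof -
      have "V c (2 ^ j * r) \<le> C0 powr (q / s') * (2 ^ j) powr (n * (1 + q / s' - q / p)) * V c r"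
        unfolding n(1) by (rule A_class_growth[OF \<omega>(1) s'0 p(2) pq C0 V test r]) simp_all
      then have "U c (2 ^ j * r) \<le> (C0 powr (q / s') * (2 ^ j) powr (n * (1 + q / s' - q / p)) * V c r) powr (\<gamma> / n)"
        unfolding U_def using V(1)[of "2 ^ j * r" c] r \<gamma>0 n0 by (intro powr_mono2) auto
      also have "\<dots> = C3 * ((2 ^ j) powr (n * (1 + q / s' - q / p))) powr (\<gamma> / n) * U c r"
        using V(1)[OF r, of c] C0 by (simp add: powr_mult C3_def U_def)
      also have "((2 ^ j) powr (n * (1 + q / s' - q / p))) powr (\<gamma> / n) = 2 powr (\<theta> * real j)"
      proof -
        have "(2::real) ^ j = 2 powr real j" by (simp add: powr_realpow)
        moreover have "real j * (n * (1 + q / s' - q / p)) * (\<gamma> / n) = \<theta> * real j"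
          using n0 by (simp add: \<theta>_def \<tau>_eq)
        ultimately show ?thesis by (simp only: powr_powr)
      qed
      finally show ?thesis .
    qed
    define C2 where "C2 = C0 powr (1 / s') * unit_ball_vol n powr (1 / s' - \<alpha> / n)"
    have C2: "0 \<le> C2" by (simp add: C2_def)
    have "\<exists>C\<ge>0. \<forall>f N. f \<in> borel_measurable borel \<longrightarrow> 0 \<le> N \<longrightarrow>
       local_power_bound s' b (\<lambda>c r. C2 * N * U c r) f \<longrightarrow>
       mean_oscillation_bound l (\<lambda>c r. C * (N * U c r)) (convolution K f)"
    proof (rule campanato_bound[where m = m and M = M and d = d and \<theta> = \<theta> and ?k0.0 = k0 and ?C3.0 = C3])
      show "b = m - real CARD('n) * (1 - 1 / s')" using b_eq unfolding n(1) .
      show "(\<integral>\<^sup>+x\<in>ball 0 R. ennreal (norm (K x) powr l) \<partial>lborel) \<le> ennreal (M * R powr (real CARD('n) - m * l))"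
        if "0 < R" for R using M(2)[OF that] unfolding n(1) .
    qed (fact Km l(1) p(1) M(1) d smooth' U C2 C3 growth)+
    then obtain C where C: "0 \<le> C" and osc: "\<forall>f N. f \<in> borel_measurable borel \<longrightarrow> 0 \<le> N \<longrightarrow>
       local_power_bound s' b (\<lambda>c r. C2 * N * U c r) f \<longrightarrow>
       mean_oscillation_bound l (\<lambda>c r. C * (N * U c r)) (convolution K f)"
      by (elim exE conjE)
    show ?thesis
    proof (rule exI[of _ "4 * C + 1"], intro conjI ballI)
      show "0 < 4 * C + 1" using C by simp
      fix f assume f: "f \<in> morrey p \<kappa> (\<lambda>x. \<omega> x powr p) (\<lambda>x. \<omega> x powr q)"
      define T where "T = T_op \<Omega> \<alpha> f"
      have fm: "f \<in> borel_measurable lebesgue"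
        using f by (intro locally_integrable_measurable) (simp add: morrey_def)
      obtain N where N: "0 \<le> N" "morrey_norm p \<kappa> (\<lambda>x. \<omega> x powr p) (\<lambda>x. \<omega> x powr q) f = ennreal N"
        using f by (cases "morrey_norm p \<kappa> (\<lambda>x. \<omega> x powr p) (\<lambda>x. \<omega> x powr q) f") (auto simp: morrey_def)
      obtain f' where f': "f' \<in> borel_measurable borel" "AE x in lborel. f x = f' x"
        using completion_ex_borel_measurable_complex[OF fm] by auto
      have fI: "local_power_bound s' b (\<lambda>c r. C2 * N * U c r) f'"
      proof -
        have "\<gamma> / n = \<kappa> / p - 1 / q" using n0 by (simp add: \<gamma>)
        then show ?thesis
          using morrey_local_power_bound[OF N(2)[THEN eq_refl] N(1) s'0 p0 q[unfolded n(1)] C0 V test fm f'(2)]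
          unfolding b_def C2_def U_def n(1) by simp
      qed
      have T_eq: "T = convolution K f'"
        unfolding T_def K_def m_def n(1) using T_op_eq_kernel[OF bv hom f'] by blast
      have Tm: "T \<in> borel_measurable lebesgue"
      proof (rule measurable_completion)
        note [measurable] = f'(1)
        show "T \<in> borel_measurable lborel" unfolding T_eq convolution_def by measurable
      qed
      have T_osc: "mean_oscillation_bound l (\<lambda>c r. C * (N * U c r)) T"
        using osc f'(1) N(1) fI unfolding T_eq by blast
      have E0: "0 \<le> C * (N * U c r)" for c r using C N U by simp
      note camp = campanato_from_oscillation[OF Tm l(1) E0 T_osc]
      have norm_le: "campanato_norm \<gamma> l (\<lambda>x. \<omega> x powr q) T \<le> ennreal (4 * C * N)"
        unfolding campanato_norm_def
      proof (rule SUP_least)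
        fix B :: "(real^'n) \<times> real" assume "B \<in> UNIV \<times> {0<..}"
        then obtain c r where B: "B = (c, r)" and r: "0 < r" by auto
        have Ur: "0 < U c r" using V(1)[OF r, of c] by (simp add: U_def)
        have "wmeas (\<lambda>x. \<omega> x powr q) (ball c r) epow (\<gamma> / real CARD('n)) = ennreal (U c r)"
          using V[OF r, of c] by (simp add: epow_ennreal U_def n(1))
        then have "ball_avg c r (\<lambda>x. norm (T x - ball_mean c r T) powr l) epow (1 / l) / (wmeas (\<lambda>x. \<omega> x powr q) (ball c r) epow (\<gamma> / real CARD('n)))
          \<le> ennreal (4 * (C * (N * U c r))) / ennreal (U c r)"
          using camp(2)[OF r] by (simp add: divide_right_mono_ennreal)
        also have "\<dots> = ennreal (4 * C * N)" using Ur by (simp add: ennreal_divide_pos mult.assoc)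
        finally show "(case B of (c, r) \<Rightarrow> ball_avg c r (\<lambda>x. norm (T x - ball_mean c r T) powr l) epow (1 / l)
            / (wmeas (\<lambda>x. \<omega> x powr q) (ball c r) epow (\<gamma> / real CARD('n)))) \<le> ennreal (4 * C * N)"
          by (simp add: B)
      qed
      have "campanato_norm \<gamma> l (\<lambda>x. \<omega> x powr q) T < \<infinity>" using norm_le by (rule le_less_trans) simp
      then show "T_op \<Omega> \<alpha> f \<in> campanato \<gamma> l (\<lambda>x. \<omega> x powr q)"
        using camp(1) by (simp add: campanato_def T_def)
      have "ennreal (4 * C * N) \<le> ennreal ((4 * C + 1) * N)"
        using N(1) by (intro ennreal_leI mult_right_mono) auto
      also have "\<dots> = ennreal (4 * C + 1) * ennreal N" using C N(1) by (simp add: ennreal_mult)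
      finally show "campanato_norm \<gamma> l (\<lambda>x. \<omega> x powr q) (T_op \<Omega> \<alpha> f)
         \<le> ennreal (4 * C + 1) * morrey_norm p \<kappa> (\<lambda>x. \<omega> x powr p) (\<lambda>x. \<omega> x powr q) f"
        unfolding N(2) using norm_le unfolding T_def by (rule order_trans[rotated])
    qed
  qed
qed

end
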